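(* For every $n\ge 1$ one has $S_n(u,v)=C_n=\frac{1}{n+1}\binom{2n}{n}$ for each of the following pairs of patterns $(u,v)$: (1) $(0001,1012)$, (2) $(0010,0021)$, (3) $(0011,0021)$, (4) $(0021,0121)$, (5) $(0121,0132)$, (6) $(0121,1032)$, (7) $(0122,0132)$, (8) $(0122,1032)$. Moreover, for the pairs (4)–(8), one has $S_{n,m}(u,v)=N_{n,m+1}$ for all $0\le m<n$.
   Context: An ascent in a sequence $x_1\cdots x_k$ is an index $j$ with $x_j<x_{j+1}$; $\mathrm{asc}(x_1\cdots x_k)$ denotes the number of ascents. An ascent sequence of length $n$ is a sequence $x_1x_2\cdots x_n$ of non-negative integers with $x_1=0$ and $x_i\le \mathrm{asc}(x_1\cdots x_{i-1})+1$ for $1<i\le n$. A pattern is a finite sequence $\tau=\tau_1\cdots\tau_k$ of non-negative integers (repetitions allowed). A sequence $\pi$ contains $\tau$ if it has a subsequence $\pi_{f(1)}\cdots\pi_{f(k)}$ ($f(1)<\dots<f(k)$) order-isomorphic to $\tau$, i.e. $\pi_{f(i)}<\pi_{f(j)}$ iff $\tau_i<\tau_j$ and $\pi_{f(i)}>\pi_{f(j)}$ iff $\tau_i>\tau_j$ (so equal letters of $\tau$ correspond to equal letters); otherwise $\pi$ avoids $\tau$. For a set of patterns $T$, $\mathcal{S}_n(T)$ is the set of ascent sequences of length $n$ avoiding every pattern in $T$, $S_n(T)=|\mathcal{S}_n(T)|$; for $0\le m<n$, $\mathcal{S}_{n,m}(T)$ is the subset of those with exactly $m$ ascents and $S_{n,m}(T)$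 its cardinality. We write $S_n(u,v)$ for $S_n(\{u,v\})$, etc. $C_n=\frac1{n+1}\binom{2n}{n}$ is the Catalan number and $N_{n,m}=\frac1n\binom{n}{m}\binom{n}{m-1}$ ($1\le m\le n$) is the Narayana number. *)

theory Defs
  imports Complex_Main
begin

definition asc :: "nat list \<Rightarrow> nat" where
  "asc xs = card {j. Suc j < length xs \<and> xs ! j < xs ! Suc j}"

definition ascent_seq :: "nat list \<Rightarrow> bool" where
  "ascent_seq xs \<longleftrightarrow> (xs \<noteq> [] \<longrightarrow> xs ! 0 = 0) \<and>
     (\<forall>i. 0 < i \<and> i < length xs \<longrightarrow> xs ! i \<le> asc (take i xs) + 1)"

definition order_iso :: "nat list \<Rightarrow> nat list \<Rightarrow> bool" where
  "order_iso s t \<longleftrightarrow> length s = length t \<and>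
     (\<forall>i < length t. \<forall>j < length t.
        (s ! i < s ! j \<longleftrightarrow> t ! i < t ! j) \<and> (s ! i > s ! j \<longleftrightarrow> t ! i > t ! j))"

definition contains :: "nat list \<Rightarrow> nat list \<Rightarrow> bool" where
  "contains \<pi> \<tau> \<longleftrightarrow> (\<exists>f :: nat \<Rightarrow> nat.
      strict_mono_on {..<length \<tau>} f \<and> (\<forall>i < length \<tau>. f i < length \<pi>) \<and>
      order_iso (map (\<lambda>i. \<pi> ! f i) [0..<length \<tau>]) \<tau>)"

definition avoids :: "nat list \<Rightarrow> nat list \<Rightarrow> bool" where
  "avoids \<pi> \<tau> \<longleftrightarrow> \<not> contains \<pi> \<tau>"

definition Sset :: "nat list set \<Rightarrow> nat \<Rightarrow> nat list set" where
  "Sset T n = {xs. length xs = n \<and> ascent_seq xs \<and> (\<forall>\<tau>\<in>T. avoids xs \<tau>)}"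

definition S :: "nat list set \<Rightarrow> nat \<Rightarrow> nat" where
  "S T n = card (Sset T n)"

definition Sm :: "nat list set \<Rightarrow> nat \<Rightarrow> nat \<Rightarrow> nat" where
  "Sm T n m = card {xs \<in> Sset T n. asc xs = m}"

definition catalan :: "nat \<Rightarrow> real" where
  "catalan n = (1 / (real n + 1)) * real ((2 * n) choose n)"

definition narayana :: "nat \<Rightarrow> nat \<Rightarrow> real" where
  "narayana n m = (1 / real n) * real (n choose m) * real (n choose (m - 1))"

end

(* Each class is generated letter by letter, remembering only a few statistics, and the resulting
   linear recurrences have explicit solutions.

   For the five Narayana pairs only two classes occur: the ascent sequences whose letters > 0
   increase weakly, and those whose letters > 1 increase strictly. In both, the number of letters
   still available above the current maximum, and whether the last letter is 0, determine the
   possible continuations. If N = x (1 + N) (1 + t N) is the Narayana series, with t marking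
   ascents, the sequences with p such letters and nonzero last letter have the generating
   function (x t N / (1 - x))^p.

   For (0010,0021) and (0011,0021) the statistics are the least repeated letter c and the number q
   of letters >= c that may be appended; the count for length n is the coefficient of x^(n - c)
   in (x C)^q, C being the Catalan series.

   For (0001,1012) the sequences are restricted growth functions in which no letter exceeds a
   letter b that has already reappeared after some letter <= b. They are built by inserting all
   copies of a new maximum at once. The copies must fall into a certain block of consecutive
   letters, of length t say, and the series for block length t is (x C)^(2t) + (x C)^(2t+1). *)

theory Submission
  imports Defs "HOL-Computational_Algebra.Formal_Power_Series"
begin

text \<open>Each solution comes from a quadratic equation. For the Narayana pairs, subtracting the
  recurrences of two consecutive levels leaves a linear recurrence of order two in p; a geometric
  solution a^p with a = x t N / (1 - x) satisfies it exactly when N = x (1 + N) (1 + t N). In the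
  other two families, w = x C satisfies w = x + w^2. No products of N or of C are formed: their
  powers are families of series with explicit coefficients, and the main fact used about them is a
  relation between consecutive exponents (\<open>nara_fps_Suc\<close>, \<open>ballot_rec\<close>).
  The obstacle is that a sequence may arise from parents whose statistic is arbitrarily large, so
  the recurrences contain unbounded sums. These are cut off at a finite level and telescoped; the
  remainder is a series whose order exceeds the length in question.\<close>

unbundle fps_syntax

section \<open>Patterns of length four and appending a letter\<close>

lemma contains4:
  "contains s [a,b,c,d] \<longleftrightarrow> (\<exists>i j k l. i < j \<and> j < k \<and> k < l \<and> l < length s \<and>
     order_iso [s ! i, s ! j, s ! k, s ! l] [a,b,c,d])"
proof
  assume "contains s [a,b,c,d]"
  then obtain f :: "nat \<Rightarrow> nat" where f: "strict_mono_on {..<4} f" "\<forall>i<4. f i < length s"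
    "order_iso (map (\<lambda>i. s ! f i) [0..<4]) [a,b,c,d]"
    unfolding contains_def by (auto simp: eval_nat_numeral)
  have "map (\<lambda>i. s ! f i) [0..<4] = [s ! f 0, s ! f 1, s ! f 2, s ! f 3]"
    by (simp add: upt_rec numeral_eq_Suc)
  moreover have "f 0 < f 1" "f 1 < f 2" "f 2 < f 3"
    using f(1) by (auto simp: strict_mono_on_def)
  moreover have "f 3 < length s" using f(2) by simp
  ultimately show "\<exists>i j k l. i < j \<and> j < k \<and> k < l \<and> l < length s \<and>
     order_iso [s ! i, s ! j, s ! k, s ! l] [a,b,c,d]"
    using f(3) by metis
next
  assume "\<exists>i j k l. i < j \<and> j < k \<and> k < l \<and> l < length s \<and>
     order_iso [s ! i, s ! j, s ! k, s ! l] [a,b,c,d]"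
  then obtain i j k l where h: "i < j" "j < k" "k < l" "l < length s"
    "order_iso [s ! i, s ! j, s ! k, s ! l] [a,b,c,d]" by blast
  define f where "f = (\<lambda>n. [i,j,k,l] ! n)"
  have "strict_mono_on {..<4} f" using h unfolding strict_mono_on_def f_def
    by (auto simp: less_Suc_eq numeral_eq_Suc)
  moreover have "\<forall>n<4. f n < length s" using h unfolding f_def
    by (auto simp: less_Suc_eq numeral_eq_Suc)
  moreover have "map (\<lambda>n. s ! f n) [0..<4] = [s ! i, s ! j, s ! k, s ! l]"
    by (simp add: upt_rec f_def numeral_eq_Suc)
  ultimately show "contains s [a,b,c,d]"
    unfolding contains_def using h(5) by (intro exI[of _ f]) (auto simp: eval_nat_numeral)
qed

lemma all_less_four: "(\<forall>i<Suc (Suc (Suc (Suc 0))). P i) \<longleftrightarrow> P 0 \<and> P 1 \<and> P 2 \<and> P 3"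
  by (auto simp: less_Suc_eq numeral_eq_Suc)

lemma order_iso4:
  "order_iso [x,y,z,w] [a,b,c,d] \<longleftrightarrow>
     ((x < y) = (a < b)) \<and> ((y < x) = (b < a)) \<and> ((x < z) = (a < c)) \<and> ((z < x) = (c < a)) \<and>
     ((x < w) = (a < d)) \<and> ((w < x) = (d < a)) \<and> ((y < z) = (b < c)) \<and> ((z < y) = (c < b)) \<and>
     ((y < w) = (b < d)) \<and> ((w < y) = (d < b)) \<and> ((z < w) = (c < d)) \<and> ((w < z) = (d < c))"
  unfolding order_iso_def
  by (simp add: all_less_four) argo

text \<open>Of the twelve comparisons in \<open>order_iso4\<close>, those between letters adjacent
  in the sorted order of the pattern imply the others; hence the short chains here and in the lemmas
  that follow.\<close>

lemma contains_0001: "contains s [0,0,0,1] \<longleftrightarrow>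
  (\<exists>i j k l. i < j \<and> j < k \<and> k < l \<and> l < length s \<and> s!i = s!j \<and> s!j = s!k \<and> s!k < s!l)"
  unfolding contains4 order_iso4 by (intro ex_cong1, simp, intro iffI; elim conjE; intro conjI; linarith)
lemma contains_1012: "contains s [1,0,1,2] \<longleftrightarrow>
  (\<exists>i j k l. i < j \<and> j < k \<and> k < l \<and> l < length s \<and> s!j < s!i \<and> s!i = s!k \<and> s!k < s!l)"
  unfolding contains4 order_iso4 by (intro ex_cong1, simp, intro iffI; elim conjE; intro conjI; linarith)
lemma contains_0010: "contains s [0,0,1,0] \<longleftrightarrow>
  (\<exists>i j k l. i < j \<and> j < k \<and> k < l \<and> l < length s \<and> s!i = s!j \<and> s!i = s!l \<and> s!l < s!k)"
  unfolding contains4 order_iso4 by (intro ex_cong1, simp, intro iffI; elim conjE; intro conjI; linarith)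
lemma contains_0021: "contains s [0,0,2,1] \<longleftrightarrow>
  (\<exists>i j k l. i < j \<and> j < k \<and> k < l \<and> l < length s \<and> s!i = s!j \<and> s!i < s!l \<and> s!l < s!k)"
  unfolding contains4 order_iso4 by (intro ex_cong1, simp, intro iffI; elim conjE; intro conjI; linarith)
lemma contains_0011: "contains s [0,0,1,1] \<longleftrightarrow>
  (\<exists>i j k l. i < j \<and> j < k \<and> k < l \<and> l < length s \<and> s!i = s!j \<and> s!i < s!l \<and> s!l = s!k)"
  unfolding contains4 order_iso4 by (intro ex_cong1, simp, intro iffI; elim conjE; intro conjI; linarith)
lemma contains_0121: "contains s [0,1,2,1] \<longleftrightarrow>
  (\<exists>i j k l. i < j \<and> j < k \<and> k < l \<and> l < length s \<and> s!i < s!j \<and> s!j = s!l \<and> s!l < s!k)"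
  unfolding contains4 order_iso4 by (intro ex_cong1, simp, intro iffI; elim conjE; intro conjI; linarith)
lemma contains_0122: "contains s [0,1,2,2] \<longleftrightarrow>
  (\<exists>i j k l. i < j \<and> j < k \<and> k < l \<and> l < length s \<and> s!i < s!j \<and> s!j < s!l \<and> s!l = s!k)"
  unfolding contains4 order_iso4 by (intro ex_cong1, simp, intro iffI; elim conjE; intro conjI; linarith)
lemma contains_0132: "contains s [0,1,3,2] \<longleftrightarrow>
  (\<exists>i j k l. i < j \<and> j < k \<and> k < l \<and> l < length s \<and> s!i < s!j \<and> s!j < s!l \<and> s!l < s!k)"
  unfolding contains4 order_iso4 by (intro ex_cong1, simp, intro iffI; elim conjE; intro conjI; linarith)
lemma contains_1032: "contains s [1,0,3,2] \<longleftrightarrow>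
  (\<exists>i j k l. i < j \<and> j < k \<and> k < l \<and> l < length s \<and> s!j < s!i \<and> s!i < s!l \<and> s!l < s!k)"
  unfolding contains4 order_iso4 by (intro ex_cong1, simp, intro iffI; elim conjE; intro conjI; linarith)

lemma asc_snoc: "asc (s @ [x]) = asc s + (if s \<noteq> [] \<and> last s < x then 1 else 0)"
proof (cases "s = []")
  case True then show ?thesis by (simp add: asc_def)
next
  case False
  let ?A = "{j. Suc j < length s \<and> s ! j < s ! Suc j}"
  have fin: "finite ?A" by (rule finite_subset[of _ "{..<length s}"]) auto
  have "{j. Suc j < length (s@[x]) \<and> (s@[x]) ! j < (s@[x]) ! Suc j} =
        ?A \<union> (if last s < x then {length s - 1} else {})"
  proof -
    obtain m where m: "length s = Suc m" using False by (cases "length s") auto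
    have "(Suc j < Suc (Suc m) \<and> (s@[x]) ! j < (s@[x]) ! Suc j) =
      ((Suc j < Suc m \<and> s ! j < s ! Suc j) \<or> j = m \<and> last s < x)" for j
      using m False by (cases "j = m") (auto simp: nth_append last_conv_nth)
    then show ?thesis using m by auto
  qed
  moreover have "length s - 1 \<notin> ?A" using False by auto
  ultimately show ?thesis using fin False unfolding asc_def by simp
qed

lemma ascent_seq_snoc:
  "ascent_seq (s @ [x]) \<longleftrightarrow> ascent_seq s \<and> x \<le> (if s = [] then 0 else asc s + 1)"
proof (cases "s = []")
  case True then show ?thesis by (simp add: ascent_seq_def)
next
  case False
  have *: "(s @ [x]) ! i = s ! i" "take i (s @ [x]) = take i s" if "i < length s" for i
    using that by (auto simp: nth_append)
  show ?thesis
  proof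
    assume h: "ascent_seq (s @ [x])"
    have "(s@[x]) ! length s \<le> asc (take (length s) (s@[x])) + 1"
      using h False unfolding ascent_seq_def by (metis length_append_singleton length_greater_0_conv lessI)
    then have "x \<le> asc s + 1" by simp
    moreover have "ascent_seq s" using h False unfolding ascent_seq_def
      by (metis * append_is_Nil_conv length_append_singleton length_greater_0_conv less_SucI)
    ultimately show "ascent_seq s \<and> x \<le> (if s = [] then 0 else asc s + 1)" using False by simp
  next
    assume h: "ascent_seq s \<and> x \<le> (if s = [] then 0 else asc s + 1)"
    show "ascent_seq (s @ [x])" using h False unfolding ascent_seq_def
      by (auto simp: less_Suc_eq * nth_append)
  qed
qed

lemma ascent_seq_single: "ascent_seq [x] \<longleftrightarrow> x = 0"
  by (simp add: ascent_seq_def)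

lemma ascent_seq_Nil: "ascent_seq []" by (simp add: ascent_seq_def)

lemma ascent_seq_take: "ascent_seq s \<Longrightarrow> ascent_seq (take i s)"
proof (induction s rule: rev_induct)
  case (snoc x s) then show ?case by (cases "i \<le> length s") (auto simp: ascent_seq_snoc)
qed simp

lemma ascent_seq_nth_0: "ascent_seq s \<Longrightarrow> s \<noteq> [] \<Longrightarrow> s ! 0 = 0"
  by (simp add: ascent_seq_def)

text \<open>As long as the last letter equals the number of ascents, the bound
  \<open>asc s + 1\<close> lets the next letter rise by at most one, and such a rise is itself an
  ascent.\<close>

lemma sorted_ascent_seq:
  assumes "ascent_seq s" "sorted s" "s \<noteq> []"
  shows "set s = {..last s} \<and> asc s = last s"
  using assms
proof (induction s rule: rev_induct)
  case (snoc x s)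
  show ?case
  proof (cases "s = []")
    case True then show ?thesis using snoc by (auto simp: ascent_seq_single asc_def)
  next
    case False
    then have "set s = {..last s} \<and> asc s = last s" using snoc by (auto simp: ascent_seq_snoc sorted_append)
    moreover have "last s \<le> x" using snoc.prems False by (auto simp: sorted_append)
    moreover have "x \<le> asc s + 1" using snoc.prems False by (auto simp: ascent_seq_snoc)
    ultimately have "set s = {..last s}" "asc s = last s" "x = last s \<or> x = Suc (last s)" by auto
    then show ?thesis using False
      by (elim disjE) (simp_all add: asc_snoc atMost_Suc insert_absorb)
  qed
qed simp

lemma finite_ascent_seq: "finite {s. length s = n \<and> ascent_seq s}"
proof (induction n)
  case (Suc n)
  have "{s. length s = Suc n \<and> ascent_seq s} \<subseteq>
    (\<Union>s \<in> {s. length s = n \<and> ascent_seq s}. (\<lambda>x. s @ [x]) ` {..asc s + 1})"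
  proof
    fix s assume s: "s \<in> {s. length s = Suc n \<and> ascent_seq s}"
    then obtain u x where "s = u @ [x]" by (cases s rule: rev_cases) auto
    then show "s \<in> (\<Union>s \<in> {s. length s = n \<and> ascent_seq s}. (\<lambda>x. s @ [x]) ` {..asc s + 1})"
      using s by (auto simp: ascent_seq_snoc split: if_splits)
  qed
  then show ?case by (rule finite_subset) (use Suc in auto)
qed simp

text \<open>Source of the letter-by-letter recurrences: \<open>X s\<close> is the set of letters
  that may follow \<open>s\<close>, and \<open>f\<close> is a weight or an indicator of a
  statistic.\<close>

lemma sum_snoc:
  fixes f :: "nat list \<Rightarrow> 'b :: comm_monoid_add"
  assumes fin: "finite {s \<in> K. length s = n}" "\<And>s. s \<in> K \<Longrightarrow> length s = n \<Longrightarrow> finite (X s)"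
    and ch: "\<And>s x. length s = n \<Longrightarrow> s @ [x] \<in> K \<longleftrightarrow> s \<in> K \<and> x \<in> X s"
  shows "(\<Sum>s\<in>{s \<in> K. length s = Suc n}. f s) = (\<Sum>s\<in>{s \<in> K. length s = n}. \<Sum>x\<in>X s. f (s @ [x]))"
proof -
  let ?S = "SIGMA s:{s \<in> K. length s = n}. X s"
  have "{s \<in> K. length s = Suc n} = (\<lambda>(s,x). s @ [x]) ` ?S"
  proof safe
    fix s assume "s \<in> K" "length s = Suc n"
    then show "s \<in> (\<lambda>(s,x). s @ [x]) ` ?S" using ch by (cases s rule: rev_cases) force+
  qed (use ch in auto)
  moreover have "inj_on (\<lambda>(s,x). s @ [x]) ?S" by (auto simp: inj_on_def)
  ultimately have "(\<Sum>s\<in>{s \<in> K. length s = Suc n}. f s) = (\<Sum>(s,x)\<in>?S. f (s @ [x]))"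
    by (simp add: sum.reindex case_prod_unfold)
  also have "\<dots> = (\<Sum>s\<in>{s \<in> K. length s = n}. \<Sum>x\<in>X s. f (s @ [x]))"
    using fin by (subst sum.Sigma) auto
  finally show ?thesis .
qed

text \<open>Only the last index of an occurrence can be the new position. Suitable choices of
  \<open>P\<close> in this and the next two lemmas cover repetitions, forbidden letters and whole
  patterns.\<close>

lemma ex2_snoc:
  "(\<exists>i j. i < j \<and> j < length (s @ [x]) \<and> P ((s @ [x]) ! i) ((s @ [x]) ! j)) \<longleftrightarrow>
   (\<exists>i j. i < j \<and> j < length s \<and> P (s ! i) (s ! j)) \<or> (\<exists>i<length s. P (s ! i) x)" (is "?L \<longleftrightarrow> ?M \<or> ?N")
proof
  assume ?L
  then obtain i j where h: "i < j" "j < Suc (length s)" "P ((s @ [x]) ! i) ((s @ [x]) ! j)" by auto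
  then show "?M \<or> ?N" by (cases "j = length s") (auto simp: nth_append)
next
  assume "?M \<or> ?N"
  then show ?L
  proof
    assume ?M
    then obtain i j where "i < j" "j < length s" "P (s ! i) (s ! j)" by blast
    then show ?L by (intro exI[of _ i] exI[of _ j]) (simp add: nth_append)
  next
    assume ?N
    then obtain i where "i < length s" "P (s ! i) x" by blast
    then show ?L by (intro exI[of _ i] exI[of _ "length s"]) (simp add: nth_append)
  qed
qed

lemma ex3_snoc:
  "(\<exists>i j k. i < j \<and> j < k \<and> k < length (s @ [x]) \<and> P ((s @ [x]) ! i) ((s @ [x]) ! j) ((s @ [x]) ! k)) \<longleftrightarrow>
   (\<exists>i j k. i < j \<and> j < k \<and> k < length s \<and> P (s ! i) (s ! j) (s ! k)) \<or>
   (\<exists>i j. i < j \<and> j < length s \<and> P (s ! i) (s ! j) x)" (is "?L \<longleftrightarrow> ?M \<or> ?N")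
proof
  assume ?L
  then obtain i j k where h: "i < j" "j < k" "k < Suc (length s)" "P ((s @ [x]) ! i) ((s @ [x]) ! j) ((s @ [x]) ! k)" by auto
  show "?M \<or> ?N"
  proof (cases "k = length s")
    case True
    then have "P (s ! i) (s ! j) x" using h by (simp add: nth_append)
    then show ?thesis using h True by blast
  next
    case False
    then have "P (s ! i) (s ! j) (s ! k)" "k < length s" using h by (simp_all add: nth_append)
    then show ?thesis using h by blast
  qed
next
  assume "?M \<or> ?N"
  then show ?L
  proof
    assume ?M
    then obtain i j k where "i < j" "j < k" "k < length s" "P (s ! i) (s ! j) (s ! k)" by blast
    then show ?L by (intro exI[of _ i] exI[of _ j] exI[of _ k]) (simp add: nth_append)
  next
    assume ?N
    then obtain i j where "i < j" "j < length s" "P (s ! i) (s ! j) x" by blast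
    then show ?L by (intro exI[of _ i] exI[of _ j] exI[of _ "length s"]) (simp add: nth_append)
  qed
qed

lemma ex4_snoc:
  "(\<exists>i j k l. i < j \<and> j < k \<and> k < l \<and> l < length (s @ [x]) \<and>
      P ((s @ [x]) ! i) ((s @ [x]) ! j) ((s @ [x]) ! k) ((s @ [x]) ! l)) \<longleftrightarrow>
   (\<exists>i j k l. i < j \<and> j < k \<and> k < l \<and> l < length s \<and> P (s ! i) (s ! j) (s ! k) (s ! l)) \<or>
   (\<exists>i j k. i < j \<and> j < k \<and> k < length s \<and> P (s ! i) (s ! j) (s ! k) x)" (is "?L \<longleftrightarrow> ?M \<or> ?N")
proof
  assume ?L
  then obtain i j k l where h: "i < j" "j < k" "k < l" "l < Suc (length s)"
    "P ((s @ [x]) ! i) ((s @ [x]) ! j) ((s @ [x]) ! k) ((s @ [x]) ! l)" by auto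
  show "?M \<or> ?N"
  proof (cases "l = length s")
    case True
    then have "P (s ! i) (s ! j) (s ! k) x" using h by (simp add: nth_append)
    then show ?thesis using h True by blast
  next
    case False
    then have "P (s ! i) (s ! j) (s ! k) (s ! l)" "l < length s" using h by (simp_all add: nth_append)
    then show ?thesis using h by blast
  qed
next
  assume "?M \<or> ?N"
  then show ?L
  proof
    assume ?M
    then obtain i j k l where "i < j" "j < k" "k < l" "l < length s" "P (s ! i) (s ! j) (s ! k) (s ! l)" by blast
    then show ?L by (intro exI[of _ i] exI[of _ j] exI[of _ k] exI[of _ l]) (simp add: nth_append)
  next
    assume ?N
    then obtain i j k where "i < j" "j < k" "k < length s" "P (s ! i) (s ! j) (s ! k) x" by blast
    then show ?L by (intro exI[of _ i] exI[of _ j] exI[of _ k] exI[of _ "length s"]) (simp add: nth_append)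
  qed
qed

section \<open>The Narayana pairs\<close>

definition weakly_incr :: "nat list set" where
  "weakly_incr = {s. ascent_seq s \<and> sorted_wrt (\<lambda>a b. 0 < b \<longrightarrow> a \<le> b) s}"

definition strictly_incr :: "nat list set" where
  "strictly_incr = {s. ascent_seq s \<and> sorted_wrt (\<lambda>a b. 1 < b \<longrightarrow> a < b) s}"

text \<open>Taking the left end of a violation as far left as possible makes every earlier letter
  obey \<open>R\<close> towards all its successors, which controls the prefix in front of
  it.\<close>

lemma minimal_violation:
  assumes "\<not> sorted_wrt R s"
  obtains i j where "i < j" "j < length s" "\<not> R (s ! i) (s ! j)"
    "\<And>p q. p < i \<Longrightarrow> p < q \<Longrightarrow> q < length s \<Longrightarrow> R (s ! p) (s ! q)"
proof -
  define Q where "Q i = (\<exists>j. i < j \<and> j < length s \<and> \<not> R (s ! i) (s ! j))" for i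
  have "\<exists>i. Q i" using assms unfolding Q_def sorted_wrt_iff_nth_less by blast
  then have "Q (LEAST i. Q i)" by (rule LeastI_ex)
  moreover have "\<And>p. p < (LEAST i. Q i) \<Longrightarrow> \<not> Q p" by (rule not_less_Least)
  ultimately show thesis using that unfolding Q_def by blast
qed

text \<open>A weakly increasing prefix uses every value up to its last letter, so a missing value forces a descent.\<close>

lemma descent_or_all_values:
  assumes "ascent_seq s" "i < length s"
  obtains p q where "p < q" "q \<le> i" "s ! q < s ! p"
  | "\<And>v. v \<le> s ! i \<Longrightarrow> \<exists>p\<le>i. s ! p = v"
proof (cases "sorted (take (Suc i) s)")
  case True
  let ?u = "take (Suc i) s"
  have "?u \<noteq> []" "last ?u = s ! i" using assms(2) by (auto simp: take_Suc_conv_app_nth)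
  then have u: "set ?u = {..s ! i}"
    using sorted_ascent_seq[OF ascent_seq_take[OF assms(1)] True] by metis
  have "\<exists>p\<le>i. s ! p = v" if "v \<le> s ! i" for v
  proof -
    have "v \<in> set ?u" using u that by auto
    then show ?thesis using assms(2) unfolding in_set_conv_nth by (auto simp: less_Suc_eq_le)
  qed
  then show thesis using that(2) by blast
next
  case False
  then obtain p q where pq: "p < q" "q < length (take (Suc i) s)"
    "\<not> take (Suc i) s ! p \<le> take (Suc i) s ! q"
    unfolding sorted_wrt_iff_nth_less by blast
  then have "q \<le> i" "s ! q < s ! p" using assms(2) by (auto simp: not_le)
  then show thesis using that(1) pq(1) by blast
qed

text \<open>All four patterns end in a descent to a letter that is not the smallest, hence in a
  descent to a positive letter.\<close>

lemma weakly_incr_imp_avoids: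
  assumes "s \<in> weakly_incr"
  shows "avoids s [0,0,2,1]" "avoids s [0,1,2,1]" "avoids s [0,1,3,2]" "avoids s [1,0,3,2]"
proof -
  have R: "0 < s ! q \<Longrightarrow> s ! p \<le> s ! q" if "p < q" "q < length s" for p q
    using assms that unfolding weakly_incr_def sorted_wrt_iff_nth_less by blast
  have *: "\<not> (\<exists>i j k l. i < j \<and> j < k \<and> k < l \<and> l < length s \<and> P i j k l)"
    if "\<And>i j k l. P i j k l \<Longrightarrow> 0 < s ! l \<and> s ! l < s ! k" for P
  proof clarify
    fix i j k l assume "k < l" "l < length s" "P i j k l"
    then show False using that[of i j k l] R[of k l] by linarith
  qed
  show "avoids s [0,0,2,1]" unfolding avoids_def contains_0021 by (rule *) auto
  show "avoids s [0,1,2,1]" unfolding avoids_def contains_0121 by (rule *) auto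
  show "avoids s [0,1,3,2]" unfolding avoids_def contains_0132 by (rule *) auto
  show "avoids s [1,0,3,2]" unfolding avoids_def contains_1032 by (rule *) auto
qed

text \<open>In all three patterns the last letter exceeds two different letters, so it is at least 2
  in the sequence, and the letter before it is at least as large.\<close>

lemma strictly_incr_imp_avoids:
  assumes "s \<in> strictly_incr"
  shows "avoids s [0,1,2,2]" "avoids s [0,1,3,2]" "avoids s [1,0,3,2]"
proof -
  have R: "1 < s ! q \<Longrightarrow> s ! p < s ! q" if "p < q" "q < length s" for p q
    using assms that unfolding strictly_incr_def sorted_wrt_iff_nth_less by blast
  have *: "\<not> (\<exists>i j k l. i < j \<and> j < k \<and> k < l \<and> l < length s \<and> P i j k l)"
    if "\<And>i j k l. P i j k l \<Longrightarrow> 1 < s ! l \<and> s ! l \<le> s ! k" for P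
  proof clarify
    fix i j k l assume "k < l" "l < length s" "P i j k l"
    then show False using that[of i j k l] R[of k l] by linarith
  qed
  show "avoids s [0,1,2,2]" unfolding avoids_def contains_0122 by (rule *) auto
  show "avoids s [0,1,3,2]" unfolding avoids_def contains_0132 by (rule *) auto
  show "avoids s [1,0,3,2]" unfolding avoids_def contains_1032 by (rule *) auto
qed

text \<open>Let i < j be a violation with i minimal. If there is a descent p < q up to i, minimality
  forces \<open>s ! q = 0\<close> and \<open>s ! p \<le> s ! j\<close>. Equality gives 0121 on 0, p,
  i, j; otherwise 0, q, i, j form 0021, while 0, p, i, j form 0132 and p, q, i, j form 1032. Without
  a descent the value \<open>s ! j\<close> occurs before i and yields 0121. The disjunction serves
  all three pairs, each of which contains 0121.\<close>

lemma not_weakly_incr_imp_contains: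
  assumes "ascent_seq s" "s \<notin> weakly_incr"
  shows "contains s [0,1,2,1] \<or>
    contains s [0,0,2,1] \<and> contains s [0,1,3,2] \<and> contains s [1,0,3,2]"
proof -
  obtain i j where ij: "i < j" "j < length s" "0 < s ! j" "s ! j < s ! i"
    and least: "\<And>p q. p < i \<Longrightarrow> p < q \<Longrightarrow> q < length s \<Longrightarrow> 0 < s ! q \<Longrightarrow> s ! p \<le> s ! q"
    using minimal_violation[of "\<lambda>a b. 0 < b \<longrightarrow> a \<le> b" s] assms unfolding weakly_incr_def
    by (metis (no_types, lifting) mem_Collect_eq not_le)
  have s0: "s ! 0 = 0" using ascent_seq_nth_0[OF assms(1)] ij by fastforce
  have c: "contains s [0,1,2,1]" if "p \<le> i" "s ! p = s ! j" for p
  proof -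
    have "p \<noteq> 0" "p \<noteq> i" using that ij s0 by (metis less_irrefl)+
    then have "0 < p" "p < i" using that by auto
    then show ?thesis unfolding contains_0121 using that ij s0 by metis
  qed
  have "i < length s" using ij by simp
  from assms(1) this show ?thesis
  proof (cases rule: descent_or_all_values)
    case (1 p q)
    have "p < i" "q < length s" "p < j" using 1 ij by auto
    then have q0: "s ! q = 0" using least[of p q] 1 by linarith
    then have "q < i" using 1 ij by (metis le_neq_implies_less not_less_zero)
    have pj: "s ! p \<le> s ! j" using least[of p j] \<open>p < i\<close> ij by auto
    show ?thesis
    proof (cases "s ! p = s ! j")
      case True then show ?thesis using c[of p] \<open>p < i\<close> by simp
    next
      case False
      then have pj: "s ! p < s ! j" using pj by simp
      have "0 < p" using 1 s0 by (metis gr0I not_less_zero)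
      have "contains s [0,0,2,1]" unfolding contains_0021
        using s0 q0 \<open>q < i\<close> ij 1 by (metis gr_implies_not_zero not_gr_zero)
      moreover have "contains s [0,1,3,2]" unfolding contains_0132
        using s0 q0 \<open>0 < p\<close> \<open>p < i\<close> ij pj 1 by metis
      moreover have "contains s [1,0,3,2]" unfolding contains_1032
        using \<open>q < i\<close> ij pj 1 by blast
      ultimately show ?thesis by simp
    qed
  next
    case 2
    then show ?thesis using c ij by (metis less_imp_le)
  qed
qed

text \<open>Let i < j be a violation with i minimal. A 0 and a 1 in front of i give 0122 if the two
  letters are equal and 0132 otherwise. In the latter case, a descent up to i starts below
  \<open>s ! j\<close> by minimality, so it ends before i and yields 1032; without a descent
  \<open>s ! j\<close> would occur before i, against minimality.\<close>

lemma not_strictly_incr_imp_contains: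
  assumes "ascent_seq s" "s \<notin> strictly_incr"
  shows "contains s [0,1,2,2] \<or> contains s [0,1,3,2] \<and> contains s [1,0,3,2]"
proof -
  obtain i j where ij: "i < j" "j < length s" "1 < s ! j" "s ! j \<le> s ! i"
    and least: "\<And>p q. p < i \<Longrightarrow> p < q \<Longrightarrow> q < length s \<Longrightarrow> 1 < s ! q \<Longrightarrow> s ! p < s ! q"
    using minimal_violation[of "\<lambda>a b. 1 < b \<longrightarrow> a < b" s] assms unfolding strictly_incr_def
    by (metis (no_types, lifting) mem_Collect_eq not_less)
  have s0: "s ! 0 = 0" using ascent_seq_nth_0[OF assms(1)] ij by fastforce
  \<comment> \<open>The first nonzero letter has no ascent in front of it, so it is 1.\<close>
  have one: "\<exists>p. 0 < p \<and> p < i \<and> s ! p = 1"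
  proof -
    have i1: "1 < s ! i" "i < length s" using ij by auto
    define f where "f = (LEAST p. s ! p \<noteq> 0)"
    have "s ! i \<noteq> 0" using i1 by simp
    then have f: "s ! f \<noteq> 0" "f \<le> i" unfolding f_def by (rule LeastI, rule Least_le)
    have f0: "s ! p = 0" if "p < f" for p using not_less_Least[OF that[unfolded f_def]] by simp
    have "0 < f" using f s0 by (metis gr0I)
    have "asc (take f s) = 0" unfolding asc_def
      using f0 by (auto simp: card_eq_0_iff)
    then have "s ! f \<le> 1" using assms(1) \<open>0 < f\<close> f i1 unfolding ascent_seq_def
      by (metis add_0 le_less_trans)
    then have "s ! f = 1" using f by simp
    moreover have "f \<noteq> i" using calculation i1 by auto
    ultimately show ?thesis using \<open>0 < f\<close> f by (metis le_neq_implies_less)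
  qed
  show ?thesis
  proof (cases "s ! j = s ! i")
    case True
    then have "contains s [0,1,2,2]" unfolding contains_0122 using one s0 ij
      by (metis zero_less_one)
    then show ?thesis by simp
  next
    case False
    then have lt: "s ! j < s ! i" using ij by simp
    have "contains s [0,1,3,2]" unfolding contains_0132 using one s0 ij lt by (metis zero_less_one)
    moreover
    have "i < length s" using ij by simp
    from assms(1) this have "contains s [1,0,3,2]"
    proof (cases rule: descent_or_all_values)
      case (1 p q)
      have "p < i" "p < j" using 1 ij by auto
      then have pj: "s ! p < s ! j" using least[of p j] ij by simp
      then have "q \<noteq> i" using 1 lt by auto
      then show ?thesis unfolding contains_1032 using pj lt 1 ij by (metis le_neq_implies_less)
    next
      case 2
      then obtain p where p: "p \<le> i" "s ! p = s ! j" using lt by (metis less_imp_le)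
      then have "p < i" using lt by (metis le_neq_implies_less less_irrefl)
      then show ?thesis using least[of p j] p ij by simp
    qed
    ultimately show ?thesis by simp
  qed
qed

lemma Sset_eq_weakly_incr:
  "Sset {[0,0,2,1],[0,1,2,1]} n = {s \<in> weakly_incr. length s = n}"
  "Sset {[0,1,2,1],[0,1,3,2]} n = {s \<in> weakly_incr. length s = n}"
  "Sset {[0,1,2,1],[1,0,3,2]} n = {s \<in> weakly_incr. length s = n}"
proof -
  have a: "s \<in> weakly_incr \<Longrightarrow> ascent_seq s" for s by (simp add: weakly_incr_def)
  note h = not_weakly_incr_imp_contains weakly_incr_imp_avoids a
  show "Sset {[0,0,2,1],[0,1,2,1]} n = {s \<in> weakly_incr. length s = n}"
    unfolding Sset_def using h by (auto simp: avoids_def)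
  show "Sset {[0,1,2,1],[0,1,3,2]} n = {s \<in> weakly_incr. length s = n}"
    unfolding Sset_def using h by (auto simp: avoids_def)
  show "Sset {[0,1,2,1],[1,0,3,2]} n = {s \<in> weakly_incr. length s = n}"
    unfolding Sset_def using h by (auto simp: avoids_def)
qed

lemma Sset_eq_strictly_incr:
  "Sset {[0,1,2,2],[0,1,3,2]} n = {s \<in> strictly_incr. length s = n}"
  "Sset {[0,1,2,2],[1,0,3,2]} n = {s \<in> strictly_incr. length s = n}"
proof -
  have a: "s \<in> strictly_incr \<Longrightarrow> ascent_seq s" for s by (simp add: strictly_incr_def)
  note h = not_strictly_incr_imp_contains strictly_incr_imp_avoids a
  show "Sset {[0,1,2,2],[0,1,3,2]} n = {s \<in> strictly_incr. length s = n}"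
    unfolding Sset_def using h by (auto simp: avoids_def)
  show "Sset {[0,1,2,2],[1,0,3,2]} n = {s \<in> strictly_incr. length s = n}"
    unfolding Sset_def using h by (auto simp: avoids_def)
qed

section \<open>Powers of the Narayana series, given by their coefficients\<close>

text \<open>The coefficient of \<open>x^n t^m\<close> in \<open>N^p\<close> by Lagrange inversion, where \<open>N = x (1 + N) (1 + t N)\<close>.
  For \<open>n = 0\<close> the division by zero gives 0, so \<open>nara_fps\<close> treats that case separately.\<close>

definition nara :: "nat \<Rightarrow> nat \<Rightarrow> nat \<Rightarrow> real" where
  "nara n p m = real p / real n * real (n choose m) * real (n choose (m + p))"

lemma choose_Suc_absorb:
  "real (Suc n) * real (n choose k) = (real (Suc n) - real k) * real (Suc n choose k)"
  "real (Suc n) * real (n choose k) = real (Suc k) * real (Suc n choose Suc k)"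
proof -
  show "real (Suc n) * real (n choose k) = (real (Suc n) - real k) * real (Suc n choose k)"
  proof (cases "k \<le> Suc n")
    case True
    have "(Suc n - k) * (Suc n choose k) = Suc n * (n choose k)"
      using binomial_absorb_comp[of "Suc n" k] by simp
    then show ?thesis using True by (metis of_nat_diff of_nat_mult)
  qed (simp add: binomial_eq_0)
  show "real (Suc n) * real (n choose k) = real (Suc k) * real (Suc n choose Suc k)"
    using Suc_times_binomial_eq[of n k] by (metis mult.commute of_nat_mult)
qed

text \<open>Coefficient form of N^(p+1) = x (1 + N) (1 + t N) N^p with the product expanded.\<close>

lemma nara_Suc:
  assumes "0 < n"
  shows "nara (Suc n) (Suc p) (Suc m) =
    nara n p (Suc m) + nara n (Suc p) (Suc m) + nara n (Suc p) m + nara n (Suc (Suc p)) m"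
proof -
  define N where "N = real (Suc n)"
  define a b where "a = real (n choose m)" and "b = real (n choose Suc m)"
  define e f where "e = real (n choose (Suc m + p))" and "f = real (n choose Suc (Suc m + p))"
  define B B' where "B = real (Suc n choose Suc m)" and "B' = real (Suc n choose Suc (Suc m + p))"
  have N: "N > 0" by (simp add: N_def)
  have ab: "N * a = real (Suc m) * B" "N * b = (N - real (Suc m)) * B"
    using choose_Suc_absorb unfolding N_def a_def b_def B_def by blast+
  have ef: "N * e = real (Suc (Suc m + p)) * B'" "N * f = (N - real (Suc (Suc m + p))) * B'"
    using choose_Suc_absorb unfolding N_def e_def f_def B'_def by blast+
  \<comment> \<open>The four terms on the right add up to \<open>real (Suc p) * B * B'\<close> minus
    this determinant, over n; absorption evaluates the determinant as the same product over
    \<open>N\<close>.\<close>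
  have "N * (N * (b * e - a * f)) = (N * b) * (N * e) - (N * a) * (N * f)" by algebra
  also have "\<dots> = N * real (Suc p) * B * B'" unfolding ab ef by (simp add: algebra_simps)
  finally have key: "N * (b * e - a * f) = real (Suc p) * B * B'" using N by simp
  have BB: "B = a + b" "B' = e + f"
    unfolding a_def b_def e_def f_def B_def B'_def by simp_all
  have "real n = N - 1" "real n \<noteq> 0" using assms by (simp_all add: N_def)
  have "nara (Suc n) (Suc p) (Suc m) = real (Suc p) * B * B' / N"
    unfolding nara_def N_def B_def B'_def by simp
  moreover have "nara n p (Suc m) + nara n (Suc p) (Suc m) + nara n (Suc p) m + nara n (Suc (Suc p)) m
     = (real p * b * e + real (Suc p) * b * f + real (Suc p) * a * e + real (Suc (Suc p)) * a * f) / real n"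
    unfolding nara_def a_def b_def e_def f_def
    by (simp add: add_divide_distrib del: of_nat_Suc)
  moreover have "real p * b * e + real (Suc p) * b * f + real (Suc p) * a * e + real (Suc (Suc p)) * a * f
     = real (Suc p) * B * B' - (b * e - a * f)" unfolding BB by (simp add: algebra_simps)
  moreover have "real (Suc p) * B * B' / N = (real (Suc p) * B * B' - (b * e - a * f)) / real n"
    unfolding key[symmetric] \<open>real n = N - 1\<close>
    using N \<open>real n \<noteq> 0\<close> \<open>real n = N - 1\<close> by (simp add: field_simps)
  ultimately show ?thesis by simp
qed

text \<open>The coefficient of t^0, to which the two terms of the expanded product with a factor t
  do not contribute.\<close>

lemma nara_Suc_0:
  assumes "0 < n"
  shows "nara (Suc n) (Suc p) 0 = nara n p 0 + nara n (Suc p) 0"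
proof -
  define e f where "e = real (n choose p)" and "f = real (n choose Suc p)"
  have "real (Suc n) * e = real (Suc p) * (e + f)"
    using choose_Suc_absorb(2)[of n p] unfolding e_def f_def by simp
  then have "real (Suc p) * (e + f) / real (Suc n) = e" by (simp add: field_simps)
  moreover have "real (Suc n) * e - e = real (Suc p) * (e + f) - e"
    using \<open>real (Suc n) * e = real (Suc p) * (e + f)\<close> by simp
  then have "real n * e = real p * e + real (Suc p) * f" by (simp add: algebra_simps)
  then have "e = (real p * e + real (Suc p) * f) / real n" using assms by (simp add: field_simps)
  ultimately show ?thesis unfolding nara_def e_def f_def using assms
    by (simp add: add_divide_distrib del: of_nat_Suc)
qed

definition nara_fps :: "real \<Rightarrow> nat \<Rightarrow> real fps" where
  "nara_fps t p = Abs_fps (\<lambda>n. if n = 0 then (if p = 0 then 1 else 0)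
     else \<Sum>m\<le>n. nara n p m * t ^ m)"

lemma nara_fps_0: "nara_fps t 0 = 1"
  by (rule fps_ext) (simp add: nara_fps_def nara_def)

text \<open>The equation for N multiplied by N^p. The case n = 0 is separate because
  \<open>nara_Suc\<close> divides by n.\<close>

lemma nara_fps_Suc:
  "nara_fps t (Suc p) = fps_X * (nara_fps t p + nara_fps t (Suc p) +
     fps_const t * nara_fps t (Suc p) + fps_const t * nara_fps t (Suc (Suc p)))"
proof (rule fps_ext)
  fix k
  show "nara_fps t (Suc p) $ k = (fps_X * (nara_fps t p + nara_fps t (Suc p) +
     fps_const t * nara_fps t (Suc p) + fps_const t * nara_fps t (Suc (Suc p)))) $ k"
  proof (cases k)
    case 0 then show ?thesis by (simp add: nara_fps_def)
  next
    case k: (Suc n)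
    show ?thesis
    proof (cases "n = 0")
      case True then show ?thesis using k by (simp add: nara_fps_def nara_def)
    next
      case False
      have top: "nara n q (Suc n) = 0" for q by (simp add: nara_def)
      have shift: "(\<Sum>m\<le>n. nara n q m * t ^ m) = nara n q 0 + (\<Sum>m\<le>n. nara n q (Suc m) * t ^ Suc m)" for q
        using sum.atMost_Suc_shift[of "\<lambda>m. nara n q m * t ^ m" n]
        by (simp add: top del: sum.atMost_Suc_shift)
      have "(\<Sum>m\<le>Suc n. nara (Suc n) (Suc p) m * t ^ m) = nara (Suc n) (Suc p) 0 +
         (\<Sum>m\<le>n. nara (Suc n) (Suc p) (Suc m) * t ^ Suc m)"
        by (subst sum.atMost_Suc_shift) simp
      also have "\<dots> = (nara n p 0 + (\<Sum>m\<le>n. nara n p (Suc m) * t ^ Suc m)) +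
         (nara n (Suc p) 0 + (\<Sum>m\<le>n. nara n (Suc p) (Suc m) * t ^ Suc m)) +
         t * (\<Sum>m\<le>n. nara n (Suc p) m * t ^ m) + t * (\<Sum>m\<le>n. nara n (Suc (Suc p)) m * t ^ m)"
        using False by (simp add: nara_Suc nara_Suc_0 algebra_simps sum.distrib sum_distrib_left)
      also have "\<dots> = (\<Sum>m\<le>n. nara n p m * t ^ m) + (\<Sum>m\<le>n. nara n (Suc p) m * t ^ m) +
         t * (\<Sum>m\<le>n. nara n (Suc p) m * t ^ m) + t * (\<Sum>m\<le>n. nara n (Suc (Suc p)) m * t ^ m)"
        by (simp only: shift[symmetric])
      finally show ?thesis using k False by (simp add: nara_fps_def)
    qed
  qed
qed

text \<open>Reflecting the second binomial coefficient turns the sum into a Vandermonde convolution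
  with value (2n choose n-1); dividing by n gives the Catalan number.\<close>

lemma sum_narayana:
  assumes "0 < n"
  shows "(\<Sum>m<n. narayana n (m + 1)) = catalan n"
proof -
  obtain k where n: "n = Suc k" using assms gr0_implies_Suc by auto
  have "(\<Sum>m<n. (n choose m) * (n choose (m + 1))) = (\<Sum>m\<le>k. (n choose m) * (n choose (k - m)))"
    unfolding n lessThan_Suc_atMost
  proof (rule sum.cong)
    fix m assume "m \<in> {..k}"
    then show "(Suc k choose m) * (Suc k choose (m + 1)) = (Suc k choose m) * (Suc k choose (k - m))"
      by (subst binomial_symmetric) auto
  qed simp
  also have "\<dots> = (2 * n) choose k" using vandermonde[of n n k] by (simp add: mult_2)
  finally have v: "(\<Sum>m<n. (n choose m) * (n choose (m + 1))) = (2 * n) choose k" .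
  have "(2 * n - k) * (2 * n choose k) = n * (2 * n choose n)"
    using binomial_absorb_comp[of "2 * n" k] times_binomial_minus1_eq[of n "2 * n"] n by simp
  then have "real (n + 1) * real (2 * n choose k) = real n * real (2 * n choose n)"
    using n by (metis (no_types, lifting) add_diff_cancel_right' mult_2 of_nat_mult plus_1_eq_Suc add.commute
        Suc_diff_le add_diff_cancel_left' diff_Suc_Suc le_add1 le_add2 diff_add_inverse2 add_Suc_right)
  then have "real (2 * n choose k) / real n = catalan n"
    using assms unfolding catalan_def by (simp add: field_simps)
  moreover have "(\<Sum>m<n. narayana n (m + 1)) = real (\<Sum>m<n. (n choose m) * (n choose (m + 1))) / real n"
    unfolding narayana_def by (simp add: sum_divide_distrib mult.commute)
  ultimately show ?thesis unfolding v by simp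
qed

section \<open>Level series and their telescoping sums\<close>

abbreviation geom :: "real fps" where "geom \<equiv> Abs_fps (\<lambda>_. 1)"

lemma geom_eq: "geom = 1 + fps_X * geom"
  by (rule fps_ext) (simp add: fps_X_mult_nth)

text \<open>The device that removes the remainders of telescoping sums at a fixed length.\<close>

lemma fps_nth_power_mult_eq_0:
  fixes y :: "real fps"
  assumes "y $ 0 = 0" "n < k"
  shows "(y ^ k * g) $ n = 0"
  using assms(2)
proof (induction k arbitrary: n)
  case (Suc k)
  have "y $ i * (y ^ k * g) $ (n - i) = 0" if "i \<le> n" for i
  proof (cases "i = 0")
    case False
    then have "n - i < k" using Suc.prems that by auto
    then show ?thesis using Suc.IH by simp
  qed (use assms(1) in simp)
  then have "(\<Sum>i=0..n. y $ i * (y ^ k * g) $ (n - i)) = 0" by (intro sum.neutral) simp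
  then show ?case by (simp add: mult.assoc fps_mult_nth[of y])
qed simp

text \<open>Generating function of the sequences with \<open>room\<close> (defined below) equal to \<open>p\<close> and nonzero last letter,
  for \<open>p > 0\<close>; those with last letter 0 get an additional factor \<open>x / (1 - x)\<close>.
  The series \<open>level_tail t p\<close> is the sum of \<open>level_fps t j\<close> over all \<open>j > p\<close>.\<close>

definition level_fps :: "real \<Rightarrow> nat \<Rightarrow> real fps" where
  "level_fps t p = (fps_const t * fps_X * geom) ^ p * nara_fps t p"

definition level_tail :: "real \<Rightarrow> nat \<Rightarrow> real fps" where
  "level_tail t p = (fps_const t * fps_X * geom) ^ p *
     ((1 - fps_X) * nara_fps t (Suc p) - fps_X * nara_fps t p)"

text \<open>With y = x t / (1 - x) the tail is the geometric series y^(p+1) N^(p+1) / (1 - y N),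
  cleared of its denominator by the equation for N. In this form consecutive tails differ by one
  level.\<close>

lemma sum_level_fps:
  assumes "p \<le> J"
  shows "(\<Sum>j\<in>{Suc p..J}. level_fps t j) = level_tail t p - level_tail t J"
proof -
  define y where "y = fps_const t * fps_X * geom"
  have y: "y = fps_const t * fps_X + fps_X * y"
    unfolding y_def using geom_eq by (metis (no_types, lifting) distrib_left mult.left_commute mult.right_neutral)
  have step: "level_tail t j - level_tail t (Suc j) = level_fps t (Suc j)" for j
  proof -
    define P Q R where "P = nara_fps t j" "Q = nara_fps t (Suc j)" "R = nara_fps t (Suc (Suc j))"
    have q: "Q = fps_X * (P + Q + fps_const t * Q + fps_const t * R)"
      unfolding P_Q_R_def by (rule nara_fps_Suc)
    have "((1 - fps_X) * Q - fps_X * P) - y * ((1 - fps_X) * R - fps_X * Q) = y * Q"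
      using q y by algebra
    then show ?thesis
      unfolding level_tail_def level_fps_def y_def[symmetric] P_Q_R_def[symmetric] power_Suc
      by (metis (no_types, lifting) mult.assoc mult.commute right_diff_distrib)
  qed
  show ?thesis using assms
  proof (induction J rule: dec_induct)
    case (step j)
    then show ?case using step(1) \<open>\<And>j. level_tail t j - level_tail t (Suc j) = level_fps t (Suc j)\<close>[of j]
      by (simp add: algebra_simps)
  qed simp
qed

lemma level_fps_0: "level_fps t 0 = 1"
  by (simp add: level_fps_def nara_fps_0)

lemma level_fps_nth: "n < p \<Longrightarrow> level_fps t p $ n = 0"
  unfolding level_fps_def by (rule fps_nth_power_mult_eq_0) simp_all

text \<open>The relation among the series that corresponds to the recurrence
  \<open>weight_Suc_False\<close> of the counts.\<close>

lemma level_fps_Suc_nth: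
  assumes "p \<le> n" 
  shows "level_fps t (Suc p) $ Suc n = level_fps t (Suc p) $ n +
    t * ((\<Sum>j\<in>{Suc p..n}. level_fps t j $ n) + (\<Sum>j\<in>{p..n}. (fps_X * geom * level_fps t j) $ n))"
proof -
  define y where "y = fps_const t * fps_X * geom"
  \<comment> \<open>The upper limit is \<open>Suc n\<close> rather than n: the remainder then
    contains y^(n+2) and does not reach the coefficient \<open>Suc n\<close>.\<close>
  define L where "L = (\<Sum>j\<in>{Suc p..Suc n}. level_fps t j)"
  have y: "y = fps_const t * fps_X + fps_X * y"
    unfolding y_def using geom_eq by (metis (no_types, lifting) distrib_left mult.left_commute mult.right_neutral)
  have L: "L = level_tail t p - level_tail t (Suc n)"
    unfolding L_def using assms by (intro sum_level_fps) simp
  have split: "(\<Sum>j\<in>{p..Suc n}. fps_X * geom * level_fps t j) = fps_X * geom * (level_fps t p + L)"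
    unfolding L_def using assms
    by (simp add: sum.atLeast_Suc_atMost[of p] sum_distrib_left distrib_left)
  have a: "level_tail t p = y ^ p * ((1 - fps_X) * nara_fps t (Suc p) - fps_X * nara_fps t p)"
     "level_fps t p = y ^ p * nara_fps t p" "level_fps t (Suc p) = y * y ^ p * nara_fps t (Suc p)"
    unfolding level_tail_def level_fps_def y_def by simp_all
  have "fps_const t * fps_X * (L + fps_X * geom * (level_fps t p + L)) =
      fps_const t * fps_X * ((1 + fps_X * geom) * L) + fps_X * y * level_fps t p"
    unfolding y_def by algebra
  also have "\<dots> = y * L + fps_X * y * level_fps t p"
    unfolding geom_eq[symmetric] y_def by (simp add: mult_ac)
  also have "\<dots> = (1 - fps_X) * level_fps t (Suc p) - y * level_tail t (Suc n)"
    unfolding L a by algebra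
  finally have *: "level_fps t (Suc p) = fps_X * level_fps t (Suc p) + y * level_tail t (Suc n) +
      fps_X * (fps_const t * (L + (\<Sum>j\<in>{p..Suc n}. fps_X * geom * level_fps t j)))"
    unfolding split by (simp add: algebra_simps)
  have z: "(y * level_tail t (Suc n)) $ Suc n = 0"
    unfolding y_def level_tail_def mult.assoc[symmetric] power_Suc[symmetric]
    by (rule fps_nth_power_mult_eq_0) simp_all
  have "level_fps t (Suc p) $ Suc n = level_fps t (Suc p) $ n +
      t * (L $ n + (\<Sum>j\<in>{p..Suc n}. (fps_X * geom * level_fps t j)) $ n)"
    by (subst *) (simp add: z del: fps_mult_nth)
  moreover have "L $ n = (\<Sum>j\<in>{Suc p..n}. level_fps t j $ n)"
    unfolding L_def using assms by (simp add: fps_sum_nth level_fps_nth)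
  moreover have "(\<Sum>j\<in>{p..Suc n}. (fps_X * geom * level_fps t j)) $ n =
     (\<Sum>j\<in>{p..n}. (fps_X * geom * level_fps t j) $ n)"
  proof -
    have "(fps_X * geom * level_fps t (Suc n)) $ n = 0"
      unfolding level_fps_def using fps_nth_power_mult_eq_0[of "fps_const t * fps_X * geom" n "Suc n" "fps_X * geom * nara_fps t (Suc n)"]
      by (simp add: mult_ac)
    then show ?thesis using assms by (simp add: fps_sum_nth)
  qed
  ultimately show ?thesis by simp
qed

lemma level_geom_nth: "n < p \<Longrightarrow> (fps_X * geom * level_fps t p) $ n = 0"
  unfolding level_fps_def using fps_nth_power_mult_eq_0[of "fps_const t * fps_X * geom" n p "fps_X * geom * nara_fps t p"]
  by (simp add: mult_ac)

text \<open>Each level p > 0 occurs with factor 1 + x / (1 - x) = 1 / (1 - x), and level 0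
  contributes x / (1 - x). The total is (x + \<open>level_tail t 0\<close>) / (1 - x), where
  \<open>level_tail t 0\<close> is (1 - x) N - x.\<close>

lemma level_total:
  "(\<Sum>p\<le>n. (fps_X * geom * level_fps t p) $ n) + (\<Sum>p\<in>{Suc 0..n}. level_fps t p $ n) = nara_fps t 1 $ n"
proof -
  define L where "L = (\<Sum>j\<in>{Suc 0..Suc n}. level_fps t j)"
  have "(\<Sum>p\<le>Suc n. fps_X * geom * level_fps t p) = fps_X * geom * (1 + L)"
    unfolding L_def using sum.atLeast_Suc_atMost[of 0 "Suc n" "\<lambda>p. level_fps t p"]
    by (simp add: sum_distrib_left[symmetric] atMost_atLeast0 level_fps_0)
  then have "(\<Sum>p\<le>Suc n. fps_X * geom * level_fps t p) + L = (1 + fps_X * geom) * L + fps_X * geom"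
    by (simp add: algebra_simps)
  also have "\<dots> = geom * L + fps_X * geom" by (simp only: geom_eq[symmetric])
  also have "\<dots> = geom * (level_tail t 0 - level_tail t (Suc n)) + fps_X * geom"
    unfolding L_def by (subst sum_level_fps) simp_all
  also have "\<dots> = nara_fps t 1 - geom * level_tail t (Suc n)"
  proof -
    have "level_tail t 0 = (1 - fps_X) * nara_fps t 1 - fps_X" by (simp add: level_tail_def nara_fps_0)
    moreover have "geom * (1 - fps_X) = 1" using geom_eq by algebra
    ultimately show ?thesis by algebra
  qed
  finally have *: "(\<Sum>p\<le>Suc n. fps_X * geom * level_fps t p) + L = nara_fps t 1 - geom * level_tail t (Suc n)" .
  have "(geom * level_tail t (Suc n)) $ n = 0"
    unfolding level_tail_def using fps_nth_power_mult_eq_0[of "fps_const t * fps_X * geom" n "Suc n"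
      "geom * ((1 - fps_X) * nara_fps t (Suc (Suc n)) - fps_X * nara_fps t (Suc n))"]
    by (simp add: mult.left_commute)
  then have "((\<Sum>p\<le>Suc n. fps_X * geom * level_fps t p) + L) $ n = nara_fps t 1 $ n" unfolding * by simp
  then show ?thesis unfolding L_def by (simp add: fps_sum_nth level_geom_nth level_fps_nth)
qed

section \<open>Counting along the generating tree\<close>

text \<open>The maximum is replaced by 1 for the all-zero sequences, which makes them behave like the other
  sequences ending in 0, with \<open>room = 0\<close>.\<close>

definition top_letter :: "nat list \<Rightarrow> nat" where
  "top_letter s = Max (insert 1 (set s))"

definition room :: "nat list \<Rightarrow> nat" where
  "room s = asc s + 1 - top_letter s"

lemma top_letter_snoc: "top_letter (s @ [x]) = max (top_letter s) x"
proof -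
  have "insert 1 (set (s @ [x])) = insert x (insert 1 (set s))" by auto
  then show ?thesis unfolding top_letter_def by (simp add: max.commute del: insert_commute)
qed

lemma top_letter_ge: "x \<in> set s \<Longrightarrow> x \<le> top_letter s" "1 \<le> top_letter s"
  unfolding top_letter_def by auto

lemma top_letter_less_iff: "top_letter s < x \<longleftrightarrow> 1 < x \<and> (\<forall>y\<in>set s. y < x)"
  unfolding top_letter_def by auto

lemma asc_le_length: "asc s \<le> length s"
proof -
  have "{j. Suc j < length s \<and> s ! j < s ! Suc j} \<subseteq> {..<length s}" by auto
  then have "card {j. Suc j < length s \<and> s ! j < s ! Suc j} \<le> card {..<length s}"
    by (rule card_mono[rotated]) simp
  then show ?thesis by (simp add: asc_def)
qed

lemma sum_level_indicator:
  fixes f :: "'a \<Rightarrow> real" and n p :: nat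
  assumes "finite A" "\<And>s. s \<in> A \<Longrightarrow> g s \<le> n"
  shows "(\<Sum>j\<in>{p..n}. \<Sum>s\<in>A. if g s = j \<and> P s then f s else 0) = (\<Sum>s\<in>A. if p \<le> g s \<and> P s then f s else 0)"
proof (subst sum.swap, rule sum.cong)
  fix s assume "s \<in> A"
  then have "g s \<le> n" using assms by simp
  have "(\<Sum>j\<in>{p..n}. if g s = j \<and> P s then f s else 0) = (\<Sum>j\<in>{p..n}. if j = g s then (if P s then f s else 0) else 0)"
    by (rule sum.cong) auto
  also have "\<dots> = (if p \<le> g s \<and> P s then f s else 0)" using \<open>g s \<le> n\<close> by (simp add: sum.delta)
  finally show "(\<Sum>j\<in>{p..n}. if g s = j \<and> P s then f s else 0) = (if p \<le> g s \<and> P s then f s else 0)" .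
qed simp

text \<open>Besides 0 and the letters above the maximum there is exactly one further letter \<open>r s\<close> that
  may be appended, and it creates an ascent only after a 0.\<close>

locale narayana_tree =
  fixes K :: "nat list set" and r :: "nat list \<Rightarrow> nat"
  assumes ascent: "s \<in> K \<Longrightarrow> ascent_seq s"
    and single: "[0] \<in> K"
    and snoc: "s \<noteq> [] \<Longrightarrow> s @ [x] \<in> K \<longleftrightarrow> s \<in> K \<and> (x = 0 \<or> x = r s \<or> top_letter s < x \<and> x \<le> asc s + 1)"
    and r_bounds: "s \<in> K \<Longrightarrow> s \<noteq> [] \<Longrightarrow> 0 < r s \<and> r s \<le> top_letter s"
    and r_last: "s \<in> K \<Longrightarrow> s \<noteq> [] \<Longrightarrow> last s \<noteq> 0 \<Longrightarrow> r s \<le> last s"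
begin

lemma finite_level: "finite {s \<in> K. length s = n}"
  by (rule finite_subset[OF _ finite_ascent_seq[of n]]) (use ascent in auto)

lemma level_1: "{s \<in> K. length s = 1} = {[0]}"
proof (intro set_eqI iffI)
  fix s assume "s \<in> {s \<in> K. length s = 1}"
  then show "s \<in> {[0]}" using ascent[of s] by (cases s) (auto simp: ascent_seq_single)
qed (use single in simp)

text \<open>Keeps the truncated subtraction in \<open>room\<close> exact.\<close>

lemma top_le:
  assumes "s \<in> K" "s \<noteq> []" shows "top_letter s \<le> asc s + 1"
  using assms
proof (induction s rule: rev_induct)
  case (snoc x s)
  show ?case
  proof (cases "s = []")
    case True then show ?thesis using snoc ascent[of "[x]"] by (simp add: top_letter_def ascent_seq_single)
  next
    case False
    then have s: "s \<in> K" "x = 0 \<or> x = r s \<or> top_letter s < x \<and> x \<le> asc s + 1"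
      using snoc.prems narayana_tree.snoc[OF narayana_tree_axioms] by auto
    moreover have "last s \<le> top_letter s" using False by (simp add: top_letter_ge)
    ultimately show ?thesis using snoc.IH False r_bounds[of s] by (auto simp: top_letter_snoc asc_snoc)
  qed
qed simp

definition weight :: "real \<Rightarrow> nat \<Rightarrow> nat \<Rightarrow> bool \<Rightarrow> real" where
  "weight t n p z = (\<Sum>s\<in>{s \<in> K. length s = n}. if room s = p \<and> (last s = 0) = z then t ^ asc s else 0)"

lemma sum_children:
  fixes f :: "nat list \<Rightarrow> real"
  assumes "0 < n"
  shows "(\<Sum>s\<in>{s \<in> K. length s = Suc n}. f s) =
    (\<Sum>s\<in>{s \<in> K. length s = n}. f (s @ [0]) + f (s @ [r s]) + (\<Sum>x\<in>{top_letter s<..asc s + 1}. f (s @ [x])))"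
proof -
  let ?X = "\<lambda>s. insert 0 (insert (r s) {top_letter s<..asc s + 1})"
  have "(\<Sum>s\<in>{s \<in> K. length s = Suc n}. f s) = (\<Sum>s\<in>{s \<in> K. length s = n}. \<Sum>x\<in>?X s. f (s @ [x]))"
  proof (rule sum_snoc[OF finite_level])
    fix s :: "nat list" and x assume "length s = n"
    then have "s \<noteq> []" using assms by auto
    then show "s @ [x] \<in> K \<longleftrightarrow> s \<in> K \<and> x \<in> ?X s" using snoc[of s x] by auto
  qed simp
  also have "\<dots> = (\<Sum>s\<in>{s \<in> K. length s = n}. f (s @ [0]) + f (s @ [r s]) + (\<Sum>x\<in>{top_letter s<..asc s + 1}. f (s @ [x])))"
  proof (rule sum.cong)
    fix s assume "s \<in> {s \<in> K. length s = n}"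
    then have "0 < r s \<and> r s \<le> top_letter s" using r_bounds[of s] assms by auto
    then show "(\<Sum>x\<in>?X s. f (s @ [x])) = f (s @ [0]) + f (s @ [r s]) + (\<Sum>x\<in>{top_letter s<..asc s + 1}. f (s @ [x]))"
      by simp
  qed simp
  finally show ?thesis .
qed

lemma child_0:
  assumes "s \<in> K" "s \<noteq> []"
  shows "room (s @ [0]) = room s" "asc (s @ [0]) = asc s"
  by (simp_all add: room_def top_letter_snoc asc_snoc)

text \<open>After a 0, the letter \<open>r s\<close> makes an ascent without raising the maximum;
  this is the only way to gain room.\<close>

lemma child_r:
  assumes "s \<in> K" "s \<noteq> []"
  shows "room (s @ [r s]) = room s + (if last s = 0 then 1 else 0)"
    "asc (s @ [r s]) = asc s + (if last s = 0 then 1 else 0)"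
proof -
  show "asc (s @ [r s]) = asc s + (if last s = 0 then 1 else 0)"
    using r_bounds[OF assms] r_last[OF assms] assms
    by (cases "last s = 0") (auto simp: asc_snoc)
  then show "room (s @ [r s]) = room s + (if last s = 0 then 1 else 0)"
    using r_bounds[OF assms] top_le[OF assms] by (auto simp: room_def top_letter_snoc max_absorb1)
qed

lemma child_above:
  assumes "s \<in> K" "s \<noteq> []" "top_letter s < x"
  shows "room (s @ [x]) = asc s + 2 - x" "asc (s @ [x]) = asc s + 1"
proof -
  have "last s < x" using top_letter_ge(1)[of "last s" s] assms by simp
  then show "asc (s @ [x]) = asc s + 1" using assms by (simp add: asc_snoc)
  then show "room (s @ [x]) = asc s + 2 - x" using assms by (simp add: room_def top_letter_snoc)
qed

lemma weight_Suc_True: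
  assumes "0 < n"
  shows "weight t (Suc n) p True = weight t n p True + weight t n p False"
proof -
  have "weight t (Suc n) p True = (\<Sum>s\<in>{s \<in> K. length s = n}. if room s = p then t ^ asc s else 0)"
    unfolding weight_def sum_children[OF assms]
  proof (rule sum.cong)
    fix s assume s: "s \<in> {s \<in> K. length s = n}"
    then have "s \<noteq> []" "s \<in> K" using assms by auto
    moreover have "(\<Sum>x\<in>{top_letter s<..asc s + 1}. if room (s @ [x]) = p \<and> (last (s @ [x]) = 0) = True then t ^ asc (s @ [x]) else 0) = 0"
      by (rule sum.neutral) auto
    ultimately show "(if room (s @ [0]) = p \<and> (last (s @ [0]) = 0) = True then t ^ asc (s @ [0]) else 0) +
      (if room (s @ [r s]) = p \<and> (last (s @ [r s]) = 0) = True then t ^ asc (s @ [r s]) else 0) +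
      (\<Sum>x\<in>{top_letter s<..asc s + 1}. if room (s @ [x]) = p \<and> (last (s @ [x]) = 0) = True then t ^ asc (s @ [x]) else 0) =
      (if room s = p then t ^ asc s else 0)"
      using child_0[of s] r_bounds[of s] by simp
  qed simp
  also have "\<dots> = weight t n p True + weight t n p False"
    unfolding weight_def sum.distrib[symmetric] by (rule sum.cong) auto
  finally show ?thesis .
qed

lemma room_le: "s \<in> K \<Longrightarrow> room s \<le> length s"
  using asc_le_length[of s] top_letter_ge(2)[of s] unfolding room_def by linarith

text \<open>A new maximum is at most \<open>asc s + 1\<close> and adds an ascent, so it leaves room;
  \<open>r s\<close> gains room after a 0 and otherwise keeps the positive room. Hence room 0 occurs
  only with last letter 0.\<close>

lemma room_pos:
  assumes "s \<in> K" "s \<noteq> []" "last s \<noteq> 0" shows "0 < room s"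
  using assms
proof (induction s rule: rev_induct)
  case (snoc x s)
  show ?case
  proof (cases "s = []")
    case True then show ?thesis using snoc ascent[of "[x]"] by (simp add: ascent_seq_single)
  next
    case False
    then have s: "s \<in> K" "x = 0 \<or> x = r s \<or> top_letter s < x \<and> x \<le> asc s + 1"
      using snoc.prems narayana_tree.snoc[OF narayana_tree_axioms] by auto
    then consider "x = r s" | "top_letter s < x" "x \<le> asc s + 1" using snoc.prems by auto
    then show ?thesis
    proof cases
      case 1 then show ?thesis using child_r[OF s(1) False] snoc.IH s(1) False by auto
    next
      case 2 then show ?thesis using child_above[OF s(1) False] by simp
    qed
  qed
qed simp

text \<open>Appending \<open>r s\<close> keeps the room after a nonzero letter and raises it from p
  after a 0. Among the new maxima only \<open>asc s + 1 - p\<close> produces room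
  \<open>Suc p\<close>, and it is available exactly if the room was at least \<open>Suc p\<close>.
  So the second sum starts at p and the first at \<open>Suc p\<close>.\<close>

lemma weight_Suc_False:
  assumes "0 < n"
  shows "weight t (Suc n) (Suc p) False = weight t n (Suc p) False +
    t * ((\<Sum>j\<in>{Suc p..n}. weight t n j False) + (\<Sum>j\<in>{p..n}. weight t n j True))"
proof -
  let ?A = "{s \<in> K. length s = n}"
  let ?g = "\<lambda>s. if room s = Suc p \<and> (last s = 0) = False then t ^ asc s else 0"
  have A: "finite ?A" "\<And>s. s \<in> ?A \<Longrightarrow> room s \<le> n" using finite_level room_le by auto
  have I: "(\<Sum>j\<in>{q..n}. \<Sum>s\<in>?A. if room s = j \<and> (last s = 0) = z then f s else 0) =
      (\<Sum>s\<in>?A. if q \<le> room s \<and> (last s = 0) = z then f s else 0)" for q z and f :: "nat list \<Rightarrow> real"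
    by (rule sum_level_indicator[OF A, where P = "\<lambda>s. (last s = 0) = z"])
  have "(\<Sum>s\<in>{s \<in> K. length s = Suc n}. ?g s) =
    (\<Sum>s\<in>?A. ?g s + (if Suc p \<le> room s \<and> (last s = 0) = False then t * t ^ asc s else 0)
         + (if p \<le> room s \<and> (last s = 0) = True then t * t ^ asc s else 0))"
    unfolding sum_children[OF assms]
  proof (rule sum.cong)
    fix s assume "s \<in> ?A"
    then have s: "s \<in> K" "s \<noteq> []" using assms by auto
    have "(\<Sum>x\<in>{top_letter s<..asc s + 1}. ?g (s @ [x])) =
      (\<Sum>x\<in>{top_letter s<..asc s + 1}. if x = asc s + 1 - p then (if p < asc s + 1 then t * t ^ asc s else 0) else 0)"
      using top_letter_ge(2)[of s] by (intro sum.cong) (auto simp: child_above[OF s])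
    also have "\<dots> = (if Suc p \<le> room s then t * t ^ asc s else 0)"
      using top_le[OF s] by (auto simp: room_def)
    finally have 1: "(\<Sum>x\<in>{top_letter s<..asc s + 1}. ?g (s @ [x])) = (if Suc p \<le> room s then t * t ^ asc s else 0)" .
    have 2: "?g (s @ [0]) = 0" by simp
    have 3: "?g (s @ [r s]) = (if room s + (if last s = 0 then 1 else 0) = Suc p then t ^ (asc s + (if last s = 0 then 1 else 0)) else 0)"
      using r_bounds[OF s] by (simp add: child_r[OF s])
    show "?g (s @ [0]) + ?g (s @ [r s]) + (\<Sum>x\<in>{top_letter s<..asc s + 1}. ?g (s @ [x])) =
      ?g s + (if Suc p \<le> room s \<and> (last s = 0) = False then t * t ^ asc s else 0)
         + (if p \<le> room s \<and> (last s = 0) = True then t * t ^ asc s else 0)"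
      unfolding 1 2 3 by auto
  qed simp
  also have "\<dots> = weight t n (Suc p) False +
    (\<Sum>j\<in>{Suc p..n}. \<Sum>s\<in>?A. if room s = j \<and> (last s = 0) = False then t * t ^ asc s else 0) +
    (\<Sum>j\<in>{p..n}. \<Sum>s\<in>?A. if room s = j \<and> (last s = 0) = True then t * t ^ asc s else 0)"
    by (simp only: I sum.distrib weight_def)
  also have "(\<Sum>j\<in>{Suc p..n}. \<Sum>s\<in>?A. if room s = j \<and> (last s = 0) = False then t * t ^ asc s else 0) =
     t * (\<Sum>j\<in>{Suc p..n}. weight t n j False)"
    unfolding weight_def sum_distrib_left by (intro sum.cong) auto
  also have "(\<Sum>j\<in>{p..n}. \<Sum>s\<in>?A. if room s = j \<and> (last s = 0) = True then t * t ^ asc s else 0) =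
     t * (\<Sum>j\<in>{p..n}. weight t n j True)"
    unfolding weight_def sum_distrib_left by (intro sum.cong) auto
  finally show ?thesis unfolding weight_def[symmetric] by (simp add: distrib_left)
qed

lemma weight_eq:
  assumes "0 < n"
  shows "weight t n (Suc p) False = level_fps t (Suc p) $ n \<and> weight t n 0 False = 0 \<and>
    weight t n p True = (fps_X * geom * level_fps t p) $ n"
  using assms
proof (induction n arbitrary: p rule: nat_induct_non_zero)
  case 1
  have "room [0] = 0" by (simp add: room_def top_letter_def asc_def)
  have w: "weight t 1 q z = (if q = 0 \<and> z then 1 else 0)" for q z
    unfolding weight_def level_1 using \<open>room [0] = 0\<close> by (auto simp: asc_def)
  have "level_fps t (Suc p) $ 1 = 0"
  proof -
    have "level_fps t (Suc p) = fps_X ^ Suc p * ((fps_const t * geom) ^ Suc p * nara_fps t (Suc p))"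
      unfolding level_fps_def by (simp add: power_mult_distrib mult_ac)
    moreover have "((fps_const t * geom) ^ Suc p * nara_fps t (Suc p)) $ 0 = 0" by (simp add: nara_fps_def)
    ultimately show ?thesis by (simp add: fps_X_power_mult_nth)
  qed
  moreover have "(fps_X * geom * level_fps t p) $ 1 = (if p = 0 then 1 else 0)"
    using level_fps_0[of t] level_fps_nth[of 0 p t] by (auto simp: mult.assoc)
  ultimately show ?case unfolding w by simp
next
  case (Suc n)
  have F: "weight t n (Suc q) False = level_fps t (Suc q) $ n" and F0: "weight t n 0 False = 0"
    and T: "weight t n q True = (fps_X * geom * level_fps t q) $ n" for q using Suc.IH by blast+
  have W: "weight t n j False = level_fps t j $ n" if "0 < j" for j
    using F that by (cases j) auto
  have a: "weight t (Suc n) (Suc p) False = level_fps t (Suc p) $ Suc n"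
  proof (cases "p \<le> n")
    case True
    have "(\<Sum>j\<in>{Suc p..n}. weight t n j False) = (\<Sum>j\<in>{Suc p..n}. level_fps t j $ n)"
      by (rule sum.cong) (auto simp: W)
    then show ?thesis
      unfolding weight_Suc_False[OF Suc.hyps] level_fps_Suc_nth[OF True] by (simp only: F T)
  next
    case False
    have "weight t (Suc n) (Suc p) False = 0" unfolding weight_Suc_False[OF Suc.hyps] F
      using False by (simp add: level_fps_nth)
    then show ?thesis using False by (simp add: level_fps_nth)
  qed
  have b: "weight t (Suc n) 0 False = 0"
    unfolding weight_def by (rule sum.neutral) (use room_pos in force)
  have "(fps_X * geom * level_fps t p) $ Suc n = (geom * level_fps t p) $ n" by (simp add: mult.assoc)
  also have "\<dots> = ((1 + fps_X * geom) * level_fps t p) $ n" using geom_eq by simp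
  also have "\<dots> = level_fps t p $ n + (fps_X * geom * level_fps t p) $ n" by (simp add: distrib_right)
  also have "level_fps t p $ n = weight t n p False"
    using F F0 Suc.hyps by (cases p) (auto simp: level_fps_0)
  finally have c: "weight t (Suc n) p True = (fps_X * geom * level_fps t p) $ Suc n"
    unfolding weight_Suc_True[OF Suc.hyps] T by simp
  from a b c show ?case by simp
qed

lemma sum_asc:
  assumes "0 < n"
  shows "(\<Sum>s\<in>{s \<in> K. length s = n}. t ^ asc s) = nara_fps t 1 $ n"
proof -
  let ?A = "{s \<in> K. length s = n}"
  have A: "finite ?A" "\<And>s. s \<in> ?A \<Longrightarrow> room s \<le> n" using finite_level room_le by auto
  have I: "(\<Sum>j\<in>{q..n}. \<Sum>s\<in>?A. if room s = j \<and> (last s = 0) = z then f s else 0) =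
      (\<Sum>s\<in>?A. if q \<le> room s \<and> (last s = 0) = z then f s else 0)" for q z and f :: "nat list \<Rightarrow> real"
    by (rule sum_level_indicator[OF A, where P = "\<lambda>s. (last s = 0) = z"])
  have "(\<Sum>s\<in>?A. t ^ asc s) = (\<Sum>j\<in>{0..n}. weight t n j True) + (\<Sum>j\<in>{0..n}. weight t n j False)"
    unfolding weight_def I by (subst sum.distrib[symmetric], rule sum.cong) auto
  also have "(\<Sum>j\<in>{0..n}. weight t n j True) = (\<Sum>p\<le>n. (fps_X * geom * level_fps t p) $ n)"
    using weight_eq[OF assms] by (simp add: atMost_atLeast0)
  also have "(\<Sum>j\<in>{0..n}. weight t n j False) = (\<Sum>j\<in>{Suc 0..n}. weight t n j False)"
    using weight_eq[OF assms] by (simp add: sum.atLeast_Suc_atMost)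
  also have "\<dots> = (\<Sum>p\<in>{Suc 0..n}. level_fps t p $ n)"
  proof (rule sum.cong)
    fix j assume "j \<in> {Suc 0..n}"
    then show "weight t n j False = level_fps t j $ n" using weight_eq[OF assms] by (cases j) auto
  qed simp
  finally show ?thesis unfolding level_total .
qed

text \<open>\<open>sum_asc\<close> holds for every real t, so two polynomials in t agree and hence
  so do their coefficients.\<close>

lemma card_asc:
  assumes "0 < n" "m < n"
  shows "real (card {s \<in> K. length s = n \<and> asc s = m}) = narayana n (m + 1)"
proof -
  let ?A = "{s \<in> K. length s = n}"
  let ?c = "\<lambda>m. real (card {s \<in> K. length s = n \<and> asc s = m})"
  have "(\<Sum>m\<le>n. ?c m * t ^ m) = (\<Sum>m\<le>n. nara n 1 m * t ^ m)" for t
  proof -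
    have "(\<Sum>m\<le>n. nara n 1 m * t ^ m) = nara_fps t 1 $ n" using assms by (simp add: nara_fps_def)
    also have "\<dots> = (\<Sum>s\<in>?A. t ^ asc s)" using sum_asc assms by simp
    also have "\<dots> = (\<Sum>m\<le>n. \<Sum>s\<in>{s \<in> ?A. asc s = m}. t ^ asc s)"
      by (rule sum.group[symmetric]) (use finite_level asc_le_length in auto)
    also have "\<dots> = (\<Sum>m\<le>n. ?c m * t ^ m)"
      by (rule sum.cong) (auto intro!: sum.cong arg_cong[where f = card])
    finally show ?thesis by simp
  qed
  then have "\<forall>m\<le>n. ?c m = nara n 1 m" by (intro polyfun_eq_coeffs[THEN iffD1] allI)
  then show ?thesis using assms by (simp add: nara_def narayana_def)
qed

lemma card_level:
  assumes "0 < n"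
  shows "real (card {s \<in> K. length s = n}) = catalan n"
proof -
  have "real (card {s \<in> K. length s = n}) = (\<Sum>s\<in>{s \<in> K. length s = n}. 1 ^ asc s)" by simp
  also have "\<dots> = nara_fps 1 1 $ n" by (rule sum_asc[OF assms])
  also have "\<dots> = (\<Sum>m<n. nara n 1 m)" using assms
    by (simp add: nara_fps_def lessThan_Suc_atMost[symmetric]) (simp add: nara_def)
  also have "\<dots> = (\<Sum>m<n. narayana n (m + 1))" by (simp add: nara_def narayana_def mult_ac)
  finally show ?thesis using sum_narayana[OF assms] by simp
qed

end

section \<open>The two classes as instances of the tree\<close>

lemma ascent_seq_le_asc: "ascent_seq s \<Longrightarrow> y \<in> set s \<Longrightarrow> y \<le> asc s"
proof (induction s arbitrary: y rule: rev_induct)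
  case (snoc x s)
  show ?case
  proof (cases "s = []")
    case True then show ?thesis using snoc.prems by (simp add: ascent_seq_single)
  next
    case False
    then have "last s \<le> asc s" using snoc by (auto simp: ascent_seq_snoc)
    moreover have "x \<le> asc s + 1" using snoc.prems False by (auto simp: ascent_seq_snoc)
    moreover have "y = x \<or> y \<le> asc s" using snoc by (auto simp: ascent_seq_snoc)
    \<comment> \<open>A letter above \<open>asc s\<close> also exceeds the last letter and therefore
      adds the ascent that is needed.\<close>
    ultimately show ?thesis using False by (auto simp: asc_snoc)
  qed
qed simp

lemma top_letter_le_iff: "top_letter s \<le> x \<longleftrightarrow> 0 < x \<and> (\<forall>y\<in>set s. y \<le> x)"
  unfolding top_letter_def by auto

text \<open>A positive letter must be at least the maximum, so the extra choice is to repeat the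
  maximum. After zeros only, \<open>top_letter\<close> is 1 and the letter 1 plays this
  part.\<close>

interpretation weakly_incr: narayana_tree weakly_incr top_letter
proof
  fix s :: "nat list" and x
  show "s \<in> weakly_incr \<Longrightarrow> ascent_seq s" by (simp add: weakly_incr_def)
  show "[0] \<in> weakly_incr" by (simp add: weakly_incr_def ascent_seq_single)
  show "s \<in> weakly_incr \<Longrightarrow> s \<noteq> [] \<Longrightarrow> 0 < top_letter s \<and> top_letter s \<le> top_letter s"
    using top_letter_ge(2)[of s] by simp
  show "top_letter s \<le> last s" if "s \<in> weakly_incr" "s \<noteq> []" "last s \<noteq> 0"
  proof -
    have "s = butlast s @ [last s]" using that(2) by simp
    then obtain u y where "s = u @ [y]" by blast
    then show ?thesis using that unfolding weakly_incr_def top_letter_le_iff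
      by (auto simp: sorted_wrt_append)
  qed
  show "s @ [x] \<in> weakly_incr \<longleftrightarrow> s \<in> weakly_incr \<and> (x = 0 \<or> x = top_letter s \<or> top_letter s < x \<and> x \<le> asc s + 1)"
    if "s \<noteq> []"
  proof -
    have "ascent_seq s \<Longrightarrow> top_letter s \<le> asc s + 1"
      unfolding top_letter_le_iff using ascent_seq_le_asc[of s] by fastforce
    moreover have "(0 < x \<longrightarrow> (\<forall>y\<in>set s. y \<le> x)) \<longleftrightarrow> x = 0 \<or> top_letter s \<le> x"
      unfolding top_letter_le_iff by auto
    ultimately show ?thesis using that unfolding weakly_incr_def
      by (auto simp: sorted_wrt_append ascent_seq_snoc)
  qed
qed

text \<open>Letters above 1 must be new maxima; the extra choice is the letter 1, which is never
  restricted.\<close>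

interpretation strictly_incr: narayana_tree strictly_incr "\<lambda>_. 1"
proof
  fix s :: "nat list" and x
  show "s \<in> strictly_incr \<Longrightarrow> ascent_seq s" by (simp add: strictly_incr_def)
  show "[0] \<in> strictly_incr" by (simp add: strictly_incr_def ascent_seq_single)
  show "s \<in> strictly_incr \<Longrightarrow> s \<noteq> [] \<Longrightarrow> 0 < (1::nat) \<and> 1 \<le> top_letter s"
    using top_letter_ge(2)[of s] by simp
  show "s \<in> strictly_incr \<Longrightarrow> s \<noteq> [] \<Longrightarrow> last s \<noteq> 0 \<Longrightarrow> 1 \<le> last s" by simp
  show "s @ [x] \<in> strictly_incr \<longleftrightarrow> s \<in> strictly_incr \<and> (x = 0 \<or> x = 1 \<or> top_letter s < x \<and> x \<le> asc s + 1)"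
    if "s \<noteq> []"
  proof -
    have "(1 < x \<longrightarrow> (\<forall>y\<in>set s. y < x)) \<longleftrightarrow> x = 0 \<or> x = 1 \<or> top_letter s < x"
      unfolding top_letter_less_iff by auto
    then show ?thesis using that unfolding strictly_incr_def
      by (auto simp: sorted_wrt_append ascent_seq_snoc)
  qed
qed

section \<open>Ballot numbers\<close>

text \<open>The coefficient of \<open>x^n\<close> in \<open>(x C)^k\<close>. The guard \<open>k \<le> n\<close> is needed because \<open>2 * n - k - 1\<close> is truncated.\<close>

definition ballot :: "nat \<Rightarrow> nat \<Rightarrow> real" where
  "ballot n k = (if n = 0 then of_bool (k = 0)
     else if k \<le> n then real ((2 * n - k - 1) choose (n - 1)) - real ((2 * n - k - 1) choose n) else 0)"

lemma ballot_eq_0: "n < k \<Longrightarrow> ballot n k = 0"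
  by (auto simp: ballot_def)

lemma ballot_0 [simp]: "ballot 0 k = of_bool (k = 0)"
  by (simp add: ballot_def)

lemma ballot_Suc_0 [simp]: "ballot (Suc n) 0 = 0"
proof -
  have "(Suc (2 * n)) choose n = (Suc (2 * n)) choose (Suc n)"
    using binomial_symmetric[of n "Suc (2 * n)"] by simp
  then show ?thesis by (simp add: ballot_def)
qed

text \<open>Coefficient form of w^(k+1) = x w^k + w^(k+2) for w = x C; in terms of binomial
  coefficients it is Pascal's rule.\<close>

lemma ballot_rec: "ballot (Suc n) (Suc k) = ballot n k + ballot (Suc n) (Suc (Suc k))"
proof (cases "n = 0 \<or> n \<le> k")
  case True
  then show ?thesis by (cases "k = n") (auto simp: ballot_def binomial_eq_0)
next
  case False
  then obtain m where n: "n = Suc m" by (cases n) auto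
  define N where "N = 2 * n - k - 1"
  have "2 * Suc n - Suc k - 1 = Suc N" "2 * Suc n - Suc (Suc k) - 1 = N" "2 * n - k - 1 = N"
    using False by (auto simp: N_def)
  then show ?thesis using False n by (simp add: ballot_def)
qed

text \<open>As series, w^k / (1 - w) = w^(k+1) / x. The telescoped remainder
  \<open>ballot (Suc n) (Suc (Suc J))\<close> vanishes because J is at least n.\<close>

lemma sum_ballot:
  assumes "n \<le> J"
  shows "(\<Sum>j\<in>{k..J}. ballot n j) = ballot (Suc n) (Suc k)"
proof (cases "k \<le> J")
  case True
  have "(\<Sum>j\<in>{k..J}. ballot n j) = ballot (Suc n) (Suc k) - ballot (Suc n) (Suc (Suc J))"
    using True
  proof (induction J rule: dec_induct)
    case base then show ?case using ballot_rec[of n k] by simp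
  next
    case (step j) then show ?case using ballot_rec[of n "Suc j"] by simp
  qed
  then show ?thesis using assms by (simp add: ballot_eq_0)
qed (use assms in \<open>simp add: ballot_eq_0\<close>)

lemma ballot_1: "ballot (Suc n) 1 = catalan n"
proof (cases "n = 0")
  case False
  have "n * (2 * n choose n) = (n + 1) * (2 * n choose (n + 1))"
    using times_binomial_minus1_eq[of "n + 1" "2 * n"] binomial_absorb_comp[of "2 * n" n] False by simp
  then have "real n * real (2 * n choose n) = real (n + 1) * real (2 * n choose (n + 1))"
    by (metis of_nat_mult)
  then have "real (2 * n choose (n + 1)) = real n * real (2 * n choose n) / real (n + 1)"
    by (simp add: field_simps)
  then show ?thesis using False by (simp add: ballot_def catalan_def field_simps)
qed (simp add: ballot_def catalan_def)

section \<open>The pairs (0010,0021) and (0011,0021)\<close>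

text \<open>Iterates w^k = x w^(k-1) + w^(k+1) on its first term down to x^k. Where
  \<open>m - i\<close> truncates to 0, the second argument is still positive, so the term is 0. The
  sum matches the letters that lower the threshold in \<open>weight_Suc\<close>.\<close>

lemma ballot_diagonal:
  "ballot m k = of_bool (m = k) + (\<Sum>i<k. ballot (m - i) (Suc k - i))"
proof (induction k arbitrary: m)
  case 0 then show ?case by (cases m) simp_all
next
  case (Suc k)
  show ?case
  proof (cases m)
    case 0 then show ?thesis by simp
  next
    case (Suc l)
    have "(\<Sum>i<Suc k. ballot (m - i) (Suc (Suc k) - i)) = ballot m (Suc (Suc k)) + (\<Sum>i<k. ballot (l - i) (Suc k - i))"
      unfolding sum.lessThan_Suc_shift using Suc by simp
    then show ?thesis using Suc.IH[of l] Suc ballot_rec[of l k] by simp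
  qed
qed

lemma card_ge_bij:
  fixes A :: "nat set"
  assumes "finite A"
  shows "bij_betw (\<lambda>x. card {y \<in> A. x \<le> y}) A {1..card A}"
proof -
  have lt: "card {y \<in> A. z \<le> y} < card {y \<in> A. x \<le> y}" if "x \<in> A" "x < z" for x z
  proof (rule psubset_card_mono)
    have "x \<in> {y \<in> A. x \<le> y}" "x \<notin> {y \<in> A. z \<le> y}" using that by auto
    moreover have "{y \<in> A. z \<le> y} \<subseteq> {y \<in> A. x \<le> y}" using that by auto
    ultimately show "{y \<in> A. z \<le> y} \<subset> {y \<in> A. x \<le> y}" by blast
  qed (use assms in simp)
  have inj: "inj_on (\<lambda>x. card {y \<in> A. x \<le> y}) A"
  proof (rule inj_onI)
    fix x z assume h: "x \<in> A" "z \<in> A" "card {y \<in> A. x \<le> y} = card {y \<in> A. z \<le> y}"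
    then show "x = z" using lt[of x z] lt[of z x] by (cases x z rule: linorder_cases) auto
  qed
  have "(\<lambda>x. card {y \<in> A. x \<le> y}) ` A \<subseteq> {1..card A}"
  proof
    fix k assume "k \<in> (\<lambda>x. card {y \<in> A. x \<le> y}) ` A"
    then obtain x where x: "x \<in> A" "k = card {y \<in> A. x \<le> y}" by blast
    then have "{y \<in> A. x \<le> y} \<noteq> {}" by auto
    then show "k \<in> {1..card A}" using x assms card_mono[OF assms, of "{y \<in> A. x \<le> y}"]
      by (auto simp: Suc_le_eq card_gt_0_iff)
  qed
  moreover have "card ((\<lambda>x. card {y \<in> A. x \<le> y}) ` A) = card A" by (rule card_image[OF inj])
  ultimately have "(\<lambda>x. card {y \<in> A. x \<le> y}) ` A = {1..card A}"
    by (intro card_subset_eq) auto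
  then show ?thesis using inj by (simp add: bij_betw_def)
qed

text \<open>Counted from the top, the least element \<open>a\<close> has rank \<open>card A\<close>,
  and the others have the ranks 1 to \<open>card A - 1\<close>, each once. In
  \<open>sum_upper\<close> the successor of such a rank is the number of appendable letters after
  the step.\<close>

lemma sum_rank:
  fixes A :: "nat set"
  assumes "finite A" "a \<in> A" "\<And>y. y \<in> A \<Longrightarrow> a \<le> y"
  shows "(\<Sum>x\<in>A - {a}. of_bool (Suc (card {y \<in> A. x \<le> y}) = q)) = (of_bool (2 \<le> q \<and> q \<le> card A) :: real)"
proof -
  let ?h = "\<lambda>x. card {y \<in> A. x \<le> y}"
  have "?h a = card A" using assms(3) by (intro arg_cong[where f = card]) auto
  have b: "bij_betw ?h (A - {a}) ({1..card A} - {card A})"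
  proof (rule bij_betw_DiffI[OF card_ge_bij[OF assms(1)]])
    show "bij_betw ?h {a} {card A}" using \<open>?h a = card A\<close> by (simp add: bij_betw_def)
    have "0 < card A" using assms by (auto simp: card_gt_0_iff)
    then show "{card A} \<subseteq> {1..card A}" by simp
  qed (use assms in simp)
  have "(\<Sum>x\<in>A - {a}. of_bool (Suc (?h x) = q)) = (\<Sum>j\<in>{1..card A} - {card A}. (of_bool (Suc j = q) :: real))"
    by (rule sum.reindex_bij_betw[OF b])
  also have "\<dots> = (\<Sum>j\<in>{1..card A} - {card A}. if j = q - 1 then of_bool (0 < q) else 0)"
    by (rule sum.cong) auto
  also have "\<dots> = of_bool (2 \<le> q \<and> q \<le> card A)" by (auto simp: of_bool_def)
  finally show ?thesis .
qed

section \<open>Repeated letters and distinct ascent sequences\<close>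

definition repeated :: "nat list \<Rightarrow> nat \<Rightarrow> bool" where
  "repeated s b \<longleftrightarrow> (\<exists>i j. i < j \<and> j < length s \<and> s ! i = b \<and> s ! j = b)"

text \<open>Unspecified for distinct sequences, hence the many guards
  \<open>\<not> distinct s\<close>.\<close>

definition threshold :: "nat list \<Rightarrow> nat" where
  "threshold s = (LEAST b. repeated s b)"

lemma repeated_snoc: "repeated (s @ [x]) b \<longleftrightarrow> repeated s b \<or> b = x \<and> x \<in> set s"
  unfolding repeated_def ex2_snoc[where P = "\<lambda>y z. y = b \<and> z = b"] in_set_conv_nth by blast

lemma distinct_iff_repeated: "distinct s \<longleftrightarrow> (\<forall>b. \<not> repeated s b)"
proof
  show "distinct s \<Longrightarrow> \<forall>b. \<not> repeated s b" by (auto simp: distinct_conv_nth repeated_def)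
next
  assume h: "\<forall>b. \<not> repeated s b"
  have "s ! i \<noteq> s ! j" if "i < j" "j < length s" for i j
    using h that unfolding repeated_def by metis
  then show "distinct s" unfolding distinct_conv_nth by (metis linorder_neqE_nat)
qed

lemma repeated_threshold: "\<not> distinct s \<Longrightarrow> repeated s (threshold s)"
  unfolding threshold_def distinct_iff_repeated by (auto intro: LeastI)

lemma threshold_le: "repeated s b \<Longrightarrow> threshold s \<le> b"
  unfolding threshold_def by (rule Least_le)

lemma threshold_eqI: "repeated s c \<Longrightarrow> (\<And>b. repeated s b \<Longrightarrow> c \<le> b) \<Longrightarrow> threshold s = c"
  unfolding threshold_def by (rule Least_equality)

text \<open>After 0, ..., n-1 the ascent bound is n, the only value up to n not yet used.\<close>

lemma distinct_ascent_seq: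
  "ascent_seq s \<Longrightarrow> distinct s \<Longrightarrow> s = [0..<length s] \<and> asc s = length s - 1"
proof (induction s rule: rev_induct)
  case (snoc x s)
  show ?case
  proof (cases "s = []")
    case True then show ?thesis using snoc.prems by (auto simp: ascent_seq_single asc_def)
  next
    case False
    then have s: "s = [0..<length s]" "asc s = length s - 1" "x \<le> asc s + 1" "x \<notin> set s"
      using snoc by (auto simp: ascent_seq_snoc)
    then have "x = length s" using False by (metis atLeastLessThan_iff le_add_diff_inverse2 le_eq_less_or_eq
        length_greater_0_conv set_upt less_eq_Suc_le One_nat_def zero_le)
    moreover have "last s < x" using s False \<open>x = length s\<close>
      by (metis atLeastLessThan_iff last_in_set set_upt)
    ultimately show ?thesis using s False by (auto simp: asc_snoc)
  qed
qed (simp add: asc_def)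

lemma ascent_seq_upt: "ascent_seq [0..<n]"
proof (induction n)
  case (Suc n)
  have "distinct [0..<n]" by simp
  then have "asc [0..<n] = n - 1" using distinct_ascent_seq[OF Suc] by simp
  then show ?case using Suc by (auto simp: ascent_seq_snoc)
qed (simp add: ascent_seq_Nil)

section \<open>Effect of an appended letter on the letters that may follow\<close>

text \<open>Both pairs forbid subsequences \<open>b b d y\<close>, with \<open>b \<le> y < d\<close> for (0010,0021) and
  \<open>b < y \<le> d\<close> for (0011,0021).\<close>

locale threshold_tree =
  fixes strict :: bool
begin

definition R :: "nat \<Rightarrow> nat \<Rightarrow> nat \<Rightarrow> bool" where
  "R b y d \<longleftrightarrow> (if strict then b < y \<and> y \<le> d else b \<le> y \<and> y < d)"

lemma R_iff:
  "strict \<Longrightarrow> R b y d \<longleftrightarrow> b < y \<and> y \<le> d"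
  "\<not> strict \<Longrightarrow> R b y d \<longleftrightarrow> b \<le> y \<and> y < d"
  unfolding R_def by simp_all

definition forbidden :: "nat list \<Rightarrow> nat \<Rightarrow> bool" where
  "forbidden s y \<longleftrightarrow> (\<exists>i j k. i < j \<and> j < k \<and> k < length s \<and> s ! i = s ! j \<and> R (s ! i) y (s ! k))"

definition K :: "nat list set" where
  "K = {s. ascent_seq s \<and> \<not> (\<exists>i j k l. i < j \<and> j < k \<and> k < l \<and> l < length s \<and>
     s ! i = s ! j \<and> R (s ! i) (s ! l) (s ! k))}"

lemma K_snoc:
  assumes "s \<noteq> []"
  shows "s @ [x] \<in> K \<longleftrightarrow> s \<in> K \<and> x \<le> asc s + 1 \<and> \<not> forbidden s x"
  using assms unfolding K_def mem_Collect_eq ascent_seq_snoc forbidden_def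
    ex4_snoc[where P = "\<lambda>a b d y. a = b \<and> R a y d"] by auto

text \<open>\<open>R b y x\<close> becomes weaker as \<open>b\<close> decreases, so among all
  repeated letters the least one decides.\<close>

lemma forbidden_snoc:
  "forbidden (s @ [x]) y \<longleftrightarrow> forbidden s y \<or> \<not> distinct s \<and> R (threshold s) y x"
proof -
  have "(\<exists>i j. i < j \<and> j < length s \<and> s ! i = s ! j \<and> R (s ! i) y x) \<longleftrightarrow> (\<exists>b. repeated s b \<and> R b y x)"
    unfolding repeated_def by metis
  also have "\<dots> \<longleftrightarrow> \<not> distinct s \<and> R (threshold s) y x"
  proof
    assume "\<exists>b. repeated s b \<and> R b y x"
    then obtain b where b: "repeated s b" "R b y x" by blast
    then have "R (threshold s) y x" using threshold_le[OF b(1)] unfolding R_def by (auto split: if_splits)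
    then show "\<not> distinct s \<and> R (threshold s) y x" using b distinct_iff_repeated by blast
  qed (use repeated_threshold in blast)
  finally show ?thesis
    unfolding forbidden_def ex3_snoc[where P = "\<lambda>a b d. a = b \<and> R a y d"] by blast
qed

lemma forbidden_bounds:
  assumes "forbidden s y"
  shows "\<not> distinct s" "threshold s \<le> y" "strict \<Longrightarrow> threshold s < y" "ascent_seq s \<Longrightarrow> y \<le> asc s"
proof -
  obtain i j k where h: "i < j" "j < k" "k < length s" "s ! i = s ! j" "R (s ! i) y (s ! k)"
    using assms unfolding forbidden_def by blast
  then have r: "repeated s (s ! i)" unfolding repeated_def
    by (intro exI[of _ i] exI[of _ j]) simp
  then show "\<not> distinct s" using distinct_iff_repeated by blast
  from threshold_le[OF r] show "threshold s \<le> y" "strict \<Longrightarrow> threshold s < y"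
    using h(5) unfolding R_def by (auto split: if_splits)
  show "y \<le> asc s" if "ascent_seq s"
    using ascent_seq_le_asc[OF that, of "s ! k"] h unfolding R_def by (auto split: if_splits)
qed

definition allowed :: "nat list \<Rightarrow> nat set" where
  "allowed s = {y. y \<le> asc s + 1 \<and> \<not> forbidden s y}"

definition upper :: "nat list \<Rightarrow> nat set" where
  "upper s = {y \<in> allowed s. threshold s \<le> y}"

lemma finite_upper: "finite (upper s)" "finite (allowed s)"
  unfolding upper_def allowed_def by (rule finite_subset[of _ "{..asc s + 1}"]; auto)+

lemma threshold_distinct_snoc:
  assumes "distinct s" "x \<in> set s" shows "threshold (s @ [x]) = x"
  by (rule threshold_eqI) (use assms distinct_iff_repeated in \<open>auto simp: repeated_snoc\<close>)

lemma threshold_snoc: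
  assumes "\<not> distinct s" "threshold s \<le> x \<or> x \<in> set s"
  shows "threshold (s @ [x]) = min (threshold s) x"
proof (cases "threshold s \<le> x")
  case True
  then show ?thesis using repeated_threshold[OF assms(1)] threshold_le[of s]
    by (intro threshold_eqI) (auto simp: repeated_snoc)
next
  case False
  then show ?thesis using assms threshold_le[of s]
    by (intro threshold_eqI) (fastforce simp: repeated_snoc)+
qed

text \<open>The first repetition happens after 0, ..., n-1, and from then on the threshold can only
  drop. So a letter appended below the threshold is a repetition and becomes the new
  threshold.\<close>

lemma below_threshold_in_set:
  "ascent_seq s \<Longrightarrow> \<not> distinct s \<Longrightarrow> {..<threshold s} \<subseteq> set s"
proof (induction s rule: rev_induct)
  case (snoc x s)
  then have a: "ascent_seq s" by (simp add: ascent_seq_snoc)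
  show ?case
  proof (cases "distinct s")
    case True
    then obtain n where n: "s = [0..<n]" using distinct_ascent_seq[OF a] by blast
    then have "x < n" using snoc.prems by simp
    moreover have "threshold (s @ [x]) = x" unfolding n
      by (rule threshold_distinct_snoc) (use \<open>x < n\<close> in auto)
    ultimately show ?thesis using n by auto
  next
    case False
    then have "threshold (s @ [x]) \<le> threshold s"
      using repeated_threshold by (intro threshold_le) (simp add: repeated_snoc)
    then show ?thesis using snoc.IH[OF a False]
      by (metis (no_types, lifting) lessThan_subset_iff order_trans set_append sup_ge1)
  qed
qed simp

lemma upper_distinct_snoc:
  assumes "x < n" shows "upper ([0..<n] @ [x]) = {x..n}" "threshold ([0..<n] @ [x]) = x"
proof -
  show t: "threshold ([0..<n] @ [x]) = x" by (rule threshold_distinct_snoc) (use assms in auto)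
  have a: "asc [0..<n] = n - 1" using distinct_ascent_seq[OF ascent_seq_upt, of n] by simp
  have "last [0..<n] = n - 1" using assms by (cases n) auto
  then have "asc ([0..<n] @ [x]) + 1 = n" using a assms by (auto simp: asc_snoc)
  moreover have "\<not> forbidden ([0..<n] @ [x]) y" for y
    using forbidden_bounds(1)[of "[0..<n]" y] by (auto simp: forbidden_snoc)
  ultimately show "upper ([0..<n] @ [x]) = {x..n}" unfolding upper_def allowed_def t by auto
qed

text \<open>A letter below the threshold makes no ascent and, as the \<open>d\<close> of a forbidden
  subsequence, excludes nothing; it merely moves the threshold, so that the letters in between are
  counted as well.\<close>

lemma upper_below_snoc:
  assumes "ascent_seq s" "\<not> distinct s" "x < threshold s" "threshold s \<le> last s"
  shows "upper (s @ [x]) = {x..<threshold s} \<union> upper s" "threshold (s @ [x]) = x"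
proof -
  have "x \<in> set s" using below_threshold_in_set[OF assms(1,2)] assms(3) by auto
  then show t: "threshold (s @ [x]) = x" using assms by (simp add: threshold_snoc)
  have "s \<noteq> []" using assms(2) by auto
  have "asc (s @ [x]) = asc s" using assms by (simp add: asc_snoc)
  moreover have "forbidden (s @ [x]) y \<longleftrightarrow> forbidden s y" for y
    using assms unfolding forbidden_snoc R_def by auto
  moreover have "threshold s \<le> asc s"
    using ascent_seq_le_asc[OF assms(1), of "last s"] assms(4) \<open>s \<noteq> []\<close> by simp
  moreover have "\<not> forbidden s y" if "y < threshold s" for y
    using forbidden_bounds(2)[of s y] that by auto
  ultimately show "upper (s @ [x]) = {x..<threshold s} \<union> upper s"
    using assms unfolding upper_def allowed_def t by auto
qed

lemma upper_above_snoc: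
  assumes "ascent_seq s" "\<not> distinct s" "x \<in> upper s"
  shows "upper (s @ [x]) = {y \<in> upper s. \<not> R (threshold s) y x} \<union> (if last s < x then {asc s + 2} else {})"
    "threshold (s @ [x]) = threshold s"
proof -
  have x: "threshold s \<le> x" "x \<le> asc s + 1" using assms(3) by (auto simp: upper_def allowed_def)
  then show t: "threshold (s @ [x]) = threshold s" using threshold_snoc assms by simp
  have "s \<noteq> []" using assms(2) by auto
  have new: "\<not> forbidden s (asc s + 2)" "\<not> R (threshold s) (asc s + 2) x" "threshold s \<le> asc s + 2"
    using forbidden_bounds(4)[of s "asc s + 2"] x assms(1) by (auto simp: R_def)
  have "y \<le> asc s + 2 \<longleftrightarrow> y \<le> asc s + 1 \<or> y = asc s + 2" for y by auto
  then show "upper (s @ [x]) = {y \<in> upper s. \<not> R (threshold s) y x} \<union> (if last s < x then {asc s + 2} else {})"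
    using assms(2) \<open>s \<noteq> []\<close> new unfolding upper_def allowed_def t by (auto simp: asc_snoc forbidden_snoc)
qed

lemma threshold_in_upper:
  assumes "strict" "ascent_seq s" "\<not> distinct s" shows "threshold s \<in> upper s"
proof -
  have "threshold s \<in> set s" using repeated_threshold[OF assms(3)] unfolding repeated_def
    by (metis nth_mem)
  then have "threshold s \<le> asc s" using ascent_seq_le_asc[OF assms(2)] by simp
  moreover have "\<not> forbidden s (threshold s)" using forbidden_bounds(3)[OF _ assms(1)] by blast
  ultimately show ?thesis by (simp add: upper_def allowed_def)
qed

text \<open>Exactly one letter of \<open>upper s\<close> creates no ascent. After a letter below the
  threshold it is that letter. After another letter x, the letters from the threshold up to x are
  excluded except for one end: the threshold survives if \<open>strict\<close> holds, x itself
  otherwise.\<close>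

lemma unique_level_letter:
  assumes "s \<in> K" "\<not> distinct s"
  shows "\<exists>a. {y \<in> upper s. y \<le> last s} = {a}"
  using assms
proof (induction s rule: rev_induct)
  case (snoc x s)
  then have "s \<noteq> []" by auto
  then have s: "s \<in> K" "x \<in> allowed s" using snoc.prems K_snoc by (auto simp: allowed_def)
  then have a: "ascent_seq s" by (simp add: K_def)
  show ?case
  proof (cases "distinct s")
    case True
    then obtain n where n: "s = [0..<n]" using distinct_ascent_seq[OF a] by blast
    then have "x < n" using snoc.prems by simp
    then show ?thesis using upper_distinct_snoc(1)[of x n] n by (intro exI[of _ x]) auto
  next
    case False
    obtain b where b: "{y \<in> upper s. y \<le> last s} = {b}" using snoc.IH s False by blast
    then have "b \<in> upper s" "b \<le> last s" by blast+
    then have "threshold s \<le> last s" by (simp add: upper_def)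
    show ?thesis
    proof (cases "x < threshold s")
      case True
      then have "upper (s @ [x]) = {x..<threshold s} \<union> upper s"
        using upper_below_snoc(1) a False \<open>threshold s \<le> last s\<close> by blast
      moreover have "\<not> y \<le> x" if "y \<in> upper s" for y using that True by (simp add: upper_def)
      ultimately have "{y \<in> upper (s @ [x]). y \<le> x} = {x}" using True by auto
      then show ?thesis by (intro exI[of _ x]) simp
    next
      case above: False
      then have xu: "x \<in> upper s" using s by (simp add: upper_def)
      then have "x \<le> asc s + 1" by (simp add: upper_def allowed_def)
      then have *: "{y \<in> upper (s @ [x]). y \<le> x} = {y \<in> upper s. \<not> R (threshold s) y x \<and> y \<le> x}"
        unfolding upper_above_snoc(1)[OF a False xu] by auto
      show ?thesis
      proof (cases strict)
        case True
        have "{y \<in> upper s. \<not> R (threshold s) y x \<and> y \<le> x} = {threshold s}"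
          using threshold_in_upper[OF True a False] above by (auto simp: R_iff(1)[OF True] upper_def)
        then show ?thesis using * by (intro exI[of _ "threshold s"]) simp
      next
        case ns: False
        have "{y \<in> upper s. \<not> R (threshold s) y x \<and> y \<le> x} = {x}"
          using xu by (auto simp: R_iff(2)[OF ns] upper_def)
        then show ?thesis using * by (intro exI[of _ x]) simp
      qed
    qed
  qed
qed simp

text \<open>The letter without ascent changes nothing. Any other letter x excludes smaller upper
  letters and gains the value \<open>asc s + 2\<close>, which leaves one more than the rank of x
  from the top; \<open>sum_rank\<close> adds these up.\<close>

lemma sum_upper:
  assumes "s \<in> K" "\<not> distinct s"
  shows "(\<Sum>x\<in>upper s. of_bool (card (upper (s @ [x])) = q)) =
    (of_bool (card (upper s) = q) + of_bool (2 \<le> q \<and> q \<le> card (upper s)) :: real)"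
proof -
  have as: "ascent_seq s" using assms by (simp add: K_def)
  obtain a where a: "{y \<in> upper s. y \<le> last s} = {a}" using unique_level_letter[OF assms] by blast
  then have au: "a \<in> upper s" "a \<le> last s" by blast+
  have gt: "last s < y" if "y \<in> upper s" "y \<noteq> a" for y using a that by (metis (no_types, lifting) mem_Collect_eq not_le singletonD)
  have min: "a \<le> y" if "y \<in> upper s" for y using gt[OF that] au by (cases "y = a") auto
  have sa: "a = threshold s" if strict
    using threshold_in_upper[OF that as assms(2)] min[of "threshold s"] au(1) by (auto simp: upper_def)
  have "upper (s @ [a]) = upper s"
  proof -
    have "\<not> R (threshold s) y a" if "y \<in> upper s" for y
    proof (cases strict)
      case True show ?thesis using sa[OF True] by (simp add: R_iff(1)[OF True])
    next
      case False show ?thesis using min[OF that] by (simp add: R_iff(2)[OF False])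
    qed
    then have "{y \<in> upper s. \<not> R (threshold s) y a} = upper s" by blast
    then show ?thesis using upper_above_snoc(1)[OF as assms(2) au(1)] au(2) by simp
  qed
  moreover have "card (upper (s @ [x])) = Suc (card {y \<in> upper s. x \<le> y})" if "x \<in> upper s - {a}" for x
  proof -
    have x: "x \<in> upper s" "last s < x" "a < x" using that gt[of x] min[of x] by auto
    have "asc s + 2 \<notin> upper s" by (simp add: upper_def allowed_def)
    then have "card (upper (s @ [x])) = Suc (card {y \<in> upper s. \<not> R (threshold s) y x})"
      using upper_above_snoc(1)[OF as assms(2) x(1)] x(2) finite_upper(1)[of s] by simp
    moreover have "card {y \<in> upper s. \<not> R (threshold s) y x} = card {y \<in> upper s. x \<le> y}"
    proof (cases strict)
      case True
      \<comment> \<open>Compared with the other case, the threshold \<open>a\<close> survives in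
        place of x, so the cardinality is the same.\<close>
      have "{y \<in> upper s. \<not> R (threshold s) y x} = insert a {y \<in> upper s. x < y}"
        using sa[OF True] x au by (auto simp: R_iff(1)[OF True] upper_def)
      moreover have "{y \<in> upper s. x \<le> y} = insert x {y \<in> upper s. x < y}" using x by auto
      ultimately show ?thesis using finite_upper(1)[of s] x by simp
    next
      case False
      show ?thesis by (intro arg_cong[where f = card]) (auto simp: R_iff(2)[OF False] upper_def)
    qed
    ultimately show ?thesis by simp
  qed
  ultimately show ?thesis using sum_rank[OF finite_upper(1) au(1) min, of q]
    by (subst sum.remove[OF finite_upper(1) au(1)]) simp
qed

section \<open>Counting by threshold and number of appendable upper letters\<close>

definition state :: "nat \<Rightarrow> nat \<Rightarrow> nat list \<Rightarrow> real" where
  "state c q s = of_bool (\<not> distinct s \<and> threshold s = c \<and> card (upper s) = q)"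

definition weight :: "nat \<Rightarrow> nat \<Rightarrow> nat \<Rightarrow> real" where
  "weight n c q = (\<Sum>s\<in>{s \<in> K. length s = n}. state c q s)"

lemma finite_level: "finite {s \<in> K. length s = n}"
  by (rule finite_subset[OF _ finite_ascent_seq[of n]]) (auto simp: K_def)

lemma distinct_level: "{s \<in> K. length s = n \<and> distinct s} = {[0..<n]}"
proof (intro set_eqI iffI)
  fix s assume "s \<in> {s \<in> K. length s = n \<and> distinct s}"
  then show "s \<in> {[0..<n]}" using distinct_ascent_seq[of s] by (auto simp: K_def)
next
  have "s \<in> K" if "ascent_seq s" "distinct s" for s
    using that unfolding K_def distinct_iff_repeated repeated_def
    by (auto, metis order_less_trans)
  then show "s \<in> {s \<in> K. length s = n \<and> distinct s}" if "s \<in> {[0..<n]}" for s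
    using ascent_seq_upt that by simp
qed

lemma sum_children_distinct:
  assumes "0 < n"
  shows "(\<Sum>x\<in>allowed [0..<n]. state c q ([0..<n] @ [x])) = of_bool (c < n \<and> q = Suc n - c)"
proof -
  have "asc [0..<n] + 1 = n" using distinct_ascent_seq[OF ascent_seq_upt, of n] assms by simp
  moreover have "\<not> forbidden [0..<n] y" for y using forbidden_bounds(1)[of "[0..<n]" y] by auto
  ultimately have "allowed [0..<n] = {..n}" by (auto simp: allowed_def)
  moreover have "state c q ([0..<n] @ [x]) = (if x = c then of_bool (c < n \<and> q = Suc n - c) else 0)" if "x \<le> n" for x
  proof (cases "x = n")
    case True then show ?thesis by (simp add: state_def)
  next
    case False
    then have "x < n" using that by simp
    then show ?thesis using upper_distinct_snoc[of x n] by (auto simp: state_def)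
  qed
  ultimately show ?thesis by simp
qed

text \<open>A letter below the threshold lowers it by some i and enlarges \<open>upper s\<close> by
  i, which gives the last sum. Letters of \<open>upper s\<close> keep the threshold and are handled
  by \<open>sum_upper\<close>; the limit n + 2 bounds the size of \<open>upper s\<close>.\<close>

lemma sum_children_not_distinct:
  assumes "s \<in> K" "\<not> distinct s" "length s = n"
  shows "(\<Sum>x\<in>allowed s. state c q (s @ [x])) =
    state c q s + of_bool (2 \<le> q) * (\<Sum>j\<in>{q..n+2}. state c j s) + (\<Sum>i\<in>{1..q}. state (c + i) (q - i) s)"
proof -
  have as: "ascent_seq s" using assms by (simp add: K_def)
  obtain a where a: "{y \<in> upper s. y \<le> last s} = {a}" using unique_level_letter[OF assms(1,2)] by blast
  then have "a \<in> upper s" "a \<le> last s" by blast+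
  then have tl: "threshold s \<le> last s" by (simp add: upper_def)
  have "s \<noteq> []" using assms(2) by auto
  then have ta: "threshold s \<le> asc s" using ascent_seq_le_asc[OF as, of "last s"] tl by simp
  have dec: "allowed s = {..<threshold s} \<union> upper s"
    using ta forbidden_bounds(2)[of s] by (force simp: allowed_def upper_def)
  have dj: "{x..<threshold s} \<inter> upper s = {}" for x by (auto simp: upper_def)
  have low: "state c q (s @ [x]) = (if x = c then of_bool (threshold s - c + card (upper s) = q) else 0)"
    if "x < threshold s" for x
  proof -
    have "x \<in> set s" using below_threshold_in_set[OF as assms(2)] that by auto
    moreover have "card (upper (s @ [x])) = threshold s - x + card (upper s)"
      unfolding upper_below_snoc(1)[OF as assms(2) that tl]
      using dj finite_upper(1) by (simp add: card_Un_disjoint)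
    ultimately show ?thesis using upper_below_snoc(2)[OF as assms(2) that tl] by (auto simp: state_def)
  qed
  have "(\<Sum>x<threshold s. state c q (s @ [x])) =
      (\<Sum>x<threshold s. if x = c then of_bool (threshold s - c + card (upper s) = q) else 0)"
    by (rule sum.cong) (auto simp: low)
  also have "\<dots> = of_bool (c < threshold s \<and> threshold s - c + card (upper s) = q)" by simp
  also have "\<dots> = (\<Sum>i\<in>{1..q}. if i = threshold s - c then of_bool (c < threshold s \<and> threshold s - c + card (upper s) = q) else 0)"
    by auto
  also have "\<dots> = (\<Sum>i\<in>{1..q}. state (c + i) (q - i) s)"
    by (rule sum.cong) (use assms(2) in \<open>auto simp: state_def\<close>)
  finally have 1: "(\<Sum>x<threshold s. state c q (s @ [x])) = (\<Sum>i\<in>{1..q}. state (c + i) (q - i) s)" .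
  have "asc s + 2 \<le> n + 2" using asc_le_length[of s] assms(3) by simp
  moreover have "upper s \<subseteq> {..<asc s + 2}" by (auto simp: upper_def allowed_def)
  then have "card (upper s) \<le> asc s + 2" using card_mono[of "{..<asc s + 2}"] by simp
  ultimately have le: "card (upper s) \<le> n + 2" by simp
  have "(\<Sum>j\<in>{q..n+2}. state c j s) = (\<Sum>j\<in>{q..n+2}. if j = card (upper s) then of_bool (threshold s = c) else 0)"
    by (rule sum.cong) (use assms(2) in \<open>auto simp: state_def\<close>)
  then have st: "(\<Sum>j\<in>{q..n+2}. state c j s) = of_bool (threshold s = c \<and> q \<le> card (upper s))"
    using le by simp
  have "(\<Sum>x\<in>upper s. state c q (s @ [x])) =
      of_bool (threshold s = c) * (\<Sum>x\<in>upper s. of_bool (card (upper (s @ [x])) = q))"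
    unfolding sum_distrib_left
    by (rule sum.cong) (use assms(2) upper_above_snoc(2)[OF as assms(2)] in \<open>auto simp: state_def\<close>)
  also have "\<dots> = state c q s + of_bool (2 \<le> q) * (\<Sum>j\<in>{q..n+2}. state c j s)"
    unfolding sum_upper[OF assms(1,2)] st using assms(2) by (auto simp: state_def)
  finally have 2: "(\<Sum>x\<in>upper s. state c q (s @ [x])) = state c q s + of_bool (2 \<le> q) * (\<Sum>j\<in>{q..n+2}. state c j s)" .
  have "{..<threshold s} \<inter> upper s = {}" by (auto simp: upper_def)
  then show ?thesis unfolding dec using 1 2 finite_upper(1) by (simp add: sum.union_disjoint)
qed

lemma weight_Suc:
  assumes "0 < n"
  shows "weight (Suc n) c q = of_bool (c < n \<and> q = Suc n - c) + weight n c q +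
    of_bool (2 \<le> q) * (\<Sum>j\<in>{q..n+2}. weight n c j) + (\<Sum>i\<in>{1..q}. weight n (c + i) (q - i))"
proof -
  let ?A = "{s \<in> K. length s = n}"
  have "weight (Suc n) c q = (\<Sum>s\<in>?A. \<Sum>x\<in>allowed s. state c q (s @ [x]))"
    unfolding weight_def
  proof (rule sum_snoc[OF finite_level])
    fix s :: "nat list" and x assume "length s = n"
    then show "s @ [x] \<in> K \<longleftrightarrow> s \<in> K \<and> x \<in> allowed s" using K_snoc[of s x] assms by (auto simp: allowed_def)
  qed (rule finite_upper)
  also have "\<dots> = (\<Sum>s\<in>?A. (if s = [0..<n] then of_bool (c < n \<and> q = Suc n - c) else 0) +
    (state c q s + of_bool (2 \<le> q) * (\<Sum>j\<in>{q..n+2}. state c j s) + (\<Sum>i\<in>{1..q}. state (c + i) (q - i) s)))"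
  proof (rule sum.cong)
    fix s assume s: "s \<in> ?A"
    show "(\<Sum>x\<in>allowed s. state c q (s @ [x])) = (if s = [0..<n] then of_bool (c < n \<and> q = Suc n - c) else 0) +
    (state c q s + of_bool (2 \<le> q) * (\<Sum>j\<in>{q..n+2}. state c j s) + (\<Sum>i\<in>{1..q}. state (c + i) (q - i) s))"
    proof (cases "distinct s")
      case True
      then have "s = [0..<n]" using s distinct_level[of n] by blast
      moreover have "state c' q' [0..<n] = 0" for c' q' by (simp add: state_def)
      ultimately show ?thesis using sum_children_distinct[OF assms] by simp
    next
      case False
      then have "s \<noteq> [0..<n]" by auto
      then show ?thesis using sum_children_not_distinct[of s n c q] s False by simp
    qed
  qed simp
  also have "\<dots> = of_bool (c < n \<and> q = Suc n - c) + (weight n c q +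
      of_bool (2 \<le> q) * (\<Sum>j\<in>{q..n+2}. weight n c j) + (\<Sum>i\<in>{1..q}. weight n (c + i) (q - i)))"
  proof -
    have "[0..<n] \<in> ?A" using distinct_level[of n] by blast
    then have 1: "(\<Sum>s\<in>?A. (if s = [0..<n] then of_bool (c < n \<and> q = Suc n - c) else 0)) = (of_bool (c < n \<and> q = Suc n - c) :: real)"
      by (subst sum.delta[OF finite_level]) simp
    have 2: "(\<Sum>s\<in>?A. \<Sum>j\<in>{q..n+2}. state c j s) = (\<Sum>j\<in>{q..n+2}. weight n c j)"
      "(\<Sum>s\<in>?A. \<Sum>i\<in>{1..q}. state (c + i) (q - i) s) = (\<Sum>i\<in>{1..q}. weight n (c + i) (q - i))"
      unfolding weight_def by (rule sum.swap)+
    show ?thesis unfolding sum.distrib sum_distrib_left[symmetric] 1 2 weight_def[symmetric] ..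
  qed
  finally show ?thesis by (simp add: add.assoc)
qed

text \<open>In the recurrence, \<open>ballot_diagonal\<close> merges the contribution of the
  distinct sequence with the letters that lower the threshold, \<open>sum_ballot\<close> evaluates
  the middle sum, and \<open>ballot_rec\<close> closes the induction.\<close>

lemma weight_eq:
  assumes "0 < n"
  shows "weight n c q = (if 2 \<le> q \<and> c < n then ballot (n - c) q else 0)"
  using assms
proof (induction n arbitrary: c q rule: nat_induct_non_zero)
  case 1
  have "\<not> (s \<in> K \<and> length s = 1 \<and> \<not> distinct s)" for s by (cases s) auto
  then have "weight 1 c q = 0" unfolding weight_def by (intro sum.neutral) (auto simp: state_def)
  then show ?case by (auto simp: ballot_eq_0)
next
  case (Suc n)
  show ?case
  proof (cases "2 \<le> q \<and> c < Suc n")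
    case False
    have "weight n (c + i) (q - i) = 0" if "i \<in> {1..q}" for i
      using that False unfolding Suc.IH by auto
    then have "(\<Sum>i\<in>{1..q}. weight n (c + i) (q - i)) = 0" by (rule sum.neutral[rule_format])
    moreover have "weight n c j = 0" if "2 \<le> q" for j using that False unfolding Suc.IH by auto
    ultimately show ?thesis using False Suc.hyps unfolding weight_Suc[OF Suc.hyps] by (auto simp: Suc.IH)
  next
    case True
    then obtain k where q: "q = Suc k" "1 \<le> k" by (cases q) auto
    define m where "m = n - c"
    have c: "c \<le> n" using True by simp
    have W: "weight n (c + i) j = (if 2 \<le> j then ballot (m - i) j else 0)" for i j
    proof (cases "c + i < n")
      case True then show ?thesis by (simp add: Suc.IH m_def diff_diff_left)
    next
      case False
      then have "m - i = 0" by (simp add: m_def)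
      then show ?thesis using False by (simp add: Suc.IH)
    qed
    have W0: "weight n c j = (if 2 \<le> j then ballot m j else 0)" for j using W[of 0 j] by simp
    have "(\<Sum>j\<in>{q..n+2}. weight n c j) = (\<Sum>j\<in>{q..n+2}. ballot m j)"
      by (rule sum.cong) (use True in \<open>auto simp: W0\<close>)
    also have "\<dots> = ballot (Suc m) (Suc q)" by (rule sum_ballot) (simp add: m_def)
    finally have 1: "(\<Sum>j\<in>{q..n+2}. weight n c j) = ballot (Suc m) (Suc q)" .
    \<comment> \<open>Counts with \<open>q - i\<close> below 2 vanish, which leaves the indices
      below k; the term i = 0 of \<open>ballot_diagonal\<close> is subtracted next.\<close>
    have "(\<Sum>i\<in>{1..q}. weight n (c + i) (q - i)) = (\<Sum>i\<in>{1..<k}. ballot (m - i) (q - i))"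
      by (rule sum.mono_neutral_cong_right) (auto simp: W q)
    also have "\<dots> = (\<Sum>i<k. ballot (m - i) (Suc k - i)) - ballot m q"
      using q by (simp add: lessThan_atLeast0 sum.atLeast_Suc_lessThan)
    also have "\<dots> = ballot m k - of_bool (m = k) - ballot m q" using ballot_diagonal[of m k] by simp
    finally have 2: "(\<Sum>i\<in>{1..q}. weight n (c + i) (q - i)) = ballot m k - of_bool (m = k) - ballot m q" .
    have 3: "c < n \<and> q = Suc n - c \<longleftrightarrow> m = k" using q c by (auto simp: m_def)
    have "ballot (Suc m) q = ballot m k + ballot (Suc m) (Suc q)" using ballot_rec[of m k] q by simp
    then show ?thesis unfolding weight_Suc[OF Suc.hyps] 1 2 3
      using True c by (simp add: W0 m_def Suc_diff_le)
  qed
qed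

text \<open>Summation over q gives \<open>ballot (Suc (n - c)) 3\<close>, a difference of
  consecutive Catalan numbers, so the sum over c is \<open>catalan n - 1\<close>. The missing
  sequence is the one without a repeated letter.\<close>

lemma card_level:
  assumes "0 < n"
  shows "real (card {s \<in> K. length s = n}) = catalan n"
proof -
  let ?A = "{s \<in> K. length s = n}"
  have one: "1 = (if s = [0..<n] then 1 else 0) + (\<Sum>c\<le>n. \<Sum>q\<le>n+2. state c q s)" if s: "s \<in> ?A" for s
  proof (cases "distinct s")
    case True
    then show ?thesis using s distinct_level[of n] by (auto simp: state_def)
  next
    case False
    have as: "ascent_seq s" using s by (simp add: K_def)
    have asc: "asc s \<le> n" using asc_le_length[of s] s by simp
    have "threshold s \<in> set s" using repeated_threshold[OF False] unfolding repeated_def by (metis nth_mem)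
    then have "threshold s \<le> n" using ascent_seq_le_asc[OF as, of "threshold s"] asc by simp
    moreover have "upper s \<subseteq> {..<asc s + 2}" by (auto simp: upper_def allowed_def)
    then have "card (upper s) \<le> n + 2" using card_mono[of "{..<asc s + 2}" "upper s"] asc by simp
    moreover have "(\<Sum>c\<le>n. \<Sum>q\<le>n+2. state c q s) = (\<Sum>c\<le>n. if c = threshold s then (\<Sum>q\<le>n+2. if q = card (upper s) then 1 else 0) else 0)"
      using False by (intro sum.cong) (auto simp: state_def intro!: sum.cong)
    moreover have "s \<noteq> [0..<n]" using False by auto
    ultimately show ?thesis by simp
  qed
  have "real (card ?A) = (\<Sum>s\<in>?A. 1)" by simp
  also have "\<dots> = (\<Sum>s\<in>?A. (if s = [0..<n] then 1 else 0) + (\<Sum>c\<le>n. \<Sum>q\<le>n+2. state c q s))"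
    by (rule sum.cong[OF refl one])
  also have "\<dots> = 1 + (\<Sum>c\<le>n. \<Sum>q\<le>n+2. weight n c q)"
  proof -
    have "[0..<n] \<in> ?A" using distinct_level[of n] by blast
    then have "(\<Sum>s\<in>?A. (if s = [0..<n] then 1 else 0)) = (1 :: real)"
      by (subst sum.delta[OF finite_level]) simp
    moreover have "(\<Sum>s\<in>?A. \<Sum>c\<le>n. \<Sum>q\<le>n+2. state c q s) = (\<Sum>c\<le>n. \<Sum>q\<le>n+2. weight n c q)"
      unfolding weight_def by (subst sum.swap, rule sum.cong[OF refl], rule sum.swap)
    ultimately show ?thesis by (simp add: sum.distrib)
  qed
  also have "(\<Sum>c\<le>n. \<Sum>q\<le>n+2. weight n c q) = (\<Sum>c<n. \<Sum>q\<le>n+2. weight n c q)"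
    by (simp add: lessThan_Suc_atMost[symmetric] weight_eq[OF assms])
  also have "\<dots> = (\<Sum>c<n. ballot (Suc (n - c)) 3)"
  proof (rule sum.cong)
    fix c assume "c \<in> {..<n}"
    then have "(\<Sum>q\<le>n+2. weight n c q) = (\<Sum>q\<in>{2..n+2}. ballot (n - c) q)"
      by (intro sum.mono_neutral_cong_right) (auto simp: weight_eq[OF assms])
    also have "\<dots> = ballot (Suc (n - c)) 3" by (subst sum_ballot) (simp_all add: numeral_eq_Suc)
    finally show "(\<Sum>q\<le>n+2. weight n c q) = ballot (Suc (n - c)) 3" .
  qed simp
  also have "\<dots> = (\<Sum>m<n. ballot (Suc (Suc m)) 3)"
    by (subst sum.nat_diff_reindex[symmetric]) (auto intro!: sum.cong simp: Suc_diff_Suc)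
  also have "\<dots> = (\<Sum>m<n. ballot (Suc (Suc m)) 1 - ballot (Suc m) 1)"
  proof (rule sum.cong)
    fix m
    show "ballot (Suc (Suc m)) 3 = ballot (Suc (Suc m)) 1 - ballot (Suc m) 1"
      using ballot_rec[of "Suc m" 1] ballot_rec[of "Suc m" 0] by (simp add: numeral_eq_Suc)
  qed simp
  also have "\<dots> = ballot (Suc n) 1 - ballot 1 1" using sum_lessThan_telescope[of "\<lambda>m. ballot (Suc m) 1" n] by simp
  also have "ballot 1 1 = 1" by (simp add: ballot_def)
  finally show ?thesis using ballot_1[of n] by simp
qed

end

section \<open>The two pairs as instances\<close>

interpretation weak: threshold_tree False .
interpretation strict: threshold_tree True .

lemma Sset_eq_weak: "Sset {[0,0,1,0],[0,0,2,1]} n = {s \<in> weak.K. length s = n}"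
proof -
  have "avoids s [0,0,1,0] \<and> avoids s [0,0,2,1] \<longleftrightarrow>
    \<not> (\<exists>i j k l. i < j \<and> j < k \<and> k < l \<and> l < length s \<and> s ! i = s ! j \<and> weak.R (s ! i) (s ! l) (s ! k))" for s
    unfolding avoids_def contains_0010 contains_0021 de_Morgan_disj[symmetric] ex_disj_distrib[symmetric] weak.R_def
    by (intro arg_cong[where f = Not] ex_cong1) auto
  then show ?thesis unfolding Sset_def weak.K_def by auto
qed

lemma Sset_eq_strict: "Sset {[0,0,1,1],[0,0,2,1]} n = {s \<in> strict.K. length s = n}"
proof -
  have "avoids s [0,0,1,1] \<and> avoids s [0,0,2,1] \<longleftrightarrow>
    \<not> (\<exists>i j k l. i < j \<and> j < k \<and> k < l \<and> l < length s \<and> s ! i = s ! j \<and> strict.R (s ! i) (s ! l) (s ! k))" for s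
    unfolding avoids_def contains_0011 contains_0021 de_Morgan_disj[symmetric] ex_disj_distrib[symmetric] strict.R_def
    by (intro arg_cong[where f = Not] ex_cong1) auto
  then show ?thesis unfolding Sset_def strict.K_def by auto
qed

section \<open>The pair (0001,1012)\<close>

text \<open>The patterns 0001 and 1012 together are the subsequences \<open>b a b c\<close> with \<open>a \<le> b < c\<close>:
  once \<open>b\<close> has returned after some \<open>a \<le> b\<close>, no later letter exceeds \<open>b\<close>.\<close>

definition returns :: "nat list \<Rightarrow> nat \<Rightarrow> bool" where
  "returns s b \<longleftrightarrow> (\<exists>i j. i < j \<and> j < length s \<and> s ! i = b \<and> s ! j \<le> b)"

text \<open>The letters c that would complete a forbidden subsequence if appended.\<close>

definition lid :: "nat list \<Rightarrow> nat \<Rightarrow> bool" where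
  "lid s c \<longleftrightarrow> (\<exists>i j k. i < j \<and> j < k \<and> k < length s \<and> s ! j \<le> s ! i \<and> s ! i = s ! k \<and> s ! k < c)"

definition rgf :: "nat list \<Rightarrow> bool" where
  "rgf s \<longleftrightarrow> (\<forall>i<length s. {..<s ! i} \<subseteq> set (take i s))"

definition rgf_avoiders :: "nat list set" where
  "rgf_avoiders = {s. rgf s \<and> \<not> (\<exists>i j k l. i < j \<and> j < k \<and> k < l \<and> l < length s \<and>
     s ! j \<le> s ! i \<and> s ! i = s ! k \<and> s ! k < s ! l)}"

lemma returns_Nil [simp]: "\<not> returns [] b" by (simp add: returns_def)
lemma lid_Nil [simp]: "\<not> lid [] c" by (simp add: lid_def)
lemma rgf_Nil [simp]: "rgf []" by (simp add: rgf_def)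

lemma returns_snoc: "returns (s @ [x]) b \<longleftrightarrow> returns s b \<or> b \<in> set s \<and> x \<le> b"
  unfolding returns_def ex2_snoc[where P = "\<lambda>y z. y = b \<and> z \<le> b"] in_set_conv_nth by blast

lemma lid_snoc: "lid (s @ [x]) c \<longleftrightarrow> lid s c \<or> returns s x \<and> x < c"
  unfolding lid_def returns_def ex3_snoc[where P = "\<lambda>y z w. z \<le> y \<and> y = w \<and> w < c"] by blast

lemma rgf_snoc: "rgf (s @ [x]) \<longleftrightarrow> rgf s \<and> {..<x} \<subseteq> set s"
  unfolding rgf_def by (auto simp: less_Suc_eq nth_append)

lemma rgf_avoiders_snoc: "s @ [x] \<in> rgf_avoiders \<longleftrightarrow> s \<in> rgf_avoiders \<and> {..<x} \<subseteq> set s \<and> \<not> lid s x"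
  unfolding rgf_avoiders_def mem_Collect_eq rgf_snoc
    ex4_snoc[where P = "\<lambda>y z w v. z \<le> y \<and> y = w \<and> w < v"] lid_def by blast

lemma rgf_avoiders_Nil: "[] \<in> rgf_avoiders" by (simp add: rgf_avoiders_def)

section \<open>The avoiding ascent sequences as restricted growth functions\<close>

definition lidless :: "nat list \<Rightarrow> bool" where
  "lidless s \<longleftrightarrow> (\<forall>c. \<not> lid s c)"

lemma lidless_Nil [simp]: "lidless []" by (simp add: lidless_def)

lemma lidless_snoc: "lidless (s @ [x]) \<longleftrightarrow> lidless s \<and> \<not> returns s x"
  unfolding lidless_def lid_snoc by blast

text \<open>The repeated letter behind a lid occurs in \<open>s\<close>, so it is below N and
  already blocks N.\<close>

lemma lidless_iff:
  assumes "set s \<subseteq> {..<N}"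
  shows "lidless s \<longleftrightarrow> \<not> lid s N"
proof
  assume N: "\<not> lid s N"
  show "lidless s" unfolding lidless_def lid_def
  proof clarify
    fix c i j k assume h: "i < j" "j < k" "k < length s" "s ! j \<le> s ! i" "s ! i = s ! k"
    then have "s ! k < N" using subsetD[OF assms nth_mem[of k s]] by simp
    then show False using N h unfolding lid_def by blast
  qed
qed (simp add: lidless_def)

lemma lidless_append: "lidless (s @ u) \<Longrightarrow> lidless s"
proof (induction u rule: rev_induct)
  case (snoc x u) then show ?case using lidless_snoc[of "s @ u" x] by simp
qed simp

lemma rgf_set: "rgf s \<Longrightarrow> \<exists>N. set s = {..<N}"
proof (induction s rule: rev_induct)
  case (snoc x s)
  then obtain N where N: "set s = {..<N}" "{..<x} \<subseteq> set s" by (auto simp: rgf_snoc)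
  then have "x \<le> N" using lessThan_subset_iff by metis
  moreover have "set (s @ [x]) = insert x {..<N}" using N(1) by simp
  ultimately have "set (s @ [x]) = {..<if x = N then Suc N else N}"
    by (simp add: lessThan_Suc insert_absorb)
  then show ?case by blast
qed (rule exI[of _ 0], simp)

text \<open>An ascent to a letter x that has occurred before would mean that x has returned, so
  appending it would create a lid. Every ascent therefore introduces a new maximum.\<close>

lemma asc_le_lidless:
  "rgf s \<Longrightarrow> lidless s \<Longrightarrow> s \<noteq> [] \<Longrightarrow> \<exists>y\<in>set s. asc s \<le> y"
proof (induction s rule: rev_induct)
  case (snoc x s)
  show ?case
  proof (cases "s = []")
    case True then show ?thesis by (simp add: asc_def)
  next
    case False
    have s: "rgf s" "lidless s" "\<not> returns s x" "{..<x} \<subseteq> set s"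
      using snoc.prems by (auto simp: rgf_snoc lidless_snoc)
    obtain y where y: "y \<in> set s" "asc s \<le> y" using snoc.IH s False by blast
    show ?thesis
    proof (cases "last s < x")
      case True
      have "x \<notin> set s"
      proof
        assume "x \<in> set s"
        have "s = butlast s @ [last s]" using False by simp
        then have "returns s x" using returns_snoc[of "butlast s" "last s" x] True \<open>x \<in> set s\<close>
          by (metis Un_iff empty_iff insert_iff less_imp_le less_irrefl list.set(1) list.simps(15) set_append)
        then show False using s(3) by simp
      qed
      obtain N where N: "set s = {..<N}" using rgf_set[OF s(1)] by blast
      then have "y < x" using y(1) \<open>x \<notin> set s\<close> by auto
      then show ?thesis using y True False by (auto simp: asc_snoc)
    next
      case nl: False
      then show ?thesis using y False by (auto simp: asc_snoc)
    qed
  qed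
qed simp

text \<open>The growth condition could fail only at a letter x that skips a value. Since x is not
  blocked, the prefix is lidless, so \<open>asc_le_lidless\<close> bounds its ascents by its
  maximum, and the ascent bound rules out the skip. Conversely, a letter x > 0 has x - 1 in front of
  it, and letters never exceed the number of ascents.\<close>

lemma rgf_avoiders_iff: "s \<in> rgf_avoiders \<longleftrightarrow> ascent_seq s \<and> avoids s [0,0,0,1] \<and> avoids s [1,0,1,2]"
proof -
  have av: "avoids s [0,0,0,1] \<and> avoids s [1,0,1,2] \<longleftrightarrow>
    \<not> (\<exists>i j k l. i < j \<and> j < k \<and> k < l \<and> l < length s \<and> s ! j \<le> s ! i \<and> s ! i = s ! k \<and> s ! k < s ! l)" for s
    unfolding avoids_def contains_0001 contains_1012 de_Morgan_disj[symmetric] ex_disj_distrib[symmetric]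
    by (intro arg_cong[where f = Not] ex_cong1) auto
  have 1: "s \<in> rgf_avoiders \<Longrightarrow> ascent_seq s" for s
  proof (induction s rule: rev_induct)
    case (snoc x s)
    then have s: "ascent_seq s" "{..<x} \<subseteq> set s" by (auto simp: rgf_avoiders_snoc)
    have "x \<le> (if s = [] then 0 else asc s + 1)"
    proof (cases x)
      case (Suc y)
      then have "y \<in> set s" using s by auto
      then show ?thesis using ascent_seq_le_asc[OF s(1)] Suc by auto
    qed simp
    then show ?case using s by (simp add: ascent_seq_snoc)
  qed (simp add: ascent_seq_Nil)
  have 2: "ascent_seq s \<Longrightarrow> avoids s [0,0,0,1] \<and> avoids s [1,0,1,2] \<Longrightarrow> rgf s" for s
    unfolding av
  proof (induction s rule: rev_induct)
    case (snoc x s)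
    have s: "ascent_seq s" "x \<le> (if s = [] then 0 else asc s + 1)" using snoc.prems(1) by (auto simp: ascent_seq_snoc)
    have np: "\<not> (\<exists>i j k l. i < j \<and> j < k \<and> k < l \<and> l < length s \<and> s ! j \<le> s ! i \<and> s ! i = s ! k \<and> s ! k < s ! l)"
      "\<not> lid s x"
      using snoc.prems(2) unfolding lid_def ex4_snoc[where P = "\<lambda>y z w v. z \<le> y \<and> y = w \<and> w < v"] by blast+
    then have "rgf s" using snoc.IH s by blast
    then obtain N where N: "set s = {..<N}" using rgf_set by blast
    have "x \<le> N"
    proof (rule ccontr)
      assume "\<not> x \<le> N"
      then have "lidless s" using np(2) lidless_iff[of s x] N by auto
      moreover have "s \<noteq> []" using s(2) \<open>\<not> x \<le> N\<close> by auto
      ultimately obtain y where "y \<in> set s" "asc s \<le> y" using asc_le_lidless \<open>rgf s\<close> by blast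
      then show False using N s(2) \<open>s \<noteq> []\<close> \<open>\<not> x \<le> N\<close> by auto
    qed
    then show ?case using N \<open>rgf s\<close> by (auto simp: rgf_snoc)
  qed simp
  show ?thesis using 1[of s] 2[of s] av[of s] unfolding rgf_avoiders_def by blast
qed

lemma Sset_eq_rgf_avoiders: "Sset {[0,0,0,1],[1,0,1,2]} n = {s \<in> rgf_avoiders. length s = n}"
  unfolding Sset_def rgf_avoiders_iff by auto

section \<open>Deleting the copies of the maximum\<close>

lemma returns_filter:
  "x < N \<Longrightarrow> set z \<subseteq> {..N} \<Longrightarrow> returns (filter (\<lambda>y. y < N) z) x \<longleftrightarrow> returns z x"
  by (induction z rule: rev_induct) (auto simp: returns_snoc)

lemma lid_filter:
  "c \<le> N \<Longrightarrow> set z \<subseteq> {..N} \<Longrightarrow> lid (filter (\<lambda>y. y < N) z) c \<longleftrightarrow> lid z c"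
  by (induction z rule: rev_induct) (auto simp: lid_snoc returns_filter)

text \<open>The prefixes after which a new maximum N may stand: all smaller letters have occurred
  and none of them blocks N.\<close>

definition good :: "nat \<Rightarrow> nat list \<Rightarrow> bool" where
  "good N p \<longleftrightarrow> lidless p \<and> {..<N} \<subseteq> set p"

text \<open>Copies of N do not influence whether a smaller letter may be appended, nor, once
  deleted, whether a further N may be. So each copy can be tested separately on the filtered prefix
  in front of it.\<close>

lemma rgf_avoiders_filter:
  "set z \<subseteq> {..N} \<Longrightarrow> z \<in> rgf_avoiders \<longleftrightarrow> filter (\<lambda>y. y < N) z \<in> rgf_avoiders \<and>
     (\<forall>u v. z = u @ N # v \<longrightarrow> good N (filter (\<lambda>y. y < N) u))"
proof (induction z rule: rev_induct)
  case Nil then show ?case by (simp add: rgf_avoiders_Nil)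
next
  case (snoc x z)
  let ?F = "filter (\<lambda>y. y < N)"
  have IH: "z \<in> rgf_avoiders \<longleftrightarrow> ?F z \<in> rgf_avoiders \<and> (\<forall>u v. z = u @ N # v \<longrightarrow> good N (?F u))"
    using snoc by simp
  have z: "set z \<subseteq> {..N}" "x \<le> N" using snoc.prems by auto
  have dec: "z @ [x] = u @ N # v \<longleftrightarrow> (\<exists>v'. v = v' @ [x] \<and> z = u @ N # v') \<or> v = [] \<and> x = N \<and> z = u" for u v
    by (cases v rule: rev_cases) auto
  have sub: "{..<y} \<subseteq> set (?F z) \<longleftrightarrow> {..<y} \<subseteq> set z" if "y \<le> N" for y using that by auto
  show ?case
  proof (cases "x = N")
    case True
    have "lidless (?F z) \<longleftrightarrow> \<not> lid z N" using lidless_iff[of "?F z" N] lid_filter[of N N z] z by auto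
    then have "good N (?F z) \<longleftrightarrow> {..<N} \<subseteq> set z \<and> \<not> lid z N" using sub[of N] by (auto simp: good_def)
    then show ?thesis unfolding rgf_avoiders_snoc dec IH using True by auto
  next
    case False
    then have "x < N" using z by simp
    then show ?thesis unfolding rgf_avoiders_snoc dec IH
      using False sub[of x] lid_filter[of x N z] z by (auto simp: rgf_avoiders_snoc)
  qed
qed

text \<open>Every letter is at most N, so N has returned as soon as anything follows its first copy,
  and a later N creates a lid. The head of \<open>q\<close> is exempt because nothing lies between
  it and the first N; hence \<open>tl q\<close>.\<close>

lemma lidless_filter:
  assumes "N \<notin> set w"
  shows "set (w @ N # q) \<subseteq> {..N} \<Longrightarrow>
    lidless (w @ N # q) \<longleftrightarrow> lidless (filter (\<lambda>y. y < N) (w @ N # q)) \<and> N \<notin> set (tl q)"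
proof (induction q rule: rev_induct)
  case Nil
  then have "filter (\<lambda>y. y < N) w = w" using assms by (intro filter_True) (auto simp: le_less)
  moreover have "\<not> returns w N" using assms unfolding returns_def by (metis less_trans nth_mem)
  ultimately show ?case by (simp add: lidless_snoc)
next
  case (snoc x q)
  let ?z = "w @ N # q"
  have z: "set ?z \<subseteq> {..N}" "x \<le> N" using snoc.prems by auto
  have IH: "lidless ?z \<longleftrightarrow> lidless (filter (\<lambda>y. y < N) ?z) \<and> N \<notin> set (tl q)" using snoc.IH z by blast
  have eq: "w @ N # q @ [x] = ?z @ [x]" by simp
  show ?case
  proof (cases "x = N")
    case True
    have "returns ?z N \<longleftrightarrow> q \<noteq> []"
    proof
      assume "returns ?z N"
      then show "q \<noteq> []"
        using returns_snoc[of w N N] assms unfolding returns_def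
        by (metis (no_types, lifting) append_Cons append_Nil less_trans nth_mem returns_def)
    next
      assume "q \<noteq> []"
      then have "hd q \<le> N" using z(1) by (cases q) auto
      then show "returns ?z N" unfolding returns_def using \<open>q \<noteq> []\<close>
        by (intro exI[of _ "length w"] exI[of _ "Suc (length w)"]) (auto simp: nth_append hd_conv_nth)
    qed
    then show ?thesis unfolding eq lidless_snoc IH using True by (cases q) auto
  next
    case False
    then have "x < N" using z by simp
    have "filter (\<lambda>y. y < N) (?z @ [x]) = filter (\<lambda>y. y < N) ?z @ [x]" using \<open>x < N\<close> by simp
    moreover have "N \<in> set (tl (q @ [x])) \<longleftrightarrow> N \<in> set (tl q)" using False by (cases q) auto
    ultimately show ?thesis unfolding eq lidless_snoc IH
      using returns_filter[OF \<open>x < N\<close> z(1)] by (metis lidless_snoc)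
  qed
qed

section \<open>The block of admissible positions\<close>

text \<open>\<open>Z\<close> is the block into which the copies of a new maximum \<open>N\<close> may be inserted: before it some
  letter below \<open>N\<close> is still missing, after it some letter below \<open>N\<close> has returned.\<close>

definition active :: "nat \<Rightarrow> nat list \<Rightarrow> nat list \<Rightarrow> nat list \<Rightarrow> nat list \<Rightarrow> bool" where
  "active N s u Z v \<longleftrightarrow> s = u @ Z @ v \<and>
     (\<forall>i\<le>length s. good N (take i s) \<longleftrightarrow> length u \<le> i \<and> i \<le> length u + length Z)"

lemma activeD:
  assumes "active N s u Z v"
  shows "s = u @ Z @ v"
    "i \<le> length s \<Longrightarrow> good N (take i s) \<longleftrightarrow> length u \<le> i \<and> i \<le> length u + length Z"
  using assms unfolding active_def by blast+

text \<open>A block of t letters has t + 1 gaps, each given by a good prefix; hence the subtraction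
  of 1.\<close>

definition zone :: "nat list \<Rightarrow> nat" where
  "zone s = card {i. i \<le> length s \<and> good (card (set s)) (take i s)} - 1"

lemma zone_active:
  assumes "active N s u Z v" "set s = {..<N}"
  shows "zone s = length Z"
proof -
  have c: "card (set s) = N" using assms(2) by simp
  have "length u + length Z \<le> length s" using activeD(1)[OF assms(1)] by simp
  then have "i \<le> length s \<and> good N (take i s) \<longleftrightarrow> i \<in> {length u..length u + length Z}" for i
    using activeD(2)[OF assms(1), of i] by auto
  then have "{i. i \<le> length s \<and> good (card (set s)) (take i s)} = {length u..length u + length Z}"
    unfolding c by blast
  then show ?thesis by (simp add: zone_def)
qed

lemma rgf_avoiders_append: "s @ u \<in> rgf_avoiders \<Longrightarrow> s \<in> rgf_avoiders"
proof (induction u rule: rev_induct)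
  case (snoc x u) then show ?case using rgf_avoiders_snoc[of "s @ u" x] by simp
qed simp

text \<open>The prefix ending at the first copy of the largest letter \<open>M\<close> qualifies:
  \<open>M\<close> was not blocked there, and a first copy cannot have returned before.\<close>

lemma good_prefix_exists:
  assumes "s \<in> rgf_avoiders" "set s = {..<N}"
  shows "\<exists>i\<le>length s. good N (take i s)"
proof (cases N)
  case 0 then show ?thesis by (intro exI[of _ 0]) (simp add: good_def)
next
  case (Suc M)
  then have "M \<in> set s" using assms by simp
  then obtain u v where s: "s = u @ M # v" "M \<notin> set u" by (meson split_list_first)
  have "u @ [M] \<in> rgf_avoiders" using rgf_avoiders_append[of "u @ [M]" v] assms(1) s(1) by simp
  then have h: "{..<M} \<subseteq> set u" "\<not> lid u M" by (auto simp: rgf_avoiders_snoc)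
  have "set u \<subseteq> {..<N}" using assms(2) s(1) by auto
  then have "set u \<subseteq> {..<M}" using Suc s(2) by (metis lessThan_Suc subset_insert)
  then have "lidless u" using lidless_iff h(2) by blast
  moreover have "\<not> returns u M" using s(2) unfolding returns_def by (metis less_trans nth_mem)
  ultimately have "good N (u @ [M])" using h(1) Suc by (auto simp: good_def lidless_snoc lessThan_Suc)
  then show ?thesis using s(1) by (intro exI[of _ "Suc (length u)"]) simp
qed

text \<open>Containing all letters below N is preserved by longer prefixes, being lidless by shorter
  ones; so the good prefixes form an interval.\<close>

lemma active_exists:
  assumes "s \<in> rgf_avoiders" "set s = {..<N}"
  obtains u Z v where "active N s u Z v"
proof -
  define G where "G = {i. i \<le> length s \<and> good N (take i s)}"
  have G: "finite G" "G \<noteq> {}" using good_prefix_exists[OF assms] by (auto simp: G_def)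
  define a b where "a = Min G" and "b = Max G"
  have ab: "a \<in> G" "b \<in> G" "a \<le> b" unfolding a_def b_def using G by auto
  have bounds: "a \<le> i \<and> i \<le> b" if "i \<in> G" for i using G that by (simp add: a_def b_def)
  have conv: "i \<in> G" if "a \<le> i" "i \<le> b" for i
  proof -
    have g: "good N (take a s)" "good N (take b s)" "b \<le> length s" using ab by (auto simp: G_def)
    have "take b s = take i s @ take (b - i) (drop i s)" using that by (metis le_add_diff_inverse take_add)
    then have "lidless (take i s)" using g(2) lidless_append[of "take i s" "take (b - i) (drop i s)"]
      by (simp only: good_def)
    moreover have "set (take a s) \<subseteq> set (take i s)" using that(1) by (rule set_take_subset_set_take)
    moreover have "{..<N} \<subseteq> set (take a s)" using g(1) by (simp add: good_def)
    ultimately have "good N (take i s)" unfolding good_def by blast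
    then show ?thesis using g(3) that by (simp add: G_def)
  qed
  have "active N s (take a s) (take (b - a) (drop a s)) (drop b s)"
    unfolding active_def
  proof (intro conjI allI impI)
    have "b \<le> length s" using ab by (simp add: G_def)
    have "take b s = take a s @ take (b - a) (drop a s)" using ab(3) by (metis le_add_diff_inverse take_add)
    then show "s = take a s @ take (b - a) (drop a s) @ drop b s"
      by (metis append.assoc append_take_drop_id)
    fix i assume "i \<le> length s"
    have "good N (take i s) \<longleftrightarrow> i \<in> G" using \<open>i \<le> length s\<close> by (simp add: G_def)
    also have "\<dots> \<longleftrightarrow> a \<le> i \<and> i \<le> b" using conv bounds by blast
    also have "\<dots> \<longleftrightarrow> length (take a s) \<le> i \<and> i \<le> length (take a s) + length (take (b - a) (drop a s))"
      using ab(3) \<open>b \<le> length s\<close> by auto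
    finally show "good N (take i s) \<longleftrightarrow> length (take a s) \<le> i \<and> i \<le> length (take a s) + length (take (b - a) (drop a s))" .
  qed
  then show thesis by (rule that)
qed

lemma filter_less_id: "set u \<subseteq> {..<N} \<Longrightarrow> filter (\<lambda>y. y < N) u = (u :: nat list)"
  by (intro filter_True) auto

lemma subset_lessThan_if_notin:
  assumes "set u \<subseteq> {..N}" "N \<notin> set u" shows "set u \<subseteq> {..<N :: nat}"
proof
  fix y assume "y \<in> set u"
  then have "y \<le> N" "y \<noteq> N" using assms by auto
  then show "y \<in> {..<N}" by simp
qed

text \<open>Goodness at the first copy of N keeps \<open>u\<close> intact and at the last copy keeps
  \<open>v\<close> intact. In between, every gap corresponds to a good prefix, so the copies can be
  placed freely.\<close>

lemma fibre:
  assumes s: "s \<in> rgf_avoiders" "set s = {..<N}" and act: "active N s u Z v"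
  shows "{z \<in> rgf_avoiders. filter (\<lambda>y. y < N) z = s \<and> N \<in> set z \<and> set z \<subseteq> {..N}} =
    (\<lambda>Y. u @ Y @ v) ` {Y. filter (\<lambda>y. y < N) Y = Z \<and> N \<in> set Y \<and> set Y \<subseteq> {..N}}"
    (is "?L = ?f ` ?R")
proof
  let ?F = "filter (\<lambda>y. y < N)"
  have sd: "s = u @ Z @ v" by (rule activeD(1)[OF act])
  have g: "good N (take i s) \<longleftrightarrow> length u \<le> i \<and> i \<le> length u + length Z" if "i \<le> length s" for i
    using activeD(2)[OF act that] .
  have uv: "set u \<subseteq> {..<N}" "set v \<subseteq> {..<N}" "set Z \<subseteq> {..<N}" using s(2) sd by auto
  then have F: "?F u = u" "?F v = v" "?F Z = Z" by (simp_all add: filter_less_id)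
  have Nuv: "N \<notin> set u" "N \<notin> set v" using uv by auto
  show "?f ` ?R \<subseteq> ?L"
  proof
    fix z assume "z \<in> ?f ` ?R"
    then obtain Y where Y: "z = u @ Y @ v" "?F Y = Z" "N \<in> set Y" "set Y \<subseteq> {..N}" by blast
    have z: "?F z = s" "N \<in> set z" "set z \<subseteq> {..N}" using Y uv F sd by auto
    have "good N (?F p)" if pq: "z = p @ N # q" for p q
    proof -
      define l where "l = length p"
      have l: "z ! l = N" "l < length z" "p = take l z" using pq by (simp_all add: l_def)
      have lu: "length u \<le> l"
      proof (rule ccontr)
        assume "\<not> length u \<le> l"
        then have "u ! l = N" "l < length u" using l Y(1) by (auto simp: nth_append)
        then show False using Nuv(1) nth_mem by blast
      qed
      have lY: "l < length u + length Y"
      proof (rule ccontr)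
        assume n: "\<not> l < length u + length Y"
        then have "v ! (l - length u - length Y) = N" "l - length u - length Y < length v"
          using l Y(1) by (auto simp: nth_append)
        then show False using Nuv(2) nth_mem by blast
      qed
      define m where "m = l - length u"
      have "p = u @ take m Y" using l(3) lu lY Y(1) by (simp add: m_def)
      then have Fp: "?F p = u @ ?F (take m Y)" using F by simp
      have "Z = ?F (take m Y) @ ?F (drop m Y)" using Y(2) by (metis append_take_drop_id filter_append)
      then have le: "length (?F (take m Y)) \<le> length Z" and sp: "s = ?F p @ ?F (drop m Y) @ v"
        using sd Fp by simp_all
      define L where "L = length (?F p)"
      have "take L s = ?F p" "L \<le> length s" unfolding L_def
        by (metis sp append_eq_conv_conj, metis sp le_add1 length_append)
      moreover have "length u \<le> L" "L \<le> length u + length Z" using le by (simp_all add: L_def Fp)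
      ultimately show ?thesis using g[of L] by metis
    qed
    then show "z \<in> ?L" using rgf_avoiders_filter[OF z(3)] z s(1) by simp
  qed
  show "?L \<subseteq> ?f ` ?R"
  proof
    fix z assume "z \<in> ?L"
    then have z: "z \<in> rgf_avoiders" "?F z = s" "N \<in> set z" "set z \<subseteq> {..N}" by auto
    have good: "good N (?F p)" if "z = p @ N # q" for p q using rgf_avoiders_filter[OF z(4)] z(1) that by blast
    obtain z1 z2 where z1: "z = z1 @ N # z2" "N \<notin> set z1" using z(3) by (meson split_list_first)
    obtain w1 w2 where w1: "z = w1 @ N # w2" "N \<notin> set w2" using z(3) by (meson split_list_last)
    have "set z1 \<subseteq> {..N}" using z(4) z1(1) by simp
    then have "set z1 \<subseteq> {..<N}" using z1(2) by (rule subset_lessThan_if_notin)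
    moreover have "set w2 \<subseteq> {..N}" using z(4) w1(1) by simp
    then have "set w2 \<subseteq> {..<N}" using w1(2) by (rule subset_lessThan_if_notin)
    ultimately
    have Fz1: "?F z1 = z1" and Fw2: "?F w2 = w2" by (simp_all add: filter_less_id)
    have s1: "s = z1 @ ?F z2" using z(2) z1(1) Fz1 by simp
    then have "take (length z1) s = z1" by simp
    then have len1: "length u \<le> length z1" using g[of "length z1"] good[OF z1(1)] Fz1 s1 by simp
    have "take (length u) s = take (length u) z1" using s1 len1 by simp
    then have "take (length u) z1 = u" using sd by simp
    then obtain z1' where z1': "z1 = u @ z1'" by (metis append_take_drop_id)
    have s2: "s = ?F w1 @ w2" using z(2) w1(1) Fw2 by simp
    then have "take (length (?F w1)) s = ?F w1" "length (?F w1) \<le> length s" by simp_all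
    then have len2: "length (?F w1) \<le> length u + length Z" using g[of "length (?F w1)"] good[OF w1(1)] by simp
    have "w2 = drop (length (?F w1)) s" using s2 by simp
    then have w2: "w2 = drop (length (?F w1)) (u @ Z) @ v" using sd len2 by simp
    define w2' where "w2' = drop (length (?F w1)) (u @ Z)"
    have w2': "w2 = w2' @ v" using w2 by (simp only: w2'_def)
    have len3: "length z1 \<le> length w1"
    proof (rule ccontr)
      assume "\<not> length z1 \<le> length w1"
      then have "z1 ! length w1 = N" using z1(1) w1(1) by (metis not_le nth_append nth_append_length)
      then show False using z1(2) \<open>\<not> length z1 \<le> length w1\<close> by (metis not_le nth_mem)
    qed
    have "take (length u) w1 = u"
    proof -
      have "take (length u) w1 = take (length u) z" using w1(1) len1 len3 by simp
      also have "\<dots> = u" using z1(1) z1' by simp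
      finally show ?thesis .
    qed
    then obtain w1' where w1': "w1 = u @ w1'" by (metis append_take_drop_id)
    have zY: "z = u @ (w1' @ N # w2') @ v" using w1(1) w1' w2' by simp
    then have "?F (w1' @ N # w2') = Z" using z(2) sd F by (simp only: filter_append same_append_eq append_same_eq)
    moreover have "N \<in> set (w1' @ N # w2')" "set (w1' @ N # w2') \<subseteq> {..N}" using zY z(4) by auto
    ultimately show "z \<in> ?f ` ?R" using zY by blast
  qed
qed

text \<open>If \<open>q\<close> follows the first \<open>N\<close> inside the block, the next block stops before \<open>N\<close> recurs,
  except that an immediate repetition \<open>N N\<close> is harmless.\<close>

definition reach :: "nat \<Rightarrow> nat list \<Rightarrow> nat" where
  "reach N q = (case q of [] \<Rightarrow> 0 | y # r \<Rightarrow> Suc (length (takeWhile (\<lambda>y. y \<noteq> N) r)))"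

lemma reach_simps [simp]: "reach N [] = 0" "reach N (y # r) = Suc (length (takeWhile (\<lambda>y. y \<noteq> N) r))"
  by (simp_all add: reach_def)

lemma notin_take_iff:
  "i \<le> length r \<Longrightarrow> N \<notin> set (take i r) \<longleftrightarrow> i \<le> length (takeWhile (\<lambda>y. y \<noteq> N) r)"
proof (induction r arbitrary: i)
  case (Cons a r) then show ?case by (cases i) auto
qed simp

lemma reach_le: "reach N q \<le> length q"
  by (cases q) (auto simp: length_takeWhile_le)

lemma reach_iff: "j \<le> length q \<Longrightarrow> N \<notin> set (tl (take j q)) \<longleftrightarrow> j \<le> reach N q"
  by (cases q; cases j) (auto simp: notin_take_iff)

text \<open>A prefix is good for \<open>Suc N\<close> if it contains the first N, its filtered form
  is good for N, and N does not recur beyond an immediate repetition. So the new block begins after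
  the first N; the second condition would let it run to the end of \<open>Y\<close>, and the third
  cuts it at \<open>reach\<close>.\<close>

lemma zone_insert:
  assumes s: "set s = {..<N}" and act: "active N s u Z v"
    and Y: "filter (\<lambda>y. y < N) Y = Z" "N \<in> set Y" "set Y \<subseteq> {..N}"
  shows "zone (u @ Y @ v) = reach N (tl (dropWhile (\<lambda>y. y \<noteq> N) Y))"
proof -
  let ?F = "filter (\<lambda>y. y < N)"
  have sd: "s = u @ Z @ v" by (rule activeD(1)[OF act])
  have g: "good N (take i s) \<longleftrightarrow> length u \<le> i \<and> i \<le> length u + length Z" if "i \<le> length s" for i
    using activeD(2)[OF act that] .
  have uv: "set u \<subseteq> {..<N}" "set v \<subseteq> {..<N}" using s(1) sd by auto
  then have F: "?F u = u" "?F v = v" by (simp_all add: filter_less_id)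
  obtain y1 Y2 where y1: "Y = y1 @ N # Y2" "N \<notin> set y1" using Y(2) by (meson split_list_first)
  have t: "tl (dropWhile (\<lambda>y. y \<noteq> N) Y) = Y2" unfolding y1(1) using y1(2) by (induction y1) auto
  have "set y1 \<subseteq> {..N}" using Y(3) y1(1) by simp
  then have y1s: "set y1 \<subseteq> {..<N}" using y1(2) by (rule subset_lessThan_if_notin)
  then have Fy1: "?F y1 = y1" by (rule filter_less_id)
  then have Z: "Z = y1 @ ?F Y2" using Y(1) y1(1) by simp
  define w where "w = u @ y1"
  have Nw: "N \<notin> set w" using uv y1s by (auto simp: w_def)
  define z where "z = u @ Y @ v"
  have z: "z = w @ N # (Y2 @ v)" using y1 by (simp add: z_def w_def)
  have zset: "set z \<subseteq> {..N}" using Y(3) uv by (auto simp: z_def)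
  have "take (length u) s = u" using sd by simp
  then have gu: "{..<N} \<subseteq> set u" using g[of "length u"] sd by (simp add: good_def)
  then have "{..<Suc N} \<subseteq> set z" unfolding lessThan_Suc z by (auto simp: w_def)
  then have zs: "set z = {..<Suc N}" using zset by (auto simp: lessThan_Suc_atMost)
  have "active (Suc N) z (w @ [N]) (take (reach N Y2) Y2) (drop (reach N Y2) Y2 @ v)"
    unfolding active_def
  proof (intro conjI allI impI)
    show "z = (w @ [N]) @ take (reach N Y2) Y2 @ drop (reach N Y2) Y2 @ v"
      using z by (simp add: append_assoc[symmetric] del: append_assoc)
    fix i assume i: "i \<le> length z"
    have "good (Suc N) (take i z) \<longleftrightarrow> length w < i \<and> i \<le> length w + 1 + reach N Y2"
    proof (cases "i \<le> length w")
      case True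
      then have "take i z = take i w" using z by simp
      then have "N \<notin> set (take i z)" using Nw by (metis in_set_takeD)
      then show ?thesis using True by (auto simp: good_def)
    next
      case False
      define j where "j = i - length w - 1"
      define q where "q = take j (Y2 @ v)"
      have ij: "i = length w + 1 + j" using False by (simp add: j_def)
      have tz: "take i z = w @ N # q" using z by (simp add: ij q_def)
      have jl: "j \<le> length Y2 + length v" using i z ij by simp
      have qs: "set (w @ N # q) \<subseteq> {..N}" using zset tz set_take_subset[of i z] by auto
      have Fq: "?F (w @ N # q) = u @ y1 @ ?F q" using F Fy1 by (simp add: w_def)
      have "?F (Y2 @ v) = ?F q @ ?F (drop j (Y2 @ v))" unfolding q_def by (metis append_take_drop_id filter_append)
      then have sq: "s = (u @ y1 @ ?F q) @ ?F (drop j (Y2 @ v))" using sd Z F by simp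
      have "good N (u @ y1 @ ?F q) \<longleftrightarrow> length (?F q) \<le> length (?F Y2)"
      proof -
        have "take (length (u @ y1 @ ?F q)) s = u @ y1 @ ?F q" "length (u @ y1 @ ?F q) \<le> length s"
          using sq by (metis append_eq_conv_conj, metis length_append le_add1)
        then show ?thesis using g[of "length (u @ y1 @ ?F q)"] Z by simp
      qed
      moreover have "length (?F q) \<le> length (?F Y2) \<longleftrightarrow> j \<le> length Y2"
      proof (cases "j \<le> length Y2")
        case True
        then have "Y2 = q @ drop j Y2" by (simp add: q_def)
        then show ?thesis using True by (metis filter_append le_add1 length_append)
      next
        case False
        then have "q = Y2 @ take (j - length Y2) v" by (simp add: q_def)
        moreover have "?F (take (j - length Y2) v) = take (j - length Y2) v"
          using uv set_take_subset[of "j - length Y2" v] by (intro filter_less_id) auto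
        ultimately show ?thesis using False jl by simp
      qed
      moreover have "good (Suc N) (take i z) \<longleftrightarrow> good N (u @ y1 @ ?F q) \<and> N \<notin> set (tl q)"
      proof -
        have "{..<N} \<subseteq> set (u @ y1 @ ?F q)" using gu by auto
        moreover have "{..<Suc N} \<subseteq> set (w @ N # q)" unfolding lessThan_Suc using gu by (auto simp: w_def)
        ultimately show ?thesis unfolding tz good_def lidless_filter[OF Nw qs] Fq by blast
      qed
      moreover have "j \<le> length Y2 \<Longrightarrow> N \<notin> set (tl q) \<longleftrightarrow> j \<le> reach N Y2"
        using reach_iff[of j Y2 N] by (simp add: q_def)
      ultimately have "good (Suc N) (take i z) \<longleftrightarrow> j \<le> reach N Y2" using reach_le[of N Y2] by auto
      then show ?thesis using ij by simp
    qed
    then show "good (Suc N) (take i z) \<longleftrightarrow> length (w @ [N]) \<le> i \<and>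
      i \<le> length (w @ [N]) + length (take (reach N Y2) Y2)" using reach_le[of N Y2] by auto
  qed
  then show ?thesis using zone_active[OF _ zs] reach_le[of N Y2] t by (simp add: z_def)
qed

section \<open>Generating functions for insertions into a block\<close>

definition insertions :: "nat \<Rightarrow> nat list \<Rightarrow> nat \<Rightarrow> nat list set" where
  "insertions N Z k = {Y. filter (\<lambda>y. y \<noteq> N) Y = Z \<and> length Y = length Z + k}"

text \<open>x marks only the inserted copies of N; the letters of \<open>Z\<close> carry no
  weight.\<close>

definition ins_fps :: "nat \<Rightarrow> nat list \<Rightarrow> (nat list \<Rightarrow> bool) \<Rightarrow> real fps" where
  "ins_fps N Z P = Abs_fps (\<lambda>k. real (card {Y \<in> insertions N Z k. P Y}))"

lemma finite_insertions: "finite (insertions N Z k)"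
proof (rule finite_subset)
  show "insertions N Z k \<subseteq> {Y. set Y \<subseteq> insert N (set Z) \<and> length Y = length Z + k}"
    unfolding insertions_def by auto
qed (simp add: finite_lists_length_eq)

lemma ins_fps_Nil: "ins_fps N [] P = of_bool (P []) + fps_X * ins_fps N [] (\<lambda>Y. P (N # Y))"
proof (rule fps_ext)
  fix k
  show "ins_fps N [] P $ k = (of_bool (P []) + fps_X * ins_fps N [] (\<lambda>Y. P (N # Y))) $ k"
  proof (cases k)
    case 0
    have "{Y \<in> insertions N [] 0. P Y} = (if P [] then {[]} else {})" by (auto simp: insertions_def)
    then show ?thesis using 0 by (simp add: ins_fps_def)
  next
    case (Suc j)
    have "{Y \<in> insertions N [] (Suc j). P Y} = (#) N ` {Y \<in> insertions N [] j. P (N # Y)}"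
    proof (intro set_eqI iffI)
      fix Y assume "Y \<in> {Y \<in> insertions N [] (Suc j). P Y}"
      then show "Y \<in> (#) N ` {Y \<in> insertions N [] j. P (N # Y)}"
        by (cases Y) (auto simp: insertions_def split: if_splits)
    qed (auto simp: insertions_def)
    then have "card {Y \<in> insertions N [] (Suc j). P Y} = card {Y \<in> insertions N [] j. P (N # Y)}"
      by (simp add: card_image)
    then show ?thesis using Suc by (simp add: ins_fps_def)
  qed
qed

lemma ins_fps_Cons:
  assumes "a \<noteq> N"
  shows "ins_fps N (a # Z) P = fps_X * ins_fps N (a # Z) (\<lambda>Y. P (N # Y)) + ins_fps N Z (\<lambda>Y. P (a # Y))"
proof (rule fps_ext)
  fix k
  let ?A = "if k = 0 then {} else (#) N ` {Y \<in> insertions N (a # Z) (k - 1). P (N # Y)}"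
  let ?B = "(#) a ` {Y \<in> insertions N Z k. P (a # Y)}"
  have "{Y \<in> insertions N (a # Z) k. P Y} = ?A \<union> ?B"
  proof (intro set_eqI iffI)
    fix Y assume Y: "Y \<in> {Y \<in> insertions N (a # Z) k. P Y}"
    then have f: "filter (\<lambda>y. y \<noteq> N) Y = a # Z" "length Y = Suc (length Z + k)" "P Y" by (auto simp: insertions_def)
    then obtain y Y' where Y': "Y = y # Y'" by (cases Y) auto
    show "Y \<in> ?A \<union> ?B"
    proof (cases "y = N")
      case True
      then have f': "filter (\<lambda>y. y \<noteq> N) Y' = a # Z" "length Y' = length Z + k" using f Y' by auto
      then have "length Y' \<ge> Suc (length Z)" using length_filter_le[of "\<lambda>y. y \<noteq> N" Y'] by simp
      then have "k \<noteq> 0" using f' by simp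
      then show ?thesis using f' f(3) True Y' by (auto simp: insertions_def)
    next
      case False
      then show ?thesis using f Y' by (auto simp: insertions_def)
    qed
  next
    fix Y assume "Y \<in> ?A \<union> ?B"
    then show "Y \<in> {Y \<in> insertions N (a # Z) k. P Y}"
      using assms by (auto simp: insertions_def split: if_splits)
  qed
  moreover have "finite ?A" "finite ?B" "?A \<inter> ?B = {}" using finite_insertions assms by auto
  ultimately have "card {Y \<in> insertions N (a # Z) k. P Y} = card ?A + card ?B"
    by (simp only: card_Un_disjoint)
  also have "card ?B = card {Y \<in> insertions N Z k. P (a # Y)}" by (simp add: card_image)
  also have "card ?A = (if k = 0 then 0 else card {Y \<in> insertions N (a # Z) (k - 1). P (N # Y)})"
    by (simp add: card_image)
  finally show "ins_fps N (a # Z) P $ k =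
    (fps_X * ins_fps N (a # Z) (\<lambda>Y. P (N # Y)) + ins_fps N Z (\<lambda>Y. P (a # Y))) $ k"
    by (simp add: ins_fps_def fps_X_mult_nth)
qed

lemma ins_fps_False: "ins_fps N Z (\<lambda>_. False) = 0"
  by (rule fps_ext) (simp add: ins_fps_def)

lemma geom_mult: "(1 - fps_X) * geom = 1"
  using geom_eq by algebra

lemma geom_solve: "(g :: real fps) = fps_X * g + h \<Longrightarrow> g = geom * h"
  using geom_mult by algebra

text \<open>Each of the \<open>length Z + 1\<close> gaps takes any number of copies.\<close>

lemma ins_fps_True: "N \<notin> set Z \<Longrightarrow> ins_fps N Z (\<lambda>_. True) = geom ^ Suc (length Z)"
proof (induction Z)
  case Nil
  have "ins_fps N [] (\<lambda>_. True) = geom * 1"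
    by (rule geom_solve) (subst ins_fps_Nil, simp add: add.commute)
  then show ?case by simp
next
  case (Cons a Z)
  have "ins_fps N (a # Z) (\<lambda>_. True) = geom * ins_fps N Z (\<lambda>_. True)"
    by (rule geom_solve) (use Cons.prems in \<open>subst ins_fps_Cons, auto\<close>)
  then show ?case using Cons by simp
qed

abbreviation run :: "nat \<Rightarrow> nat list \<Rightarrow> nat" where
  "run N Y \<equiv> length (takeWhile (\<lambda>y. y \<noteq> N) Y)"

text \<open>For j < \<open>length Z\<close> the first j gaps are empty, the next takes at least one
  copy, and the remaining \<open>length Z - j\<close> gaps are free. For j = \<open>length Z\<close>
  all copies stand at the end.\<close>

lemma ins_fps_run:
  "N \<notin> set Z \<Longrightarrow> ins_fps N Z (\<lambda>Y. run N Y = j) =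
     (if j < length Z then fps_X * geom ^ (length Z - j + 1) else if j = length Z then geom else 0)"
proof (induction Z arbitrary: j)
  case Nil
  have g: "ins_fps N [] (\<lambda>_. True) = geom" using ins_fps_True[of N "[]"] by simp
  show ?case
  proof (cases "j = 0")
    case True
    then have "ins_fps N [] (\<lambda>Y. run N Y = j) = 1 + fps_X * geom"
      by (subst ins_fps_Nil) (simp add: g)
    then show ?thesis using True geom_eq by simp
  next
    case False
    then show ?thesis by (subst ins_fps_Nil) (simp add: ins_fps_False)
  qed
next
  case (Cons a Z)
  then have a: "a \<noteq> N" "N \<notin> set Z" by auto
  show ?case
  proof (cases j)
    case 0
    then show ?thesis using a ins_fps_True[OF Cons.prems]
      by (subst ins_fps_Cons) (simp_all add: ins_fps_False)
  next
    case (Suc i)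
    then show ?thesis using a Cons.IH[of i]
      by (subst ins_fps_Cons) (simp_all add: ins_fps_False)
  qed
qed

text \<open>\<open>reach\<close> skips the first letter and then counts a run. That letter is either
  an inserted N, followed by a run in all of \<open>Z\<close>, or the head of \<open>Z\<close>,
  followed by a run in the rest.\<close>

lemma ins_fps_reach:
  assumes "N \<notin> set Z"
  shows "ins_fps N Z (\<lambda>Y. reach N Y = u) =
    (if u = 0 then of_bool (Z = [])
     else if u < length Z then fps_X * geom ^ (length Z - u + 2)
     else if u = length Z then fps_X ^ 2 * geom ^ 2 + geom
     else if u = Suc (length Z) then fps_X * geom else 0)"
proof (cases Z)
  case Nil
  show ?thesis
  proof (cases u)
    case 0
    then show ?thesis using Nil by (subst Nil, subst ins_fps_Nil) (simp add: ins_fps_False)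
  next
    case (Suc i)
    then show ?thesis using Nil ins_fps_run[of N "[]" i]
      by (subst Nil, subst ins_fps_Nil) (simp add: ins_fps_False)
  qed
next
  case (Cons a Z')
  then have a: "a \<noteq> N" "N \<notin> set Z'" using assms by auto
  show ?thesis
  proof (cases u)
    case 0
    then show ?thesis using Cons a by (subst Cons, subst ins_fps_Cons) (simp_all add: ins_fps_False)
  next
    case (Suc i)
    then have e: "ins_fps N Z (\<lambda>Y. reach N Y = u) =
      fps_X * ins_fps N Z (\<lambda>Y. run N Y = i) + ins_fps N Z' (\<lambda>Y. run N Y = i)"
      unfolding Cons using a by (subst ins_fps_Cons) simp_all
    have l: "length Z = Suc (length Z')" using Cons by simp
    consider "i < length Z'" | "i = length Z'" | "i = Suc (length Z')" | "Suc (length Z') < i" by linarith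
    then show ?thesis
    proof cases
      case 1
      define d where "d = length Z' - i"
      have "fps_X * (fps_X * geom ^ (d + 2)) + fps_X * geom ^ (d + 1) = fps_X * geom ^ (d + 1) * (1 + fps_X * geom)"
        by (simp add: algebra_simps)
      also have "\<dots> = fps_X * geom ^ (d + 2)" by (simp add: geom_eq[symmetric] mult_ac)
      finally show ?thesis using 1 Suc l unfolding e ins_fps_run[OF assms] ins_fps_run[OF a(2)]
        by (simp add: d_def Suc_diff_le)
    next
      case 2
      then show ?thesis using Suc l unfolding e ins_fps_run[OF assms] ins_fps_run[OF a(2)]
        by (simp add: power2_eq_square mult_ac)
    next
      case 3
      then show ?thesis using Suc l unfolding e ins_fps_run[OF assms] ins_fps_run[OF a(2)] by simp
    next
      case 4
      then show ?thesis using Suc l unfolding e ins_fps_run[OF assms] ins_fps_run[OF a(2)] by simp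
    qed
  qed
qed

text \<open>Passage from block length t to block length u, with x marking the copies of the new
  maximum. The block grows, to t + 1, only if two copies stand in front of it and all further ones
  behind it; hence x^2 / (1 - x).\<close>

definition zone_fps :: "nat \<Rightarrow> nat \<Rightarrow> real fps" where
  "zone_fps t u = (if u = 0 then fps_X else if u \<le> t then fps_X * geom ^ (t - u + 2)
     else if u = Suc t then fps_X ^ 2 * geom else 0)"

text \<open>Induction over the letters of \<open>Z\<close> in front of the first N. If N comes
  first, the rest is counted by \<open>ins_fps_reach\<close>; otherwise one letter of
  \<open>Z\<close> is dropped without affecting the new block.\<close>

lemma ins_fps_zone:
  "N \<notin> set Z \<Longrightarrow> ins_fps N Z (\<lambda>Y. N \<in> set Y \<and> reach N (tl (dropWhile (\<lambda>y. y \<noteq> N) Y)) = u) =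
     zone_fps (length Z) u"
proof (induction Z)
  case Nil
  show ?case using ins_fps_reach[OF Nil, of u]
    by (subst ins_fps_Nil) (auto simp: zone_fps_def power2_eq_square mult_ac)
next
  case (Cons a Z)
  then have a: "a \<noteq> N" "N \<notin> set Z" by auto
  let ?t = "length Z"
  have e: "ins_fps N (a # Z) (\<lambda>Y. N \<in> set Y \<and> reach N (tl (dropWhile (\<lambda>y. y \<noteq> N) Y)) = u) =
      fps_X * ins_fps N (a # Z) (\<lambda>Y. reach N Y = u) + zone_fps ?t u"
    using a Cons.IH by (subst ins_fps_Cons) auto
  have g: "fps_X * geom ^ k + fps_X * (fps_X * geom ^ Suc k) = fps_X * geom ^ Suc k" for k
    using geom_eq by (metis (no_types, lifting) distrib_left mult.commute mult.left_commute mult.right_neutral power_Suc)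
  consider "u = 0" | "0 < u" "u \<le> ?t" | "u = Suc ?t" | "u = Suc (Suc ?t)" | "Suc (Suc ?t) < u" by linarith
  then show ?case
  proof cases
    case 2
    then have "Suc ?t - u = Suc (?t - u)" by simp
    then show ?thesis using 2 g[of "?t - u + 2"] unfolding e ins_fps_reach[OF Cons.prems] zone_fps_def
      by (simp add: add.commute)
  next
    case 3
    have "fps_X * (fps_X ^ 2 * geom ^ 2 + geom) + fps_X ^ 2 * geom = fps_X * geom ^ 2"
      using geom_eq by algebra
    then show ?thesis using 3 unfolding e ins_fps_reach[OF Cons.prems] zone_fps_def
      by (simp add: power2_eq_square)
  next
    case 4
    then show ?thesis unfolding e ins_fps_reach[OF Cons.prems] zone_fps_def
      by (simp add: power2_eq_square mult_ac)
  qed (unfold e ins_fps_reach[OF Cons.prems] zone_fps_def, auto)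
qed

lemma card_fibre:
  assumes s: "s \<in> rgf_avoiders" "set s = {..<N}"
  shows "real (card {z \<in> rgf_avoiders. filter (\<lambda>y. y < N) z = s \<and> N \<in> set z \<and> set z \<subseteq> {..N} \<and>
      length z = length s + k \<and> zone z = u}) = zone_fps (zone s) u $ k"
proof -
  obtain a Z b where act: "active N s a Z b" using active_exists[OF s] by blast
  have sd: "s = a @ Z @ b" by (rule activeD(1)[OF act])
  have NZ: "set Z \<subseteq> {..<N}" using s(2) sd by auto
  let ?P = "\<lambda>Y. N \<in> set Y \<and> reach N (tl (dropWhile (\<lambda>y. y \<noteq> N) Y)) = u"
  have "filter (\<lambda>y. y < N) Y = Z \<and> set Y \<subseteq> {..N} \<longleftrightarrow> filter (\<lambda>y. y \<noteq> N) Y = Z" for Y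
  proof -
    have "filter (\<lambda>y. y < N) Y = filter (\<lambda>y. y \<noteq> N) Y" if "set Y \<subseteq> {..N}"
      using that by (intro filter_cong) auto
    moreover have "set Y \<subseteq> {..N}" if "filter (\<lambda>y. y \<noteq> N) Y = Z"
    proof
      fix y assume "y \<in> set Y"
      then have "y = N \<or> y \<in> set Z" using that by auto
      then show "y \<in> {..N}" using NZ by auto
    qed
    ultimately show ?thesis by metis
  qed
  then have eq: "{Y \<in> insertions N Z k. ?P Y} = {Y. filter (\<lambda>y. y < N) Y = Z \<and> N \<in> set Y \<and> set Y \<subseteq> {..N} \<and>
      length Y = length Z + k \<and> reach N (tl (dropWhile (\<lambda>y. y \<noteq> N) Y)) = u}" (is "_ = ?R")
    unfolding insertions_def by blast
  have "{z \<in> rgf_avoiders. filter (\<lambda>y. y < N) z = s \<and> N \<in> set z \<and> set z \<subseteq> {..N} \<and> length z = length s + k \<and> zone z = u} =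
    {z \<in> {z \<in> rgf_avoiders. filter (\<lambda>y. y < N) z = s \<and> N \<in> set z \<and> set z \<subseteq> {..N}}. length z = length s + k \<and> zone z = u}"
    by blast
  also have "\<dots> = (\<lambda>Y. a @ Y @ b) ` ?R"
    unfolding fibre[OF s act] using zone_insert[OF s(2) act] sd by auto
  finally have "card {z \<in> rgf_avoiders. filter (\<lambda>y. y < N) z = s \<and> N \<in> set z \<and> set z \<subseteq> {..N} \<and>
      length z = length s + k \<and> zone z = u} = card ?R"
    by (simp add: card_image inj_on_def)
  also have "\<dots> = card {Y \<in> insertions N Z k. ?P Y}" unfolding eq ..
  finally show ?thesis using ins_fps_zone[of N Z u] NZ zone_active[OF act s(2)]
    by (auto simp: ins_fps_def fps_eq_iff)
qed

section \<open>Recurrence by length and block length\<close>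

definition zone_count :: "nat \<Rightarrow> nat \<Rightarrow> real" where
  "zone_count n u = real (card {s \<in> rgf_avoiders. length s = n \<and> zone s = u})"

lemma zone_le_length: "zone s \<le> length s"
proof -
  have "card {i. i \<le> length s \<and> good (card (set s)) (take i s)} \<le> card {..length s}"
    by (rule card_mono) auto
  then show ?thesis by (simp add: zone_def)
qed

lemma finite_rgf_avoiders_level: "finite {s \<in> rgf_avoiders. length s = n}"
  by (rule finite_subset[OF _ finite_ascent_seq[of n]]) (auto simp: rgf_avoiders_iff)

lemma zone_count_rec:
  assumes "0 < n"
  shows "zone_count n u = (\<Sum>m<n. \<Sum>t\<le>n. zone_count m t * zone_fps t u $ (n - m))"
proof -
  let ?S = "{z \<in> rgf_avoiders. length z = n \<and> zone z = u}"
  let ?T = "\<Union>m<n. {s \<in> rgf_avoiders. length s = m}"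
  \<comment> \<open>The letters of a nonempty \<open>z\<close> are 0 to
    \<open>card (set z) - 1\<close>, so this deletes all copies of the maximum.\<close>
  define parent where "parent z = filter (\<lambda>y. y < card (set z) - 1) z" for z :: "nat list"
  have par: "\<exists>N. set z = {..N} \<and> parent z = filter (\<lambda>y. y < N) z" if "z \<in> rgf_avoiders" "z \<noteq> []" for z
  proof -
    obtain M where M: "set z = {..<M}" using rgf_set[of z] \<open>z \<in> rgf_avoiders\<close> by (auto simp: rgf_avoiders_def)
    then obtain N where "M = Suc N" using \<open>z \<noteq> []\<close> by (cases M) auto
    then show ?thesis using M by (intro exI[of _ N]) (simp add: parent_def lessThan_Suc_atMost)
  qed
  have sub: "parent ` ?S \<subseteq> ?T"
  proof
    fix s assume "s \<in> parent ` ?S"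
    then obtain z where z: "z \<in> rgf_avoiders" "length z = n" "s = parent z" by blast
    then obtain N where N: "set z = {..N}" "s = filter (\<lambda>y. y < N) z" using par[of z] assms by auto
    then have "s \<in> rgf_avoiders" using rgf_avoiders_filter[of z N] z by simp
    moreover have "length s < n" unfolding N(2) z(2)[symmetric]
      by (rule length_filter_less[of N]) (use N(1) in auto)
    ultimately show "s \<in> ?T" by auto
  qed
  have fib: "real (card {z \<in> ?S. parent z = s}) = zone_fps (zone s) u $ (n - length s)" if s: "s \<in> ?T" for s
  proof -
    have sA: "s \<in> rgf_avoiders" "length s < n" using s by auto
    then obtain N where N: "set s = {..<N}" using rgf_set[of s] by (auto simp: rgf_avoiders_def)
    have "{z \<in> ?S. parent z = s} = {z \<in> rgf_avoiders. filter (\<lambda>y. y < N) z = s \<and> N \<in> set z \<and> set z \<subseteq> {..N} \<and>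
      length z = length s + (n - length s) \<and> zone z = u}"
    proof (intro set_eqI iffI)
      fix z assume "z \<in> {z \<in> ?S. parent z = s}"
      then have z: "z \<in> rgf_avoiders" "length z = n" "zone z = u" "parent z = s" by simp_all
      then obtain M where M: "set z = {..M}" "parent z = filter (\<lambda>y. y < M) z" using par[of z] assms by auto
      then have f: "filter (\<lambda>y. y < M) z = s" using z(4) by simp
      then have "set s = {..<M}" using M(1) by auto
      then have "M = N" using N by simp
      moreover have "N \<in> set z" "set z \<subseteq> {..N}" using M(1) \<open>M = N\<close> by simp_all
      ultimately show "z \<in> {z \<in> rgf_avoiders. filter (\<lambda>y. y < N) z = s \<and> N \<in> set z \<and> set z \<subseteq> {..N} \<and>
        length z = length s + (n - length s) \<and> zone z = u}" using z f sA(2) by simp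
    next
      fix z assume z: "z \<in> {z \<in> rgf_avoiders. filter (\<lambda>y. y < N) z = s \<and> N \<in> set z \<and> set z \<subseteq> {..N} \<and>
        length z = length s + (n - length s) \<and> zone z = u}"
      then have "set s \<subseteq> set z" by auto
      then have "set z = {..N}" using z N by (auto simp: order.order_iff_strict)
      then show "z \<in> {z \<in> ?S. parent z = s}" using z sA by (simp add: parent_def)
    qed
    then show ?thesis using card_fibre[OF sA(1) N] by simp
  qed
  have fin: "finite ?S" "finite ?T" using finite_rgf_avoiders_level finite_subset[OF _ finite_rgf_avoiders_level[of n], of ?S] by auto
  have "zone_count n u = (\<Sum>z\<in>?S. 1)" by (simp add: zone_count_def)
  also have "\<dots> = (\<Sum>s\<in>?T. \<Sum>z\<in>{z \<in> ?S. parent z = s}. 1)" by (rule sum.group[symmetric, OF fin sub])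
  also have "\<dots> = (\<Sum>s\<in>?T. zone_fps (zone s) u $ (n - length s))"
    by (rule sum.cong[OF refl], simp only: fib[symmetric]) simp
  also have "\<dots> = (\<Sum>m<n. \<Sum>s\<in>{s \<in> rgf_avoiders. length s = m}. zone_fps (zone s) u $ (n - length s))"
    by (rule sum.UNION_disjoint) (use finite_rgf_avoiders_level in auto)
  also have "\<dots> = (\<Sum>m<n. \<Sum>t\<le>n. zone_count m t * zone_fps t u $ (n - m))"
  proof (rule sum.cong)
    fix m assume "m \<in> {..<n}"
    let ?A = "{s \<in> rgf_avoiders. length s = m}"
    have "(\<Sum>s\<in>?A. zone_fps (zone s) u $ (n - length s)) =
      (\<Sum>t\<le>n. \<Sum>s\<in>{s \<in> ?A. zone s = t}. zone_fps (zone s) u $ (n - length s))"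
    proof (rule sum.group[symmetric])
      show "zone ` ?A \<subseteq> {..n}" using zone_le_length \<open>m \<in> {..<n}\<close> by (auto intro: order_trans[OF zone_le_length])
    qed (use finite_rgf_avoiders_level in auto)
    also have "\<dots> = (\<Sum>t\<le>n. zone_count m t * zone_fps t u $ (n - m))"
    proof (rule sum.cong)
      fix t
      have "(\<Sum>s\<in>{s \<in> ?A. zone s = t}. zone_fps (zone s) u $ (n - length s)) = (\<Sum>s\<in>{s \<in> ?A. zone s = t}. zone_fps t u $ (n - m))"
        by (rule sum.cong) auto
      moreover have "{s \<in> ?A. zone s = t} = {s \<in> rgf_avoiders. length s = m \<and> zone s = t}" by blast
      ultimately show "(\<Sum>s\<in>{s \<in> ?A. zone s = t}. zone_fps (zone s) u $ (n - length s)) =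
        zone_count m t * zone_fps t u $ (n - m)" by (simp add: zone_count_def)
    qed simp
    finally show "(\<Sum>s\<in>?A. zone_fps (zone s) u $ (n - length s)) = (\<Sum>t\<le>n. zone_count m t * zone_fps t u $ (n - m))" .
  qed simp
  finally show ?thesis .
qed

section \<open>Solving the recurrence\<close>

definition ballot_fps :: "nat \<Rightarrow> real fps" where
  "ballot_fps k = Abs_fps (\<lambda>n. ballot n k)"

lemma ballot_fps_0: "ballot_fps 0 = 1"
proof (rule fps_ext)
  fix n show "ballot_fps 0 $ n = 1 $ n" by (cases n) (simp_all add: ballot_fps_def)
qed

lemma ballot_fps_Suc: "ballot_fps (Suc k) = fps_X * ballot_fps k + ballot_fps (Suc (Suc k))"
proof (rule fps_ext)
  fix n show "ballot_fps (Suc k) $ n = (fps_X * ballot_fps k + ballot_fps (Suc (Suc k))) $ n"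
    using ballot_rec[of "n - 1" k] by (cases n) (simp_all add: ballot_fps_def)
qed

text \<open>Generating function of the sequences with zone \<open>u\<close>, see \<open>zone_count_eq\<close>.\<close>

definition zone_series :: "nat \<Rightarrow> real fps" where
  "zone_series u = ballot_fps (2 * u) + ballot_fps (2 * u + 1)"

text \<open>With w = x C, x w^k = w^(k+1) - w^(k+2), so each summand is w^(2t+1) - w^(2t+3).\<close>

lemma sum_zone_series_0: "(\<Sum>t\<le>J. fps_X * zone_series t) = ballot_fps 1 - ballot_fps (2 * J + 3)"
proof (induction J)
  case 0
  show ?case using ballot_fps_Suc[of 0] ballot_fps_Suc[of 1] by (simp add: zone_series_def algebra_simps numeral_eq_Suc)
next
  case (Suc J)
  have "fps_X * zone_series (Suc J) = ballot_fps (2 * J + 3) - ballot_fps (2 * Suc J + 3)"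
    using ballot_fps_Suc[of "2 * J + 2"] ballot_fps_Suc[of "2 * J + 3"]
    by (simp add: zone_series_def algebra_simps numeral_eq_Suc)
  then show ?case using Suc by simp
qed

text \<open>Writes the term as b - \<open>geom\<close> b', where b' is b with t replaced by t + 1;
  weighted by powers of \<open>geom\<close>, such terms telescope.\<close>

lemma zone_series_step:
  "fps_X * geom * zone_series t = ballot_fps (2 * t + 1) + ballot_fps (2 * t + 2) - geom * (ballot_fps (2 * t + 3) + ballot_fps (2 * t + 4))"
proof -
  define a b c d e where "a = ballot_fps (2 * t)" "b = ballot_fps (2 * t + 1)" "c = ballot_fps (2 * t + 2)"
    "d = ballot_fps (2 * t + 3)" "e = ballot_fps (2 * t + 4)"
  have "b = fps_X * a + c" "c = fps_X * b + d" "d = fps_X * c + e"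
    unfolding a_b_c_d_e_def using ballot_fps_Suc[of "2 * t"] ballot_fps_Suc[of "2 * t + 1"] ballot_fps_Suc[of "2 * t + 2"]
    by (simp_all add: numeral_eq_Suc)
  then have "(1 - fps_X) * (b + c) = fps_X * (a + b) + (d + e)" by algebra
  then have "geom * ((1 - fps_X) * (b + c)) = geom * (fps_X * (a + b) + (d + e))" by simp
  moreover have "geom * ((1 - fps_X) * (b + c)) = b + c"
    using geom_mult by (metis mult.assoc mult.commute mult_1)
  moreover have "zone_series t = a + b" by (simp add: zone_series_def a_b_c_d_e_def)
  ultimately show ?thesis unfolding a_b_c_d_e_def[symmetric] by (simp add: algebra_simps)
qed

lemma sum_zone_series_Suc:
  assumes "u \<le> J"
  shows "(\<Sum>t\<in>{u..J}. fps_X * geom ^ (t - u + 2) * zone_series t) =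
    geom * (ballot_fps (2 * u + 1) + ballot_fps (2 * u + 2)) -
    geom ^ (J - u + 2) * (ballot_fps (2 * J + 3) + ballot_fps (2 * J + 4))"
  using assms
proof (induction J rule: dec_induct)
  case base
  have "fps_X * geom ^ 2 * zone_series u = geom * (fps_X * geom * zone_series u)" by (simp add: power2_eq_square mult_ac)
  then show ?case unfolding zone_series_step by (simp add: algebra_simps power2_eq_square)
next
  case (step J)
  have "fps_X * geom ^ (Suc J - u + 2) * zone_series (Suc J) = geom ^ (J - u + 2) * (fps_X * geom * zone_series (Suc J))"
    using step(1) by (simp add: Suc_diff_le mult_ac)
  also have "\<dots> = geom ^ (J - u + 2) * (ballot_fps (2 * J + 3) + ballot_fps (2 * J + 4)) -
     geom ^ (Suc J - u + 2) * (ballot_fps (2 * Suc J + 3) + ballot_fps (2 * Suc J + 4))"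
    unfolding zone_series_step using step(1) by (simp add: algebra_simps Suc_diff_le numeral_eq_Suc)
  finally show ?case using step by simp
qed

lemma ballot_fps_mult_nth: "n < k \<Longrightarrow> (f * ballot_fps k) $ n = 0"
  unfolding fps_mult_nth by (rule sum.neutral) (auto simp: ballot_fps_def ballot_eq_0)

text \<open>The series form of \<open>zone_count_rec\<close>. For u > 0 the sources are t = u - 1
  and all t >= u; the latter telescope, and \<open>mid\<close> says that both together make
  \<open>zone_series u\<close>.\<close>

lemma zone_series_rec:
  "zone_series u $ n = of_bool (u = 0 \<and> n = 0) + (\<Sum>t\<le>n. (zone_series t * zone_fps t u) $ n)"
proof (cases u)
  case 0
  have "(\<Sum>t\<le>n. (zone_series t * zone_fps t u) $ n) = (\<Sum>t\<le>n. fps_X * zone_series t) $ n"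
    using 0 by (simp add: zone_fps_def fps_sum_nth mult.commute)
  also have "\<dots> = ballot_fps 1 $ n" unfolding sum_zone_series_0 using ballot_fps_mult_nth[of n "2 * n + 3" 1] by simp
  finally show ?thesis using 0 by (auto simp: zone_series_def ballot_fps_0)
next
  case (Suc v)
  have mid: "zone_series u = geom * (fps_X ^ 2 * zone_series v + ballot_fps (2 * u + 1) + ballot_fps (2 * u + 2))"
  proof -
    define a b c d e where "a = ballot_fps (2 * v)" "b = ballot_fps (2 * v + 1)" "c = ballot_fps (2 * v + 2)"
      "d = ballot_fps (2 * v + 3)" "e = ballot_fps (2 * v + 4)"
    have "b = fps_X * a + c" "c = fps_X * b + d" "d = fps_X * c + e"
      unfolding a_b_c_d_e_def using ballot_fps_Suc[of "2 * v"] ballot_fps_Suc[of "2 * v + 1"] ballot_fps_Suc[of "2 * v + 2"]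
      by (simp_all add: numeral_eq_Suc)
    then have "(1 - fps_X) * (c + d) = fps_X ^ 2 * (a + b) + d + e" by algebra
    moreover have "zone_series v = a + b" "zone_series u = c + d" "ballot_fps (2 * u + 1) = d" "ballot_fps (2 * u + 2) = e"
      using Suc by (simp_all add: zone_series_def a_b_c_d_e_def numeral_eq_Suc)
    ultimately have "(1 - fps_X) * zone_series u = fps_X ^ 2 * zone_series v + ballot_fps (2 * u + 1) + ballot_fps (2 * u + 2)"
      by simp
    then show ?thesis using geom_mult by (metis mult.assoc mult.commute mult_1)
  qed
  \<comment> \<open>Large enough to include u and to push the telescoped remainder beyond order
    n.\<close>
  define J where "J = n + u"
  have ext: "(\<Sum>t\<le>n. (zone_series t * zone_fps t u) $ n) = (\<Sum>t\<le>J. zone_series t * zone_fps t u) $ n"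
  proof -
    have "(zone_series t * zone_fps t u) $ n = 0" if "n < t" for t
      using that ballot_fps_mult_nth[of n "2 * t" "zone_fps t u"] ballot_fps_mult_nth[of n "2 * t + 1" "zone_fps t u"]
      by (simp add: zone_series_def mult.commute[of _ "zone_fps t u"] distrib_left)
    then show ?thesis unfolding fps_sum_nth
      by (intro sum.mono_neutral_left) (auto simp: J_def)
  qed
  have "(\<Sum>t\<le>J. zone_series t * zone_fps t u) = (\<Sum>t\<in>{v..J}. zone_series t * zone_fps t u)"
    by (rule sum.mono_neutral_right) (auto simp: zone_fps_def Suc)
  also have "\<dots> = zone_series v * zone_fps v u + (\<Sum>t\<in>{u..J}. zone_series t * zone_fps t u)"
    using Suc by (simp add: sum.atLeast_Suc_atMost J_def)
  also have "(\<Sum>t\<in>{u..J}. zone_series t * zone_fps t u) = (\<Sum>t\<in>{u..J}. fps_X * geom ^ (t - u + 2) * zone_series t)"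
    by (rule sum.cong) (auto simp: zone_fps_def Suc mult_ac)
  also have "zone_series v * zone_fps v u = geom * (fps_X ^ 2 * zone_series v)" using Suc by (simp add: zone_fps_def mult_ac)
  also have "(\<Sum>t\<in>{u..J}. fps_X * geom ^ (t - u + 2) * zone_series t) =
    geom * (ballot_fps (2 * u + 1) + ballot_fps (2 * u + 2)) -
    geom ^ (J - u + 2) * (ballot_fps (2 * J + 3) + ballot_fps (2 * J + 4))"
    by (rule sum_zone_series_Suc) (simp add: J_def)
  finally have "(\<Sum>t\<le>J. zone_series t * zone_fps t u) = zone_series u - geom ^ (J - u + 2) * (ballot_fps (2 * J + 3) + ballot_fps (2 * J + 4))"
    unfolding mid by (simp add: algebra_simps)
  moreover have "(geom ^ (J - u + 2) * (ballot_fps (2 * J + 3) + ballot_fps (2 * J + 4))) $ n = 0"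
    unfolding distrib_left fps_add_nth by (simp add: ballot_fps_mult_nth J_def del: fps_mult_nth)
  ultimately show ?thesis unfolding ext using Suc by simp
qed

lemma zone_count_eq: "zone_count n u = zone_series u $ n"
proof (induction n arbitrary: u rule: less_induct)
  case (less n)
  show ?case
  proof (cases "n = 0")
    case True
    have "{s \<in> rgf_avoiders. length s = 0 \<and> zone s = u} = (if u = 0 then {[]} else {})"
      by (auto simp: rgf_avoiders_Nil zone_def good_def)
    then show ?thesis using True by (simp add: zone_count_def zone_series_def ballot_fps_def)
  next
    case False
    have "zone_count n u = (\<Sum>t\<le>n. \<Sum>m<n. zone_count m t * zone_fps t u $ (n - m))"
      using False by (subst zone_count_rec) (simp, rule sum.swap)
    also have "\<dots> = (\<Sum>t\<le>n. (zone_series t * zone_fps t u) $ n)"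
    proof (rule sum.cong)
      fix t
      have "zone_fps t u $ 0 = 0" by (simp add: zone_fps_def)
      then have "(zone_series t * zone_fps t u) $ n = (\<Sum>m<n. zone_series t $ m * zone_fps t u $ (n - m))"
        unfolding fps_mult_nth by (simp add: atLeast0AtMost lessThan_Suc_atMost[symmetric])
      then show "(\<Sum>m<n. zone_count m t * zone_fps t u $ (n - m)) = (zone_series t * zone_fps t u) $ n"
        using less by simp
    qed simp
    also have "\<dots> = zone_series u $ n" using zone_series_rec[of u n] False by simp
    finally show ?thesis .
  qed
qed

text \<open>A factor x turns the total over all block lengths into the telescoping sum
  \<open>sum_zone_series_0\<close>, whose main term is x C; hence the shift to
  \<open>Suc n\<close>.\<close>

lemma card_rgf_avoiders: "real (card {s \<in> rgf_avoiders. length s = n}) = catalan n"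
proof -
  let ?A = "{s \<in> rgf_avoiders. length s = n}"
  have "real (card ?A) = (\<Sum>s\<in>?A. 1)" by simp
  also have "\<dots> = (\<Sum>u\<le>n. \<Sum>s\<in>{s \<in> ?A. zone s = u}. 1)"
    by (rule sum.group[symmetric]) (use finite_rgf_avoiders_level zone_le_length in auto)
  also have "\<dots> = (\<Sum>u\<le>n. zone_count n u)"
    by (rule sum.cong) (auto simp: zone_count_def intro!: arg_cong[where f = card])
  also have "\<dots> = (\<Sum>u\<le>n. fps_X * zone_series u) $ Suc n" by (simp add: zone_count_eq fps_sum_nth)
  also have "\<dots> = ballot (Suc n) 1"
    unfolding sum_zone_series_0 by (simp add: ballot_fps_def ballot_eq_0)
  finally show ?thesis by (simp only: ballot_1)
qed

theorem theorem1:
  shows "(\<forall>n \<ge> 1. \<forall>(u, v) \<in> {([0,0,0,1],[1,0,1,2]), ([0,0,1,0],[0,0,2,1]),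
                        ([0,0,1,1],[0,0,2,1]), ([0,0,2,1],[0,1,2,1]),
                        ([0,1,2,1],[0,1,3,2]), ([0,1,2,1],[1,0,3,2]),
                        ([0,1,2,2],[0,1,3,2]), ([0,1,2,2],[1,0,3,2])}.
            real (S {u, v} n) = catalan n)
       \<and> (\<forall>n \<ge> 1. \<forall>m < n. \<forall>(u, v) \<in> {([0,0,2,1],[0,1,2,1]),
                        ([0,1,2,1],[0,1,3,2]), ([0,1,2,1],[1,0,3,2]),
                        ([0,1,2,2],[0,1,3,2]), ([0,1,2,2],[1,0,3,2])}.
            real (Sm {u, v} n m) = narayana n (m + 1))"
proof (intro conjI allI impI)
  fix n :: nat assume "1 \<le> n"
  then have "0 < n" by simp
  then show "\<forall>(u, v) \<in> {([0,0,0,1],[1,0,1,2]), ([0,0,1,0],[0,0,2,1]),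
                        ([0,0,1,1],[0,0,2,1]), ([0,0,2,1],[0,1,2,1]),
                        ([0,1,2,1],[0,1,3,2]), ([0,1,2,1],[1,0,3,2]),
                        ([0,1,2,2],[0,1,3,2]), ([0,1,2,2],[1,0,3,2])}.
            real (S {u, v} n) = catalan n"
    using card_rgf_avoiders[of n] weak.card_level[of n] strict.card_level[of n] weakly_incr.card_level[of n] strictly_incr.card_level[of n]
    by (simp only: S_def Sset_eq_rgf_avoiders Sset_eq_weak Sset_eq_strict Sset_eq_weakly_incr Sset_eq_strictly_incr
        ball_simps case_prod_conv)
next
  fix n m :: nat assume "1 \<le> n" "m < n"
  then have "0 < n" by simp
  have c: "{s \<in> {s \<in> K. length s = n}. asc s = m} = {s \<in> K. length s = n \<and> asc s = m}" for K by blast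
  show "\<forall>(u, v) \<in> {([0,0,2,1],[0,1,2,1]),
                        ([0,1,2,1],[0,1,3,2]), ([0,1,2,1],[1,0,3,2]),
                        ([0,1,2,2],[0,1,3,2]), ([0,1,2,2],[1,0,3,2])}.
            real (Sm {u, v} n m) = narayana n (m + 1)"
    using weakly_incr.card_asc[OF \<open>0 < n\<close> \<open>m < n\<close>] strictly_incr.card_asc[OF \<open>0 < n\<close> \<open>m < n\<close>]
    by (simp only: Sm_def Sset_eq_weakly_incr Sset_eq_strictly_incr c ball_simps case_prod_conv)
qed

end
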